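(* Let $(S_n)_{n\ge 0}$ be an ERWG process with any memory matrix $B$ (not necessarily diagonalisable), and suppose $\eta<\frac12$. Then, with probability 1, the sequence $\frac{S_n}{\sqrt{2n\log\log n}}$ is relatively compact and its set of limit points is the ellipsoid $$E:=\big\{x\in\mathbb{R}^k: x(\Sigma^{(1)})^{-1}x'\le1\big\},\qquad \Sigma^{(1)}=\int_0^\infty e^{(B-\frac12I)'t}e^{(B-\frac12I)t}\,dt.$$
   Context: ERWG model. Let $k\ge1$, $V=\{1,\dots,k\}$, and let $(V,\overrightarrow{E})$, $\overrightarrow{E}\subseteq V\times V$, be a directed graph (self-loops allowed) in which every vertex $j$ has in-degree $d_j^{\rm in}=|\{i:(i,j)\in\overrightarrow{E}\}|\ge1$. Let $p_v,q_v\in[0,1]$ for $v\in V$. $\mathrm{Rad}(p)$ is the law on $\{-1,1\}$ giving mass $p$ to $1$. Let $\{\sigma^{(v)},\xi_n^{(v)},D_n^{(v)},u_n^{(v)}: n\ge1,v\in V\}$ be independent with $\sigma^{(v)}\sim\mathrm{Rad}(q_v)$, $\xi_n^{(v)}\sim\mathrm{Rad}(p_v)$, $D_n^{(v)}\sim\mathrm{Unif}\{1,\dots,n\}$, $u_n^{(v)}\sim\mathrm{Unif}\{v':(v',v)\in\overrightarrow{E}\}$. Define $X_1^{(v)}=\sigma^{(v)}$ and, for $n\ge1$, $X_{n+1}^{(v)}=\xi_n^{(v)}X^{(u_n^{(v)})}_{D_n^{(v)}}$; set $X_n=(X_n^{(1)},\dots,X_n^{(k)})$, $S_0=0$, $S_n=\sum_{j=1}^nX_j$.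 The process $(S_n)$ is called the ERWG process. Its memory matrix is the $k\times k$ matrix $B$ with $B_{i,j}=\frac{2p_j-1}{d_j^{\rm in}}\mathbf{1}_{\{(i,j)\in\overrightarrow{E}\}}$. Let $\lambda_1,\dots,\lambda_k$ be the eigenvalues of $B$ (with multiplicity) and $\eta=\max_j\Re(\lambda_j)$. All vectors are row vectors; $A'$ is the transpose of $A$ and $I$ the identity. *)

theory Defs
  imports "HOL-Probability.Probability"
begin

section \<open>Matrices\<close>

text \<open>On the type \<open>real^'n^'n\<close> the operations \<open>*\<close> and \<open>^\<close> act entrywise, and the type has no
  \<open>exp\<close>; hence the exponential series is written out with the matrix product \<open>**\<close>.\<close>

definition matrix_exp :: "real^'n^'n \<Rightarrow> real^'n^'n" where
  "matrix_exp A = (\<Sum>m. (1 / fact m) *\<^sub>R (((**) A) ^^ m) (mat 1))"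

definition complex_matrix :: "real^'n^'m \<Rightarrow> complex^'n^'m" where
  "complex_matrix A = (\<chi> i j. complex_of_real (A $ i $ j))"

definition eigenvalues :: "complex^'n^'n \<Rightarrow> complex set" where
  "eigenvalues A = {l. \<exists>x. x \<noteq> 0 \<and> A *v x = l *s x}"

text \<open>Multiplicities are irrelevant for the maximum, so it is taken over the set of eigenvalues,
  which is finite and nonempty.\<close>

definition max_Re_eigenvalue :: "real^'n^'n \<Rightarrow> real" where
  "max_Re_eigenvalue A = Max (Re ` eigenvalues (complex_matrix A))"


section \<open>Limit points of a sequence\<close>

text \<open>These are the limits of subsequences. In contrast to \<open>islimpt\<close> applied to the range, a value
  taken infinitely often is a limit point.\<close>

definition seq_limit_points :: "(nat \<Rightarrow> 'a::topological_space) \<Rightarrow> 'a set" where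
  "seq_limit_points x = {l. \<exists>r. strict_mono (r :: nat \<Rightarrow> nat) \<and> (x \<circ> r) \<longlonglongrightarrow> l}"


section \<open>The ERWG process\<close>

text \<open>The vertex set \<open>{1, \<dots>, k}\<close> is the universe of a finite type \<open>'k\<close>. The pair \<open>(i, j) \<in> E\<close> is
  an edge from \<open>i\<close> to \<open>j\<close>.\<close>

definition in_neighbours :: "('k \<times> 'k) set \<Rightarrow> 'k \<Rightarrow> 'k set" where
  "in_neighbours E j = {i. (i, j) \<in> E}"

definition in_degree :: "('k \<times> 'k) set \<Rightarrow> 'k \<Rightarrow> nat" where
  "in_degree E j = card (in_neighbours E j)"

definition memory_matrix :: "('k::finite \<times> 'k) set \<Rightarrow> ('k \<Rightarrow> real) \<Rightarrow> real^'k^'k" where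
  "memory_matrix E p =
     (\<chi> i j. if (i, j) \<in> E then (2 * p j - 1) / real (in_degree E j) else 0)"

definition rad_pmf :: "real \<Rightarrow> int pmf" where
  "rad_pmf p = map_pmf (\<lambda>b. if b then 1 else - 1) (bernoulli_pmf p)"

text \<open>Names for the members of the driving family \<open>\<sigma>\<^sup>(\<^sup>v\<^sup>)\<close>, \<open>\<xi>\<^sub>n\<^sup>(\<^sup>v\<^sup>)\<close>, \<open>D\<^sub>n\<^sup>(\<^sup>v\<^sup>)\<close>, \<open>u\<^sub>n\<^sup>(\<^sup>v\<^sup>)\<close>.\<close>

datatype 'k driver = Init 'k | Flip nat 'k | Time nat 'k | Source nat 'k

definition drivers :: "'k driver set" where
  "drivers = range Init \<union>
     {i. \<exists>n\<ge>1. \<exists>v. i = Flip n v \<or> i = Time n v \<or> i = Source n v}"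

text \<open>Since \<open>indep_vars\<close> needs a common value type, the integer-, time- and vertex-valued drivers
  are injected into a disjoint sum. The injections do not change the generated \<open>\<sigma>\<close>-algebras, so
  joint independence is not affected.\<close>

fun driver_var ::
  "('k \<Rightarrow> 'a \<Rightarrow> int) \<Rightarrow> (nat \<Rightarrow> 'k \<Rightarrow> 'a \<Rightarrow> int) \<Rightarrow> (nat \<Rightarrow> 'k \<Rightarrow> 'a \<Rightarrow> nat) \<Rightarrow>
   (nat \<Rightarrow> 'k \<Rightarrow> 'a \<Rightarrow> 'k) \<Rightarrow> 'k driver \<Rightarrow> 'a \<Rightarrow> int + nat + 'k" where
  "driver_var \<sigma> \<xi> D u (Init v) \<omega> = Inl (\<sigma> v \<omega>)"
| "driver_var \<sigma> \<xi> D u (Flip n v) \<omega> = Inl (\<xi> n v \<omega>)"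
| "driver_var \<sigma> \<xi> D u (Time n v) \<omega> = Inr (Inl (D n v \<omega>))"
| "driver_var \<sigma> \<xi> D u (Source n v) \<omega> = Inr (Inr (u n v \<omega>))"

text \<open>\<open>X n v \<omega>\<close> is the step of walker \<open>v\<close> at time \<open>n \<ge> 1\<close>; \<open>X 0\<close> is unconstrained and unused.
  The steps are determined almost surely by the drivers, because \<open>D n v\<close> lies in \<open>{1..n}\<close> almost
  surely.\<close>

locale erwg = prob_space M
  for M :: "'a measure" +
  fixes E :: "('k::finite \<times> 'k) set"
    and p q :: "'k \<Rightarrow> real"
    and \<sigma> :: "'k \<Rightarrow> 'a \<Rightarrow> int"
    and \<xi> :: "nat \<Rightarrow> 'k \<Rightarrow> 'a \<Rightarrow> int"
    and D :: "nat \<Rightarrow> 'k \<Rightarrow> 'a \<Rightarrow> nat"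
    and u :: "nat \<Rightarrow> 'k \<Rightarrow> 'a \<Rightarrow> 'k"
    and X :: "nat \<Rightarrow> 'k \<Rightarrow> 'a \<Rightarrow> int"
  assumes in_degree_pos: "\<And>j. in_degree E j \<ge> 1"
    and p_range: "\<And>v. p v \<in> {0..1}"
    and q_range: "\<And>v. q v \<in> {0..1}"
    and indep: "indep_vars (\<lambda>_. count_space UNIV) (driver_var \<sigma> \<xi> D u) drivers"
    and distr_\<sigma>: "\<And>v. distr M (count_space UNIV) (\<sigma> v) = measure_pmf (rad_pmf (q v))"
    and distr_\<xi>: "\<And>n v. n \<ge> 1 \<Longrightarrow>
          distr M (count_space UNIV) (\<xi> n v) = measure_pmf (rad_pmf (p v))"
    and distr_D: "\<And>n v. n \<ge> 1 \<Longrightarrow>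
          distr M (count_space UNIV) (D n v) = measure_pmf (pmf_of_set {1..n})"
    and distr_u: "\<And>n v. n \<ge> 1 \<Longrightarrow>
          distr M (count_space UNIV) (u n v) = measure_pmf (pmf_of_set (in_neighbours E v))"
    and X_1: "\<And>v \<omega>. \<omega> \<in> space M \<Longrightarrow> X 1 v \<omega> = \<sigma> v \<omega>"
    and X_Suc: "\<And>n v \<omega>. n \<ge> 1 \<Longrightarrow> \<omega> \<in> space M \<Longrightarrow>
          X (Suc n) v \<omega> = \<xi> n v \<omega> * X (D n v \<omega>) (u n v \<omega>) \<omega>"

definition erwg_sum :: "(nat \<Rightarrow> 'k::finite \<Rightarrow> 'a \<Rightarrow> int) \<Rightarrow> nat \<Rightarrow> 'a \<Rightarrow> real^'k" where
  "erwg_sum X n \<omega> = (\<Sum>j=1..n. \<chi> v. real_of_int (X j v \<omega>))"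

definition lil_seq :: "(nat \<Rightarrow> 'k::finite \<Rightarrow> 'a \<Rightarrow> int) \<Rightarrow> 'a \<Rightarrow> nat \<Rightarrow> real^'k" where
  "lil_seq X \<omega> n = (1 / sqrt (2 * real n * ln (ln (real n)))) *\<^sub>R erwg_sum X n \<omega>"

definition limit_cov :: "real^'k^'k \<Rightarrow> real^'k^'k" where
  "limit_cov B = integral {0..} (\<lambda>t.
     matrix_exp (t *\<^sub>R transpose (B - (1/2) *\<^sub>R mat 1)) ** matrix_exp (t *\<^sub>R (B - (1/2) *\<^sub>R mat 1)))"

text \<open>The row-vector expression \<open>x C\<^sup>-\<^sup>1 x'\<close> is \<open>(x v* C\<^sup>-\<^sup>1) \<bullet> x\<close>.\<close>

definition cov_ellipsoid :: "real^'k^'k \<Rightarrow> (real^'k) set" where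
  "cov_ellipsoid C = {x. (x v* matrix_inv C) \<bullet> x \<le> 1}"

end

theory Submission
  imports Defs "HOL-Real_Asymp.Real_Asymp" "HOL-Computational_Algebra.Fundamental_Theorem_Algebra"
begin

section \<open>Law of the iterated logarithm for the ERWG process\<close>

text \<open>
  Put \<open>V x = x \<bullet> (\<Sigma> x)\<close>. Integrating the derivative of \<open>(norm (e\<^sup>t\<^sup>A x))\<^sup>2\<close>, with \<open>A = B - I/2\<close>, gives the
  Lyapunov equation \<open>2 x \<bullet> (\<Sigma> (B x)) = V x - x \<bullet> x\<close>. The conditional mean of \<open>x \<bullet> S\<^sub>n\<^sub>+\<^sub>1\<close> is \<open>(x + B x / n) \<bullet> S\<^sub>n\<close>,
  so iterating the one-step exponential moments of signs produces quadratic forms that the Lyapunov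
  equation compares with \<open>n V x\<close>: conditionally on the past, \<open>ln E exp (x \<bullet> S\<^sub>n)\<close> is \<open>n V x / 2\<close> up to a factor
  tending to 1.

  The upper bound, valid without restriction on the drift, and the maximal inequality along geometric
  blocks give \<open>limsup x \<bullet> S\<^sub>n / sqrt (2 n ln (ln n)) \<le> 1\<close> whenever \<open>V x \<le> 1\<close>. For the converse the two-sided
  estimate along \<open>n = r!\<close> allows exponential tilting by \<open>\<theta>\<close> with \<open>V \<theta> < 1\<close>: given the past, the normalised
  sum is near \<open>\<Sigma> \<theta>\<close> with probability at least \<open>(ln n) powr (- g)\<close> for some \<open>g < 1\<close>. The exponents sum to
  infinity, and a conditional Borel--Cantelli argument makes these events happen infinitely often.
\<close>

subsection \<open>Quadratic forms solving the Lyapunov equation\<close>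

text \<open>Because of the drift, \<open>x \<bullet> S n\<close> is not a martingale, but its
  prediction at a later time \<open>N\<close>, namely \<open>R n (N - n) x \<bullet> S n\<close>, is
  one for \<open>n \<le> N\<close>. The maximal inequality therefore concerns predictions, and short
  blocks are needed to return to \<open>x \<bullet> S n\<close>.

  Positive definiteness of \<open>G\<close> together with the Lyapunov equation yields an exponent
  \<open>s > 0\<close> such that \<open>V\<close> of a prediction grows at most like
  \<open>(N / n) powr (1 - s)\<close>. Relative to \<open>N * V x\<close>, the first
  \<open>n\<close> steps thus weigh at most \<open>(n / N) powr s\<close>.

  The times \<open>r!\<close> reconcile two opposite demands: the ratio of consecutive times tends
  to infinity, so the past is forgotten, while \<open>ln (r!)\<close> is at most
  \<open>r * ln r\<close>, so probabilities of order \<open>(ln n) powr (- g)\<close> with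
  \<open>g < 1\<close> still have a divergent sum.

  All moment estimates carry a nonnegative weight \<open>Z\<close> depending on the past. With
  indicators for \<open>Z\<close> they become conditional estimates that hold uniformly over past
  events.\<close>

locale lyapunov =
  fixes B G :: "real^'k^'k"
  assumes G_sym: "x \<bullet> (G *v y) = y \<bullet> (G *v x)"
    and G_pos: "x \<noteq> 0 \<Longrightarrow> 0 < x \<bullet> (G *v x)"
    and G_lyapunov: "2 * (x \<bullet> (G *v (B *v x))) = x \<bullet> (G *v x) - x \<bullet> x"
begin

definition V :: "real^'k \<Rightarrow> real" where
  "V x = x \<bullet> (G *v x)"

lemma V_scale: "V (a *\<^sub>R x) = a\<^sup>2 * V x"
  by (simp add: V_def matrix_vector_mult_scaleR power2_eq_square)

lemma V_add: "V (x + y) = V x + 2 * (x \<bullet> (G *v y)) + V y"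
  using G_sym[of x y]
  by (simp add: V_def matrix_vector_right_distrib inner_add_left inner_add_right)

lemma V_zero [simp]: "V 0 = 0"
  by (simp add: V_def)

lemma V_uminus [simp]: "V (- x) = V x"
  using V_scale[of "-1" x] by simp

lemma V_nonneg: "0 \<le> V x"
  using G_pos[of x] by (cases "x = 0") (auto simp: V_def)

text \<open>Parallelogram law, with the nonnegative \<open>V (x - y)\<close> dropped.\<close>

lemma V_add_le: "V (x + y) \<le> 2 * V x + 2 * V y"
proof -
  have "V (x + (-1) *\<^sub>R y) = V x + 2 * (x \<bullet> (G *v ((-1) *\<^sub>R y))) + V ((-1) *\<^sub>R y)"
    by (rule V_add)
  also have "\<dots> = V x - 2 * (x \<bullet> (G *v y)) + V y"
    by (simp only: V_scale matrix_vector_mult_scaleR) simp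
  finally show ?thesis
    using V_add[of x y] V_nonneg[of "x + (-1) *\<^sub>R y"] by linarith
qed

lemma continuous_V: "continuous_on A V"
  unfolding V_def by (intro continuous_intros matrix_vector_mult_linear_continuous_on)

section \<open>Comparison of \<open>V\<close> with the Euclidean norm and with
  \<open>B\<close>\<close>

lemma V_upper: "\<exists>C>0. \<forall>x. V x \<le> C * (norm x)\<^sup>2"
proof (intro exI conjI allI)
  fix x
  have "V x \<le> norm x * norm (G *v x)" unfolding V_def by (rule norm_cauchy_schwarz)
  also have "\<dots> \<le> norm x * (onorm ((*v) G) * norm x)"
    by (intro mult_left_mono onorm matrix_vector_mul_bounded_linear norm_ge_zero)
  also have "\<dots> \<le> (onorm ((*v) G) + 1) * (norm x)\<^sup>2"
    by (simp add: power2_eq_square algebra_simps)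
  finally show "V x \<le> (onorm ((*v) G) + 1) * (norm x)\<^sup>2" .
next
  show "0 < onorm ((*v) G) + 1"
    using onorm_pos_le[OF matrix_vector_mul_bounded_linear[of G]] by linarith
qed

text \<open>\<open>V\<close> has a positive minimum on the unit sphere, and both sides are
  homogeneous of degree 2.\<close>

lemma V_lower: "\<exists>C>0. \<forall>x. (norm x)\<^sup>2 \<le> C * V x"
proof -
  have "compact (sphere (0::real^'k) 1)" "sphere (0::real^'k) 1 \<noteq> {}" by auto
  from continuous_attains_inf[OF this continuous_V]
  obtain z where z: "z \<in> sphere 0 1" "\<forall>y\<in>sphere 0 1. V z \<le> V y" by blast
  then have Vz: "V z > 0" unfolding V_def by (intro G_pos) auto
  have "(norm x)\<^sup>2 \<le> 1 / V z * V x" for x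
  proof (cases "x = 0")
    case False
    then have "x /\<^sub>R norm x \<in> sphere 0 1" by simp
    then have "V z \<le> V (x /\<^sub>R norm x)" using z by blast
    also have "\<dots> = V x / (norm x)\<^sup>2" by (simp add: V_scale power_divide field_simps)
    finally show ?thesis using Vz False by (simp add: field_simps)
  qed simp
  then show ?thesis using Vz by (intro exI[of _ "1 / V z"]) simp
qed

definition C1 where "C1 = (SOME C. C > 0 \<and> (\<forall>x. V x \<le> C * (norm x)\<^sup>2))"
definition C2 where "C2 = (SOME C. C > 0 \<and> (\<forall>x. (norm x)\<^sup>2 \<le> C * V x))"

lemma C1: "C1 > 0" "V x \<le> C1 * (norm x)\<^sup>2"
  using someI_ex[OF V_upper, folded C1_def] by auto

lemma C2: "C2 > 0" "(norm x)\<^sup>2 \<le> C2 * V x"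
  using someI_ex[OF V_lower, folded C2_def] by auto

definition b where "b = onorm ((*v) B)"

lemma b: "b \<ge> 0" "norm (B *v x) \<le> b * norm x"
  unfolding b_def
  by (auto intro!: onorm_pos_le onorm matrix_vector_mul_bounded_linear)

definition C3 where "C3 = C1 * b\<^sup>2"

lemma C3: "C3 \<ge> 0" "V (B *v x) \<le> C3 * (norm x)\<^sup>2"
proof -
  show "C3 \<ge> 0" using C1(1) by (simp add: C3_def)
  have "V (B *v x) \<le> C1 * (norm (B *v x))\<^sup>2" by (rule C1)
  also have "\<dots> \<le> C1 * (b * norm x)\<^sup>2"
    using b C1(1) by (intro mult_left_mono power_mono) auto
  finally show "V (B *v x) \<le> C3 * (norm x)\<^sup>2" by (simp add: C3_def power_mult_distrib)
qed

section \<open>Backward propagation of linear functionals and of their variance\<close>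

definition T :: "nat \<Rightarrow> real^'k \<Rightarrow> real^'k" where
  "T n x = x + (1 / real n) *\<^sub>R (B *v x)"

lemma T_scale: "T n (a *\<^sub>R x) = a *\<^sub>R T n x"
  by (simp add: T_def matrix_vector_mult_scaleR algebra_simps)

text \<open>The Lyapunov equation turns the cross term of \<open>V (T n x)\<close> into
  \<open>(V x - x \<bullet> x) / n\<close>. Hence the difference between
  \<open>(n + 1) * V x\<close> and \<open>n * V (T n x)\<close> is the variance
  \<open>(norm x)\<^sup>2\<close> of one step, up to an error of order \<open>1 / n\<close>. This is
  the telescoping that evaluates \<open>q\<close>.\<close>

lemma V_T: "n \<ge> 1 \<Longrightarrow> n * V (T n x) = (n + 1) * V x - (norm x)\<^sup>2 + V (B *v x) / n"
proof -
  assume n: "n \<ge> 1"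
  have "V (T n x) = V x + (2 * (x \<bullet> (G *v (B *v x)))) / n + V (B *v x) / n\<^sup>2"
    by (simp add: T_def V_add V_scale matrix_vector_mult_scaleR power_divide)
  also have "\<dots> = V x + (V x - (norm x)\<^sup>2) / n + V (B *v x) / n\<^sup>2"
    unfolding G_lyapunov V_def by (simp add: dot_square_norm)
  finally show ?thesis using n by (simp add: field_simps power2_eq_square)
qed

text \<open>\<open>R n d x\<close> is \<open>T n (T (n + 1) (... (T (n + d - 1) x)))\<close>, the
  functional whose value at \<open>S n\<close> predicts \<open>x \<bullet> S (n + d)\<close>. New
  factors are added on the outside, so inductions on \<open>d\<close> move \<open>n\<close>
  upwards.\<close>

fun R :: "nat \<Rightarrow> nat \<Rightarrow> real^'k \<Rightarrow> real^'k" where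
  "R n 0 x = x"
| "R n (Suc d) x = T n (R (Suc n) d x)"

text \<open>The sum of \<open>(norm (R j (n + d - j) x))\<^sup>2\<close> over
  \<open>n < j \<le> n + d\<close>: the variance that the steps after \<open>n\<close> add to the
  prediction, each sign being counted with variance 1.\<close>

fun q :: "nat \<Rightarrow> nat \<Rightarrow> real^'k \<Rightarrow> real" where
  "q n 0 x = 0"
| "q n (Suc d) x = (norm (R (Suc n) d x))\<^sup>2 + q (Suc n) d x"

lemma R_scale: "R n d (a *\<^sub>R x) = a *\<^sub>R R n d x"
  by (induction d arbitrary: n) (simp_all add: T_scale)

lemma q_nonneg: "0 \<le> q n d x"
  by (induction d arbitrary: n) simp_all

lemma q_lower:
  "n \<ge> 1 \<Longrightarrow> q n d x \<ge> (real n + d) * V x - n * V (R n d x)"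
proof (induction d arbitrary: n)
  case (Suc d)
  have "q (Suc n) d x \<ge> (real (Suc n) + d) * V x - real (Suc n) * V (R (Suc n) d x)"
    by (rule Suc.IH) simp
  moreover have "n * V (R n (Suc d) x) \<ge> (n + 1) * V (R (Suc n) d x) - (norm (R (Suc n) d x))\<^sup>2"
    using V_T[of n "R (Suc n) d x"] divide_nonneg_nonneg[OF V_nonneg[of "B *v R (Suc n) d x"], of "real n"]
      Suc.prems by (simp add: algebra_simps)
  ultimately show ?case by (simp add: algebra_simps)
qed simp

text \<open>The error \<open>V (B *v y) / n\<close> in \<open>V_T\<close> is at most
  \<open>C3 / n\<close> times \<open>(norm y)\<^sup>2\<close> and is absorbed by the factor
  \<open>1 + e\<close>. The subtracted \<open>n * V (R n d x)\<close> makes the induction telescope;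
  \<open>q_upper\<close> drops it.\<close>

lemma q_upper_aux:
  assumes "n \<ge> 1" "e > 0" "(1 + e) * C3 \<le> e * n"
  shows "q n d x \<le> (1 + e) * ((real n + d) * V x - n * V (R n d x))"
  using assms(1,3)
proof (induction d arbitrary: n)
  case (Suc d)
  let ?y = "R (Suc n) d x"
  have "q (Suc n) d x \<le> (1 + e) * ((real (Suc n) + d) * V x - real (Suc n) * V ?y)"
    using Suc.prems \<open>e > 0\<close> by (intro Suc.IH) (auto simp: algebra_simps)
  moreover have "(1 + e) * (n * V (T n ?y)) \<le> (1 + e) * ((n + 1) * V ?y) - (norm ?y)\<^sup>2"
  proof -
    have "(1 + e) * V (B *v ?y) / n \<le> (1 + e) * (C3 * (norm ?y)\<^sup>2) / n"
      using C3(2)[of ?y] \<open>e > 0\<close> by (intro divide_right_mono mult_left_mono) auto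
    also have "\<dots> = (1 + e) * C3 / n * (norm ?y)\<^sup>2" by simp
    also have "\<dots> \<le> e * (norm ?y)\<^sup>2"
      using Suc.prems by (intro mult_right_mono) (auto simp: field_simps)
    finally show ?thesis
      using Suc.prems by (simp add: V_T algebra_simps add_divide_distrib)
  qed
  ultimately show ?case by (simp add: algebra_simps)
qed simp

lemma q_upper:
  assumes "e > 0"
  shows "\<exists>n0\<ge>1. \<forall>n\<ge>n0. \<forall>d x. q n d x \<le> (1 + e) * ((real n + d) * V x)"
proof -
  obtain m :: nat where m: "(1 + e) * C3 / e \<le> m" using real_arch_simple by blast
  have "q n d x \<le> (1 + e) * ((real n + d) * V x)" if "n \<ge> max 1 m" for n d x
  proof -
    have "(1 + e) * C3 / e \<le> n" using m that by linarith
    then have "q n d x \<le> (1 + e) * ((real n + d) * V x - n * V (R n d x))"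
      using that assms by (intro q_upper_aux) (auto simp: field_simps)
    also have "\<dots> \<le> (1 + e) * ((real n + d) * V x)"
      using assms V_nonneg by (intro mult_left_mono) auto
    finally show ?thesis .
  qed
  then show ?thesis by (intro exI[of _ "max 1 m"]) auto
qed

text \<open>The rate at which the past is forgotten. Since
  \<open>V x \<le> C1 * (norm x)\<^sup>2\<close>, the choice gives
  \<open>2 * s * V x \<le> (norm x)\<^sup>2 / 2\<close>: one half of the variance term in
  \<open>V_T\<close>, the other half paying for the error of order \<open>1 / n\<close>.\<close>

definition s where "s = min (1 / (4 * C1)) (1 / 2)"

lemma s: "0 < s" "s \<le> 1/2" "4 * C1 * s \<le> 1"
  using C1(1) by (auto simp: s_def min_def field_simps)

text \<open>For \<open>y = 1 + 1 / n\<close>, weighted AM-GM gives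
  \<open>y powr t \<le> 1 + t / n\<close>, and
  \<open>(1 + (1 - 2 * t) / n) * (1 + t / n) \<le> y\<close>. Giving up one \<open>t / n\<close>
  leaves room for the quadratic term.\<close>

lemma powr_ratio_bound:
  assumes "n \<ge> (1::nat)" "0 \<le> t" "t \<le> 1"
  shows "1 + (1 - 2 * t) / n \<le> ((real n + 1) / n) powr (1 - t)"
proof -
  let ?y = "1 + 1 / real n"
  have "?y powr t \<le> 1 + t / n"
  proof -
    have "?y powr t * 1 powr (1 - t) \<le> t * ?y + (1 - t) * 1"
      by (rule Youngs_inequality_0) (use assms in \<open>auto simp: add_pos_nonneg\<close>)
    then show ?thesis by (simp add: algebra_simps)
  qed
  moreover have "0 \<le> 1 + (1 - 2 * t) / n"
    using assms by (simp add: field_simps)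
  ultimately have "(1 + (1 - 2 * t) / n) * ?y powr t \<le> (1 + (1 - 2 * t) / n) * (1 + t / n)"
    by (rule mult_left_mono)
  also have "\<dots> \<le> ?y"
  proof -
    have "n * (t * (1 - 2 * t)) \<le> n * (t * n)" using assms by (intro mult_left_mono) auto
    then show ?thesis using assms by (simp add: field_simps power2_eq_square)
  qed
  also have "?y = ?y powr (1 - t) * ?y powr t"
  proof -
    have z: "z = z powr (1 - t) * z powr t" if "z > 0" for z :: real
      using that by (simp add: powr_add [symmetric])
    show ?thesis by (rule z) (simp add: add_pos_nonneg)
  qed
  finally have "1 + (1 - 2 * t) / n \<le> ?y powr (1 - t)"
    by (rule mult_right_le_imp_le) (use assms in \<open>auto simp: add_nonneg_eq_0_iff\<close>)
  then show ?thesis using assms by (simp add: add_divide_distrib)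
qed

text \<open>One step costs a factor \<open>1 + (1 - 2 * s) / n\<close>, and the powers of
  \<open>(n + 1) / n\<close> telescope. That the exponent is below 1 is decisive: compared with
  \<open>(n + d) * V x\<close>, the share \<open>n * V (R n d x)\<close> of the first
  \<open>n\<close> steps decays like \<open>(n / (n + d)) powr s\<close>.\<close>

lemma R_bound:
  "\<exists>n0\<ge>1. \<forall>n\<ge>n0. \<forall>d x. V (R n d x) \<le> ((real n + d) / n) powr (1 - s) * V x"
proof -
  obtain m :: nat where m: "2 * C3 \<le> m" using real_arch_simple by blast
  have T: "V (T n y) \<le> ((real n + 1) / n) powr (1 - s) * V y" if n: "n \<ge> max 1 m" for n :: nat and y
  proof -
    have "n * V (T n y) \<le> (n + 1) * V y - (norm y)\<^sup>2 + 1 / 2 * (norm y)\<^sup>2"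
    proof -
      have "V (B *v y) / n \<le> C3 * (norm y)\<^sup>2 / n"
        using C3 by (intro divide_right_mono) auto
      also have "\<dots> = C3 / n * (norm y)\<^sup>2" by simp
      also have "\<dots> \<le> 1 / 2 * (norm y)\<^sup>2"
        using m n by (intro mult_right_mono) (auto simp: field_simps)
      finally show ?thesis using n by (simp add: V_T algebra_simps)
    qed
    also have "\<dots> \<le> (n + 1) * V y - 2 * s * V y"
    proof -
      have "2 * s * V y \<le> 2 * s * (C1 * (norm y)\<^sup>2)" using s C1 by (intro mult_left_mono) auto
      also have "\<dots> = (4 * C1 * s) * (norm y)\<^sup>2 / 2" by simp
      also have "\<dots> \<le> (norm y)\<^sup>2 / 2"
        using s(3) by (intro divide_right_mono mult_left_le_one_le) (auto simp: s C1 less_imp_le)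
      finally show ?thesis by simp
    qed
    also have "\<dots> = n * ((1 + (1 - 2 * s) / n) * V y)" using n by (simp add: field_simps)
    finally have "V (T n y) \<le> (1 + (1 - 2 * s) / n) * V y" using n by (simp add: mult_le_cancel_left)
    also have "\<dots> \<le> ((real n + 1) / n) powr (1 - s) * V y"
      using n s V_nonneg by (intro mult_right_mono powr_ratio_bound) auto
    finally show ?thesis by simp
  qed
  have "V (R n d x) \<le> ((real n + d) / n) powr (1 - s) * V x" if "n \<ge> max 1 m" for n d :: nat and x
    using that
  proof (induction d arbitrary: n)
    case (Suc d)
    have "V (R n (Suc d) x) \<le> ((real n + 1) / n) powr (1 - s) * V (R (Suc n) d x)"
      using T[OF Suc.prems] by simp
    also have "\<dots> \<le> ((real n + 1) / n) powr (1 - s) * (((real (Suc n) + d) / real (Suc n)) powr (1 - s) * V x)"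
      using Suc.prems by (intro mult_left_mono Suc.IH) auto
    also have "\<dots> = (((real n + 1) / n) * ((real (Suc n) + d) / real (Suc n))) powr (1 - s) * V x"
      by (subst powr_mult) auto
    also have "((real n + 1) / n) * ((real (Suc n) + d) / real (Suc n)) = (real n + Suc d) / n"
    proof -
      have "(x / n) * ((x + d) / x) = (x + d) / n" if "x > 0" for x :: real
        using that by simp
      moreover have "real (Suc n) = real n + 1" "real n + real (Suc d) = real n + 1 + d" by simp_all
      ultimately show ?thesis by (simp only:)
    qed
    finally show ?case .
  qed auto
  then show ?thesis by (intro exI[of _ "max 1 m"]) auto
qed

text \<open>The counterpart of \<open>R_bound\<close> on short stretches: for
  \<open>j \<ge> n\<close> each factor \<open>T j\<close> differs from the identity by at most
  \<open>b / n\<close> in norm, so a prediction is close to \<open>x\<close> when \<open>d\<close>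
  is small against \<open>n\<close>.\<close>

lemma R_near:
  assumes "n \<ge> 1"
  shows "norm (R n d x - x) \<le> (exp (b * d / n) - 1) * norm x"
proof -
  have aux: "norm (R m d x - x) \<le> ((1 + b / n) ^ d - 1) * norm x" if "m \<ge> n" for m
    using that
  proof (induction d arbitrary: m)
    case (Suc d)
    let ?y = "R (Suc m) d x" and ?c = "(1 + b / n) ^ d"
    have IH: "norm (?y - x) \<le> (?c - 1) * norm x" using Suc.prems by (intro Suc.IH) auto
    have "norm ?y \<le> norm (?y - x) + norm x" using norm_triangle_ineq[of "?y - x" x] by simp
    with IH have y: "norm ?y \<le> ?c * norm x" by (simp add: algebra_simps)
    have "norm ((1 / real m) *\<^sub>R (B *v ?y)) \<le> 1 / n * (b * (?c * norm x))"
      unfolding norm_scaleR using Suc.prems assms b y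
      by (intro mult_mono order_trans[OF b(2)] mult_left_mono) (auto simp: field_simps)
    moreover have "norm (R m (Suc d) x - x) \<le> norm (?y - x) + norm ((1 / real m) *\<^sub>R (B *v ?y))"
      using norm_triangle_ineq[of "?y - x" "(1 / real m) *\<^sub>R (B *v ?y)"]
      by (simp add: T_def algebra_simps)
    ultimately have "norm (R m (Suc d) x - x) \<le> (?c - 1) * norm x + 1 / n * (b * (?c * norm x))"
      using IH by linarith
    then show ?case by (simp add: algebra_simps)
  qed simp
  have "(1 + b / n) ^ d \<le> exp (b / n) ^ d" using b by (intro power_mono) (auto simp: add_nonneg_nonneg)
  also have "\<dots> = exp (b * d / n)" by (simp add: exp_of_nat_mult [symmetric] mult_ac)
  finally show ?thesis using aux[of n] by (smt (verit) mult_right_mono norm_ge_zero order_refl)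
qed

end

section \<open>Exponential moments of a single sign\<close>

lemma cosh_sinh_upper:
  fixes m t :: real
  assumes "\<bar>m\<bar> \<le> 1"
  shows "cosh t + m * sinh t \<le> exp (t * m + t\<^sup>2 / 2)"
proof -
  have *: "cosh t + m * sinh t \<le> exp (t * m + t\<^sup>2 / 2)" if "\<bar>m\<bar> \<le> 1" "t \<ge> 0" for m t :: real
  proof -
    \<comment> \<open>The inequality behind Hoeffding's lemma is for a variable with range of length
      1; a sign of mean \<open>m\<close> has success probability \<open>?p\<close> and range of
      length 2, hence the argument \<open>2 * t\<close>.\<close>
    let ?p = "(1 + m) / 2" and ?h = "2 * t"
    have eq: "1 + ?p * (exp ?h - 1) = exp t * (cosh t + m * sinh t)"
    proof -
      have "exp ?h = exp t * exp t" by (simp add: exp_add [symmetric])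
      then show ?thesis by (simp add: cosh_def sinh_def exp_minus field_simps)
    qed
    have "1 + ?p * (exp ?h - 1) > 0"
      using that by (intro add_pos_nonneg mult_nonneg_nonneg) auto
    then have pos: "cosh t + m * sinh t > 0" unfolding eq by (simp add: zero_less_mult_iff)
    have "- ?h * ?p + ln (1 + ?p * (exp ?h - 1)) \<le> ?h\<^sup>2 / 8"
      by (rule Hoeffdings_lemma_aux) (use that in auto)
    moreover have "ln (1 + ?p * (exp ?h - 1)) = t + ln (cosh t + m * sinh t)"
      using ln_mult_pos[OF exp_gt_zero pos, of t] by (simp only: eq ln_exp)
    moreover have "- ?h * ?p = - t - t * m" by (simp add: field_simps)
    moreover have "?h\<^sup>2 / 8 = t\<^sup>2 / 2" by (simp add: power2_eq_square)
    ultimately have "ln (cosh t + m * sinh t) \<le> t * m + t\<^sup>2 / 2" by linarith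
    then have "exp (ln (cosh t + m * sinh t)) \<le> exp (t * m + t\<^sup>2 / 2)"
      by (subst exp_le_cancel_iff)
    then show ?thesis using pos by simp
  qed
  \<comment> \<open>Reflecting the sign changes \<open>m\<close> and \<open>t\<close> simultaneously
    and covers negative \<open>t\<close>.\<close>
  show ?thesis
    using *[of m t] *[of "-m" "-t"] assms by (cases "t \<ge> 0") auto
qed

text \<open>Truncation after an odd power leaves a remainder of even degree, which is nonnegative
  for every real \<open>x\<close>.\<close>

lemma exp_ge_cubic: "1 + x + x\<^sup>2 / 2 + x ^ 3 / 6 \<le> exp (x::real)"
proof -
  obtain t where "exp x = (\<Sum>m<4. x ^ m / fact m) + exp t / fact 4 * x ^ 4"
    using Maclaurin_exp_le[of x 4] by blast
  moreover have "exp t / fact 4 * x ^ 4 \<ge> 0" by simp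
  ultimately show ?thesis
    by (simp add: eval_nat_numeral lessThan_Suc field_simps)
qed

text \<open>Expansion of a centred sign: the linear term vanishes, the variance is
  \<open>1 - m\<^sup>2\<close> and the third central moment is
  \<open>- 2 * m * (1 - m\<^sup>2)\<close>. A small mean keeps the variance near 1, which reverses
  \<open>cosh_sinh_upper\<close> up to the factor \<open>1 - e\<close>.\<close>

lemma cosh_sinh_lower:
  fixes e :: real
  assumes "e > 0"
  shows "\<exists>\<delta>>0. \<forall>m t. \<bar>m\<bar> \<le> \<delta> \<longrightarrow> \<bar>t\<bar> \<le> \<delta> \<longrightarrow>
           exp (t * m + (1 - e) * t\<^sup>2 / 2) \<le> cosh t + m * sinh t"
proof -
  \<comment> \<open>The slack \<open>10 * \<delta> \<le> e\<close> covers
    \<open>2 * \<delta>\<close> lost through the variance and the cubic term, and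
    \<open>\<delta>\<close> lost through the square in
    \<open>exp y \<le> 1 + y + y\<^sup>2\<close>.\<close>
  define \<delta> where "\<delta> = min (1/10) (e / 10)"
  have \<delta>: "\<delta> > 0" "\<delta> \<le> 1/10" "10 * \<delta> \<le> e" using assms by (auto simp: \<delta>_def)
  have "exp (t * m + (1 - e) * t\<^sup>2 / 2) \<le> cosh t + m * sinh t" if "\<bar>m\<bar> \<le> \<delta>" "\<bar>t\<bar> \<le> \<delta>" for m t
  proof -
    have m1: "\<bar>m\<bar> \<le> 1" and t1: "\<bar>t\<bar> \<le> 1" using that \<delta> by auto
    \<comment> \<open>A sign with mean \<open>m\<close>, centred, takes the value \<open>1 - m\<close> with probability \<open>(1 + m) / 2\<close> and \<open>- 1 - m\<close> otherwise.\<close>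
    define u w where "u = t * (1 - m)" and "w = t * (- 1 - m)"
    define y where "y = (1 - e) * t\<^sup>2 / 2"
    have eq: "cosh t + m * sinh t = exp (t * m) * ((1 + m) / 2 * exp u + (1 - m) / 2 * exp w)"
    proof -
      have "exp (t * m) * exp u = exp t" "exp (t * m) * exp w = exp (- t)"
        by (simp_all add: u_def w_def exp_add [symmetric] algebra_simps)
      moreover have "exp (t * m) * ((1 + m) / 2 * exp u + (1 - m) / 2 * exp w)
          = (1 + m) / 2 * (exp (t * m) * exp u) + (1 - m) / 2 * (exp (t * m) * exp w)"
        by (simp add: algebra_simps)
      ultimately have "exp (t * m) * ((1 + m) / 2 * exp u + (1 - m) / 2 * exp w)
          = (1 + m) / 2 * exp t + (1 - m) / 2 * exp (- t)"
        by simp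
      then show ?thesis by (simp add: cosh_def sinh_def field_simps)
    qed
    have "(1 + m) / 2 * exp u + (1 - m) / 2 * exp w
        \<ge> (1 + m) / 2 * (1 + u + u\<^sup>2 / 2 + u ^ 3 / 6) + (1 - m) / 2 * (1 + w + w\<^sup>2 / 2 + w ^ 3 / 6)"
      using m1 by (intro add_mono mult_left_mono exp_ge_cubic) auto
    also have "(1 + m) / 2 * (1 + u + u\<^sup>2 / 2 + u ^ 3 / 6) + (1 - m) / 2 * (1 + w + w\<^sup>2 / 2 + w ^ 3 / 6)
        = 1 + t\<^sup>2 / 2 * ((1 - m\<^sup>2) - (2 / 3) * (t * m * (1 - m\<^sup>2)))"
      unfolding u_def w_def by (simp add: field_simps power2_eq_square power3_eq_cube)
    finally have 1: "(1 + m) / 2 * exp u + (1 - m) / 2 * exp w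
        \<ge> 1 + t\<^sup>2 / 2 * ((1 - m\<^sup>2) - (2 / 3) * (t * m * (1 - m\<^sup>2)))" .
    have mm: "m\<^sup>2 \<le> \<delta>" "0 \<le> 1 - m\<^sup>2" "1 - m\<^sup>2 \<le> 1"
    proof -
      have "\<bar>m\<bar> * \<bar>m\<bar> \<le> 1 * \<delta>" using that m1 by (intro mult_mono) auto
      then show "m\<^sup>2 \<le> \<delta>" by (simp add: power2_eq_square)
      then show "0 \<le> 1 - m\<^sup>2" using \<delta> by linarith
      show "1 - m\<^sup>2 \<le> 1" by simp
    qed
    have "\<bar>t * m * (1 - m\<^sup>2)\<bar> \<le> \<delta> * 1 * 1"
      unfolding abs_mult using that m1 mm by (intro mult_mono) auto
    then have 2: "(1 - m\<^sup>2) - (2 / 3) * (t * m * (1 - m\<^sup>2)) \<ge> 1 - 2 * \<delta>" using mm by linarith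
    have tt: "t\<^sup>2 \<le> \<delta>"
    proof -
      have "\<bar>t\<bar> * \<bar>t\<bar> \<le> 1 * \<delta>" using that t1 by (intro mult_mono) auto
      then show "t\<^sup>2 \<le> \<delta>" by (simp add: power2_eq_square)
    qed
    have "exp y \<le> 1 + t\<^sup>2 / 2 * (1 - 2 * \<delta>)"
    proof (cases "y \<ge> 0")
      case True
      have yb: "y \<le> t\<^sup>2 / 2 * (1 - 10 * \<delta>)"
      proof -
        have "(1 - e) * t\<^sup>2 \<le> (1 - 10 * \<delta>) * t\<^sup>2" using \<delta> by (intro mult_right_mono) auto
        then show ?thesis by (simp add: y_def field_simps)
      qed
      also have "\<dots> \<le> t\<^sup>2 / 2" using \<delta> by (simp add: mult_left_le)
      finally have y2: "y \<le> t\<^sup>2 / 2" .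
      have "exp y \<le> 1 + y + y\<^sup>2" using True y2 tt \<delta> by (intro exp_bound) auto
      also have "\<dots> \<le> 1 + y + t\<^sup>2 / 2 * \<delta>"
      proof -
        have "y * y \<le> t\<^sup>2 / 2 * \<delta>" using True y2 tt \<delta> by (intro mult_mono) auto
        then show ?thesis by (simp add: power2_eq_square)
      qed
      also have "\<dots> \<le> 1 + t\<^sup>2 / 2 * (1 - 10 * \<delta>) + t\<^sup>2 / 2 * \<delta>" using yb by simp
      also have "\<dots> \<le> 1 + t\<^sup>2 / 2 * (1 - 2 * \<delta>)"
      proof -
        have "0 \<le> t\<^sup>2 * \<delta>" using \<delta> by simp
        then show ?thesis by (simp add: field_simps)
      qed
      finally show ?thesis .
    next
      case False
      then have "exp y \<le> 1" by simp
      also have "\<dots> \<le> 1 + t\<^sup>2 / 2 * (1 - 2 * \<delta>)" using \<delta> by simp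
      finally show ?thesis .
    qed
    also have "\<dots> \<le> 1 + t\<^sup>2 / 2 * ((1 - m\<^sup>2) - (2 / 3) * (t * m * (1 - m\<^sup>2)))"
      using 2 by (intro add_left_mono mult_left_mono) auto
    also note 1
    finally show ?thesis
      unfolding eq y_def exp_add by (intro mult_left_mono) auto
  qed
  then show ?thesis using \<delta> by blast
qed

subsection \<open>Sign-valued walks with linear drift\<close>

text \<open>Since the steps take finitely many values, conditioning on the past needs no conditional
  expectations: \<open>Y_step\<close> gives the moment generating function of a step on each event that fixes the
  past. A drift \<open>m\<close> of a sign contributes the factor \<open>cosh t + m sinh t\<close>.\<close>

locale pm_walk = prob_space M + lyapunov B G
  for M :: "'a measure" and B G :: "real^'k^'k" +
  fixes Y :: "nat \<Rightarrow> 'a \<Rightarrow> real^'k"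
  assumes Y_measurable [measurable]: "\<And>n. Y n \<in> borel_measurable M"
    and Y_pm: "\<And>n \<omega> v. \<omega> \<in> space M \<Longrightarrow> \<bar>Y n \<omega> $ v\<bar> = 1"
    and B_column: "\<And>j. (\<Sum>i\<in>UNIV. \<bar>B $ i $ j\<bar>) \<le> 1"
    and Y_step: "\<And>n h x. n \<ge> 1 \<Longrightarrow>
      expectation (\<lambda>\<omega>. indicator {\<omega> \<in> space M. \<forall>j\<in>{1..n}. Y j \<omega> = h j} \<omega> * exp (x \<bullet> Y (Suc n) \<omega>)) =
      prob {\<omega> \<in> space M. \<forall>j\<in>{1..n}. Y j \<omega> = h j} *
      (\<Prod>v\<in>UNIV. cosh (x $ v) + ((\<Sum>j=1..n. h j) v* B) $ v / n * sinh (x $ v))"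
begin

section \<open>Adapted functionals and finite histories\<close>

definition S :: "nat \<Rightarrow> 'a \<Rightarrow> real^'k" where
  "S n \<omega> = (\<Sum>j=1..n. Y j \<omega>)"

definition drift :: "nat \<Rightarrow> 'a \<Rightarrow> real^'k" where
  "drift n \<omega> = (1 / real n) *\<^sub>R (S n \<omega> v* B)"

text \<open>Dependence on the first \<open>n\<close> steps, stated without \<sigma>-algebras. As
  these steps take finitely many values, real-valued adapted functions are automatically bounded and
  measurable, and any pointwise operation preserves the property.\<close>

definition adapted :: "nat \<Rightarrow> ('a \<Rightarrow> 'b) \<Rightarrow> bool" where
  "adapted n Z \<longleftrightarrow> (\<forall>\<omega>\<in>space M. \<forall>\<omega>'\<in>space M. (\<forall>j\<in>{1..n}. Y j \<omega> = Y j \<omega>') \<longrightarrow> Z \<omega> = Z \<omega>')"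

named_theorems adapted

lemma adapted_const [adapted]: "adapted n (\<lambda>_. c)"
  by (simp add: adapted_def)

lemma adapted_S [adapted]: "m \<le> n \<Longrightarrow> adapted n (S m)"
  unfolding adapted_def S_def by (auto intro!: sum.cong)

lemma adapted_comp: "adapted n f \<Longrightarrow> adapted n (\<lambda>\<omega>. h (f \<omega>))"
  unfolding adapted_def by metis

lemma adapted_comp2: "adapted n f \<Longrightarrow> adapted n g \<Longrightarrow> adapted n (\<lambda>\<omega>. h (f \<omega>) (g \<omega>))"
  unfolding adapted_def by metis

lemma adapted_S_fun: "m \<le> n \<Longrightarrow> adapted n (\<lambda>\<omega>. h (S m \<omega>))"
  by (rule adapted_comp[OF adapted_S])

lemma adapted_mult [adapted]: "adapted n f \<Longrightarrow> adapted n g \<Longrightarrow> adapted n (\<lambda>\<omega>. f \<omega> * g \<omega> :: real)"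
  by (rule adapted_comp2)

lemma adapted_drift: "m \<le> n \<Longrightarrow> adapted n (\<lambda>\<omega>. h (drift m \<omega>))"
  unfolding drift_def by (rule adapted_S_fun)

lemma adapted_exp_inner [adapted]: "m \<le> n \<Longrightarrow> adapted n (\<lambda>\<omega>. exp (x \<bullet> S m \<omega>))"
  by (rule adapted_S_fun)

lemma adapted_all: "(\<And>i. i \<in> I \<Longrightarrow> adapted n (P i)) \<Longrightarrow> adapted n (\<lambda>\<omega>. \<forall>i\<in>I. P i \<omega>)"
  unfolding adapted_def by metis

lemma adapted_ex: "(\<And>i. i \<in> I \<Longrightarrow> adapted n (P i)) \<Longrightarrow> adapted n (\<lambda>\<omega>. \<exists>i\<in>I. P i \<omega>)"
  unfolding adapted_def by metis

lemma adapted_mono: "adapted m Z \<Longrightarrow> m \<le> n \<Longrightarrow> adapted n Z"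
  unfolding adapted_def by (meson atLeastAtMost_iff order_trans)

lemma finite_pm: "finite {x::real^'k. \<forall>v. \<bar>x $ v\<bar> = 1}"
proof (rule finite_subset)
  show "{x::real^'k. \<forall>v. \<bar>x $ v\<bar> = 1} \<subseteq> vec_lambda ` (UNIV \<rightarrow>\<^sub>E {-1, 1})"
  proof
    fix x :: "real^'k" assume "x \<in> {x. \<forall>v. \<bar>x $ v\<bar> = 1}"
    then have "vec_nth x \<in> UNIV \<rightarrow>\<^sub>E {-1, 1}" by (fastforce simp: abs_if split: if_splits)
    then show "x \<in> vec_lambda ` (UNIV \<rightarrow>\<^sub>E {-1, 1})" by (metis imageI vec_nth_inverse)
  qed
qed (auto intro!: finite_PiE)

text \<open>Zeros outside \<open>{1..n}\<close> make the set of histories finite and let equality of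
  histories mean equality of the first \<open>n\<close> steps.\<close>

definition hist :: "nat \<Rightarrow> 'a \<Rightarrow> nat \<Rightarrow> real^'k" where
  "hist n \<omega> j = (if j \<in> {1..n} then Y j \<omega> else 0)"

definition cyl :: "nat \<Rightarrow> (nat \<Rightarrow> real^'k) \<Rightarrow> 'a set" where
  "cyl n h = {\<omega> \<in> space M. \<forall>j\<in>{1..n}. Y j \<omega> = h j}"

lemma finite_hist: "finite (hist n ` space M)"
proof (rule finite_subset)
  show "hist n ` space M \<subseteq> {f. \<forall>j. (j \<in> {1..n} \<longrightarrow> f j \<in> {x. \<forall>v. \<bar>x $ v\<bar> = 1}) \<and> (j \<notin> {1..n} \<longrightarrow> f j = 0)}"
    using Y_pm by (auto simp: hist_def)
  show "finite \<dots>" by (rule finite_set_of_finite_funs) (auto intro: finite_pm)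
qed

lemma cyl_sets [measurable]: "cyl n h \<in> sets M"
  unfolding cyl_def by measurable

lemma hist_eq_iff: "\<omega> \<in> space M \<Longrightarrow> \<omega>' \<in> space M \<Longrightarrow> \<omega> \<in> cyl n (hist n \<omega>') \<longleftrightarrow> hist n \<omega>' = hist n \<omega>"
  by (auto simp: cyl_def hist_def fun_eq_iff)

lemma adapted_factor:
  assumes "adapted n Z"
  shows "\<exists>z. \<forall>\<omega>\<in>space M. Z \<omega> = z (hist n \<omega>)"
proof (rule exI[of _ "\<lambda>h. Z (SOME w. w \<in> space M \<and> hist n w = h)"], rule ballI)
  fix \<omega> assume \<omega>: "\<omega> \<in> space M"
  let ?w = "SOME w. w \<in> space M \<and> hist n w = hist n \<omega>"
  have w: "?w \<in> space M" "hist n ?w = hist n \<omega>"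
    using someI[of "\<lambda>w. w \<in> space M \<and> hist n w = hist n \<omega>" \<omega>] \<omega> by auto
  have "\<forall>j\<in>{1..n}. Y j \<omega> = Y j ?w"
  proof
    fix j assume "j \<in> {1..n}"
    then show "Y j \<omega> = Y j ?w" using fun_cong[OF w(2), of j] by (simp add: hist_def)
  qed
  then show "Z \<omega> = Z ?w"
    using assms \<omega> w(1) by (simp only: adapted_def)
qed

lemma hist_sum:
  fixes z :: "_ \<Rightarrow> real"
  assumes "\<omega> \<in> space M"
  shows "(\<Sum>h\<in>hist n ` space M. z h * indicator (cyl n h) \<omega>) = z (hist n \<omega>)"
proof -
  have "(\<Sum>h\<in>hist n ` space M. z h * indicator (cyl n h) \<omega>) =
      (\<Sum>h\<in>hist n ` space M. if h = hist n \<omega> then z h else 0)"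
    using assms by (intro sum.cong) (auto simp: hist_eq_iff indicator_def)
  also have "\<dots> = z (hist n \<omega>)"
    using assms finite_hist by (simp add: sum.delta)
  finally show ?thesis .
qed

lemma adapted_measurable: "adapted n Z \<Longrightarrow> Z \<in> borel_measurable M" for Z :: "'a \<Rightarrow> real"
proof -
  assume "adapted n Z"
  then obtain z where z: "\<And>\<omega>. \<omega> \<in> space M \<Longrightarrow> Z \<omega> = z (hist n \<omega>)" using adapted_factor by blast
  have "(\<lambda>\<omega>. \<Sum>h\<in>hist n ` space M. z h * indicator (cyl n h) \<omega>) \<in> borel_measurable M"
    by measurable
  then show ?thesis
    by (rule measurable_cong[THEN iffD1, rotated]) (simp add: hist_sum z)
qed

lemma adapted_bounded:
  fixes Z :: "'a \<Rightarrow> real"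
  assumes "adapted n Z"
  shows "\<exists>K. \<forall>\<omega>\<in>space M. \<bar>Z \<omega>\<bar> \<le> K"
proof -
  obtain z where z: "\<And>\<omega>. \<omega> \<in> space M \<Longrightarrow> Z \<omega> = z (hist n \<omega>)" using adapted_factor[OF assms] by blast
  have "finite ((\<lambda>h. \<bar>z h\<bar>) ` hist n ` space M)" using finite_hist by blast
  then have "\<forall>\<omega>\<in>space M. \<bar>Z \<omega>\<bar> \<le> Max ((\<lambda>h. \<bar>z h\<bar>) ` hist n ` space M)"
    by (auto simp: z intro!: Max_ge)
  then show ?thesis by blast
qed

lemma adapted_integrable: "adapted n Z \<Longrightarrow> integrable M Z" for Z :: "'a \<Rightarrow> real"
  using adapted_bounded[of n Z] adapted_measurable[of n Z]
  by (metis AE_I2 integrable_const_bound real_norm_def)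

lemma adapted_sets: "adapted n P \<Longrightarrow> {\<omega> \<in> space M. P \<omega>} \<in> sets M"
proof -
  assume "adapted n P"
  then have "adapted n (\<lambda>\<omega>. of_bool (P \<omega>) :: real)" by (rule adapted_comp)
  from adapted_measurable[OF this] have "(\<lambda>\<omega>. of_bool (P \<omega>) :: real) \<in> borel_measurable M" .
  then have "{\<omega> \<in> space M. (of_bool (P \<omega>) :: real) = 1} \<in> sets M" by measurable
  then show ?thesis by simp
qed

lemma expectation_of_bool: "adapted n P \<Longrightarrow> expectation (\<lambda>\<omega>. of_bool (P \<omega>) :: real) = prob {\<omega> \<in> space M. P \<omega>}"
proof -
  assume "adapted n P"
  have "expectation (\<lambda>\<omega>. of_bool (P \<omega>) :: real) = expectation (indicator {\<omega> \<in> space M. P \<omega>} :: _ \<Rightarrow> real)"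
    by (intro Bochner_Integration.integral_cong) (auto simp: indicator_def)
  then show ?thesis using adapted_sets[OF \<open>adapted n P\<close>] by simp
qed

section \<open>Recursions for weighted exponential moments\<close>

abbreviation mgf :: "('a \<Rightarrow> real) \<Rightarrow> real^'k \<Rightarrow> nat \<Rightarrow> real" where
  "mgf Z x n \<equiv> expectation (\<lambda>\<omega>. Z \<omega> * exp (x \<bullet> S n \<omega>))"

lemma S_Suc: "S (Suc n) \<omega> = S n \<omega> + Y (Suc n) \<omega>"
  by (simp add: S_def)

text \<open>\<open>Y_step\<close> summed over the cylinders of length \<open>n\<close>, on each of
  which \<open>Z\<close> and the drift are constant.\<close>

lemma step_exp:
  fixes Z :: "'a \<Rightarrow> real"
  assumes "n \<ge> 1" "adapted n Z"
  shows "expectation (\<lambda>\<omega>. Z \<omega> * exp (x \<bullet> Y (Suc n) \<omega>)) =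
    expectation (\<lambda>\<omega>. Z \<omega> * (\<Prod>v\<in>UNIV. cosh (x $ v) + drift n \<omega> $ v * sinh (x $ v)))"
proof -
  obtain z where z: "\<And>\<omega>. \<omega> \<in> space M \<Longrightarrow> Z \<omega> = z (hist n \<omega>)" using adapted_factor[OF assms(2)] by blast
  let ?H = "hist n ` space M"
  define f where "f h = (\<Prod>v\<in>UNIV. cosh (x $ v) + ((\<Sum>j=1..n. h j) v* B) $ v / n * sinh (x $ v))" for h
  have f: "(\<Prod>v\<in>UNIV. cosh (x $ v) + drift n \<omega> $ v * sinh (x $ v)) = f (hist n \<omega>)" for \<omega>
  proof -
    have "(\<Sum>j=1..n. hist n \<omega> j) = S n \<omega>" by (simp add: hist_def S_def)
    then show ?thesis by (simp add: f_def drift_def)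
  qed
  have Yint: "integrable M (\<lambda>\<omega>. indicator (cyl n h) \<omega> * exp (x \<bullet> Y (Suc n) \<omega>))" for h
  proof (rule Bochner_Integration.integrable_bound)
    have "x \<bullet> Y (Suc n) \<omega> \<le> (\<Sum>v\<in>UNIV. \<bar>x $ v\<bar>)" if "\<omega> \<in> space M" for \<omega>
      unfolding inner_vec_def
    proof (rule sum_mono)
      fix v
      have "\<bar>x $ v * Y (Suc n) \<omega> $ v\<bar> = \<bar>x $ v\<bar>" using Y_pm[OF that] by (simp add: abs_mult)
      then show "x $ v \<bullet> Y (Suc n) \<omega> $ v \<le> \<bar>x $ v\<bar>" by (metis abs_ge_self inner_real_def)
    qed
    then show "AE \<omega> in M. norm (indicator (cyl n h) \<omega> * exp (x \<bullet> Y (Suc n) \<omega>))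
        \<le> norm (exp (\<Sum>v\<in>UNIV. \<bar>x $ v\<bar>))"
      by (intro AE_I2) (auto simp: indicator_def)
  qed (auto simp: borel_measurable_inner)
  have "expectation (\<lambda>\<omega>. Z \<omega> * exp (x \<bullet> Y (Suc n) \<omega>)) =
      expectation (\<lambda>\<omega>. \<Sum>h\<in>?H. z h * (indicator (cyl n h) \<omega> * exp (x \<bullet> Y (Suc n) \<omega>)))"
    by (intro Bochner_Integration.integral_cong refl)
      (simp add: z hist_sum[symmetric] sum_distrib_right mult.assoc)
  also have "\<dots> = (\<Sum>h\<in>?H. z h * expectation (\<lambda>\<omega>. indicator (cyl n h) \<omega> * exp (x \<bullet> Y (Suc n) \<omega>)))"
    using Yint by (subst Bochner_Integration.integral_sum) auto
  also have "\<dots> = (\<Sum>h\<in>?H. (z h * f h) * expectation (indicator (cyl n h)))"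
    using Y_step[OF assms(1), of _ x] by (intro sum.cong refl) (simp add: cyl_def f_def)
  also have "\<dots> = expectation (\<lambda>\<omega>. \<Sum>h\<in>?H. (z h * f h) * indicator (cyl n h) \<omega>)"
    by (subst Bochner_Integration.integral_sum) (auto simp: emeasure_eq_measure)
  also have "\<dots> = expectation (\<lambda>\<omega>. Z \<omega> * (\<Prod>v\<in>UNIV. cosh (x $ v) + drift n \<omega> $ v * sinh (x $ v)))"
    by (intro Bochner_Integration.integral_cong refl)
      (simp add: z f hist_sum[where z="\<lambda>h. z h * f h"])
  finally show ?thesis .
qed

lemma S_component_le: "\<omega> \<in> space M \<Longrightarrow> \<bar>S n \<omega> $ v\<bar> \<le> n"
proof -
  assume "\<omega> \<in> space M"
  then have "\<bar>S n \<omega> $ v\<bar> \<le> (\<Sum>j=1..n. \<bar>Y j \<omega> $ v\<bar>)"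
    unfolding S_def by (simp add: sum_component sum_abs)
  also have "\<dots> = n" using \<open>\<omega> \<in> space M\<close> by (simp add: Y_pm)
  finally show ?thesis .
qed

text \<open>The bound on the columns of \<open>B\<close> makes every coordinate of the drift an
  admissible mean of a sign, as \<open>cosh_sinh_upper\<close> demands.\<close>

lemma drift_le:
  assumes "\<omega> \<in> space M"
  shows "\<bar>drift n \<omega> $ v\<bar> \<le> 1"
proof -
  have "\<bar>(S n \<omega> v* B) $ v\<bar> \<le> (\<Sum>i\<in>UNIV. \<bar>B $ i $ v\<bar> * n)"
  proof -
    have "\<bar>S n \<omega> $ i * B $ i $ v\<bar> \<le> \<bar>B $ i $ v\<bar> * n" for i
      unfolding abs_mult mult.commute[of "\<bar>S n \<omega> $ i\<bar>"] by (intro mult_left_mono S_component_le assms) simp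
    then show ?thesis
      unfolding vector_matrix_mult_def by (auto intro!: order_trans[OF sum_abs] sum_mono)
  qed
  also have "\<dots> \<le> 1 * real n"
    unfolding sum_distrib_right [symmetric] by (intro mult_right_mono B_column) auto
  finally show ?thesis
    by (cases "n = 0") (auto simp: drift_def abs_mult field_simps)
qed

text \<open>The origin of \<open>T\<close>: adding the conditional mean of the next step to
  \<open>S n\<close> amounts to applying the transposed map to the functional.\<close>

lemma inner_S_drift: "x \<bullet> S n \<omega> + x \<bullet> drift n \<omega> = T n x \<bullet> S n \<omega>"
  by (simp add: T_def drift_def inner_add_left inner_commute[of x] dot_lmul_matrix inner_commute[of "B *v x"])

lemma mgf_step:
  fixes Z :: "'a \<Rightarrow> real"
  assumes "n \<ge> 1" "adapted n Z"
  shows "mgf Z x (Suc n) =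
    expectation (\<lambda>\<omega>. Z \<omega> * exp (x \<bullet> S n \<omega>) * (\<Prod>v\<in>UNIV. cosh (x $ v) + drift n \<omega> $ v * sinh (x $ v)))"
proof -
  have "adapted n (\<lambda>\<omega>. Z \<omega> * exp (x \<bullet> S n \<omega>))" by (intro adapted assms order_refl)
  from step_exp[OF assms(1) this, of x] show ?thesis
    by (simp add: S_Suc inner_add_right exp_add mult.assoc)
qed

lemma sum_exponent:
  "(\<Sum>v\<in>UNIV. x $ v * drift n \<omega> $ v + a * (x $ v)\<^sup>2) = x \<bullet> drift n \<omega> + a * (norm x)\<^sup>2"
proof -
  have "(norm x)\<^sup>2 = (\<Sum>v\<in>UNIV. (x $ v)\<^sup>2)"
    unfolding power2_norm_eq_inner inner_vec_def by (simp add: power2_eq_square)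
  then show ?thesis by (simp add: sum.distrib inner_vec_def sum_distrib_left)
qed

lemma cosh_sinh_nonneg: "\<bar>m\<bar> \<le> 1 \<Longrightarrow> 0 \<le> cosh t + m * sinh (t::real)"
proof -
  assume m: "\<bar>m\<bar> \<le> 1"
  have "\<bar>sinh t\<bar> \<le> cosh t"
    using cosh_plus_sinh[of t] cosh_minus_sinh[of t] exp_gt_zero[of t] exp_gt_zero[of "-t"] by linarith
  then have "\<bar>m\<bar> * \<bar>sinh t\<bar> \<le> 1 * cosh t"
    using m by (intro mult_mono) auto
  then have "\<bar>m * sinh t\<bar> \<le> cosh t" by (simp add: abs_mult)
  then show ?thesis by linarith
qed

lemma mgf_step_upper:
  fixes Z :: "'a \<Rightarrow> real"
  assumes n: "n \<ge> 1" and Z: "adapted n Z" "\<And>\<omega>. Z \<omega> \<ge> 0"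
  shows "mgf Z x (Suc n) \<le>
    exp ((norm x)\<^sup>2 / 2) * mgf Z (T n x) n"
proof -
  let ?P = "\<lambda>\<omega>. \<Prod>v\<in>UNIV. cosh (x $ v) + drift n \<omega> $ v * sinh (x $ v)"
  have le: "?P \<omega> \<le> exp (x \<bullet> drift n \<omega> + (norm x)\<^sup>2 / 2)" if "\<omega> \<in> space M" for \<omega>
  proof -
    have "?P \<omega> \<le> (\<Prod>v\<in>UNIV. exp (x $ v * drift n \<omega> $ v + 1/2 * (x $ v)\<^sup>2))"
      using drift_le[OF that, of n] cosh_sinh_upper by (intro prod_mono) (auto intro: cosh_sinh_nonneg)
    also have "\<dots> = exp (x \<bullet> drift n \<omega> + (norm x)\<^sup>2 / 2)"
      unfolding exp_sum[OF finite, symmetric] sum_exponent by simp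
    finally show ?thesis .
  qed
  have "mgf Z x (Suc n) = expectation (\<lambda>\<omega>. Z \<omega> * exp (x \<bullet> S n \<omega>) * ?P \<omega>)"
    by (rule mgf_step[OF n Z(1)])
  also have "\<dots> \<le> expectation (\<lambda>\<omega>. exp ((norm x)\<^sup>2 / 2) * (Z \<omega> * exp (T n x \<bullet> S n \<omega>)))"
  proof (rule integral_mono)
    show "integrable M (\<lambda>\<omega>. Z \<omega> * exp (x \<bullet> S n \<omega>) * ?P \<omega>)"
      by (intro adapted_integrable[of n] adapted_mult[OF adapted_mult[OF Z(1)]] adapted order_refl
          adapted_drift[where h="\<lambda>d. \<Prod>v\<in>UNIV. cosh (x $ v) + d $ v * sinh (x $ v)"])
    show "integrable M (\<lambda>\<omega>. exp ((norm x)\<^sup>2 / 2) * (Z \<omega> * exp (T n x \<bullet> S n \<omega>)))"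
      by (intro adapted_integrable[of n] adapted Z order_refl)
    fix \<omega> assume "\<omega> \<in> space M"
    have "Z \<omega> * exp (x \<bullet> S n \<omega>) * ?P \<omega> \<le> Z \<omega> * exp (x \<bullet> S n \<omega>) * exp (x \<bullet> drift n \<omega> + (norm x)\<^sup>2 / 2)"
      using Z le[OF \<open>\<omega> \<in> space M\<close>] by (intro mult_left_mono) auto
    also have "\<dots> = exp ((norm x)\<^sup>2 / 2) * (Z \<omega> * exp (T n x \<bullet> S n \<omega>))"
      by (simp add: inner_S_drift[symmetric] exp_add)
    finally show "Z \<omega> * exp (x \<bullet> S n \<omega>) * ?P \<omega> \<le> exp ((norm x)\<^sup>2 / 2) * (Z \<omega> * exp (T n x \<bullet> S n \<omega>))" .
  qed
  finally show ?thesis by simp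
qed

lemma mgf_step_lower:
  fixes Z :: "'a \<Rightarrow> real"
  assumes n: "n \<ge> 1" and Z: "adapted n Z" "\<And>\<omega>. Z \<omega> \<ge> 0"
    and \<delta>: "\<And>m t. \<bar>m\<bar> \<le> \<delta> \<Longrightarrow> \<bar>t\<bar> \<le> \<delta> \<Longrightarrow> exp (t * m + (1 - e) * t\<^sup>2 / 2) \<le> cosh t + m * sinh t"
    and x: "norm x \<le> \<delta>"
    and supp: "\<And>\<omega> v. Z \<omega> \<noteq> 0 \<Longrightarrow> \<bar>drift n \<omega> $ v\<bar> \<le> \<delta>"
  shows "exp ((1 - e) * (norm x)\<^sup>2 / 2) * mgf Z (T n x) n
    \<le> mgf Z x (Suc n)"
proof -
  let ?P = "\<lambda>\<omega>. \<Prod>v\<in>UNIV. cosh (x $ v) + drift n \<omega> $ v * sinh (x $ v)"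
  have le: "exp (x \<bullet> drift n \<omega> + (1 - e) * (norm x)\<^sup>2 / 2) \<le> ?P \<omega>" if "Z \<omega> \<noteq> 0" for \<omega>
  proof -
    have "exp (x \<bullet> drift n \<omega> + (1 - e) * (norm x)\<^sup>2 / 2) =
        (\<Prod>v\<in>UNIV. exp (x $ v * drift n \<omega> $ v + (1 - e) / 2 * (x $ v)\<^sup>2))"
      unfolding exp_sum[OF finite, symmetric] sum_exponent by simp
    also have "\<dots> \<le> ?P \<omega>"
    proof (rule prod_mono, safe)
      fix v
      have "\<bar>x $ v\<bar> \<le> \<delta>" using x component_le_norm_cart[of x v] by simp
      from \<delta>[OF supp[OF that] this]
      show "exp (x $ v * drift n \<omega> $ v + (1 - e) / 2 * (x $ v)\<^sup>2) \<le> cosh (x $ v) + drift n \<omega> $ v * sinh (x $ v)"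
        by simp
    qed simp
    finally show ?thesis .
  qed
  have "expectation (\<lambda>\<omega>. exp ((1 - e) * (norm x)\<^sup>2 / 2) * (Z \<omega> * exp (T n x \<bullet> S n \<omega>)))
      \<le> expectation (\<lambda>\<omega>. Z \<omega> * exp (x \<bullet> S n \<omega>) * ?P \<omega>)"
  proof (rule integral_mono)
    show "integrable M (\<lambda>\<omega>. Z \<omega> * exp (x \<bullet> S n \<omega>) * ?P \<omega>)"
      by (intro adapted_integrable[of n] adapted_mult[OF adapted_mult[OF Z(1)]] adapted order_refl
          adapted_drift[where h="\<lambda>d. \<Prod>v\<in>UNIV. cosh (x $ v) + d $ v * sinh (x $ v)"])
    show "integrable M (\<lambda>\<omega>. exp ((1 - e) * (norm x)\<^sup>2 / 2) * (Z \<omega> * exp (T n x \<bullet> S n \<omega>)))"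
      by (intro adapted_integrable[of n] adapted Z order_refl)
    fix \<omega> assume "\<omega> \<in> space M"
    have "exp ((1 - e) * (norm x)\<^sup>2 / 2) * (Z \<omega> * exp (T n x \<bullet> S n \<omega>)) =
        Z \<omega> * exp (x \<bullet> S n \<omega>) * exp (x \<bullet> drift n \<omega> + (1 - e) * (norm x)\<^sup>2 / 2)"
      by (simp add: inner_S_drift[symmetric] exp_add)
    also have "\<dots> \<le> Z \<omega> * exp (x \<bullet> S n \<omega>) * ?P \<omega>"
      using Z le[of \<omega>] by (cases "Z \<omega> = 0") (auto intro!: mult_left_mono)
    finally show "exp ((1 - e) * (norm x)\<^sup>2 / 2) * (Z \<omega> * exp (T n x \<bullet> S n \<omega>)) \<le> Z \<omega> * exp (x \<bullet> S n \<omega>) * ?P \<omega>" .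
  qed
  also have "\<dots> = mgf Z x (Suc n)"
    by (rule mgf_step[OF n Z(1), symmetric])
  finally show ?thesis by simp
qed

lemma mgf_upper:
  fixes Z :: "'a \<Rightarrow> real"
  assumes "n \<ge> 1" "adapted n Z" "\<And>\<omega>. Z \<omega> \<ge> 0"
  shows "mgf Z x (n + d) \<le>
    exp (q n d x / 2) * mgf Z (R n d x) n"
  using assms
proof (induction d arbitrary: n)
  case (Suc d)
  have "mgf Z x (n + Suc d) \<le>
      exp (q (Suc n) d x / 2) * mgf Z (R (Suc n) d x) (Suc n)"
    using Suc.IH[of "Suc n"] Suc.prems adapted_mono[of n Z "Suc n"] by simp
  also have "\<dots> \<le> exp (q (Suc n) d x / 2) * (exp ((norm (R (Suc n) d x))\<^sup>2 / 2) *
      mgf Z (T n (R (Suc n) d x)) n)"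
    using Suc.prems by (intro mult_left_mono mgf_step_upper) auto
  finally show ?case by (simp add: exp_add add_divide_distrib mult_ac)
qed simp

text \<open>Doob's inequality for a nonnegative supermartingale, the supermartingale property being
  tested against adapted weights. The free weight \<open>Z\<close> drives the induction: where
  \<open>c \<le> W n\<close> the bound is immediate, and the rest is the induction hypothesis at
  \<open>n + 1\<close> with \<open>Z\<close> restricted to \<open>W n < c\<close>.\<close>

lemma maximal_inequality:
  fixes Z :: "'a \<Rightarrow> real" and W :: "nat \<Rightarrow> 'a \<Rightarrow> real"
  assumes "adapted n Z" "\<And>\<omega>. Z \<omega> \<ge> 0" and "c \<ge> 0"
    and "\<And>j. n \<le> j \<Longrightarrow> j \<le> n + d \<Longrightarrow> adapted j (W j)" and "\<And>j \<omega>. W j \<omega> \<ge> 0"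
    and "\<And>j Z'. n \<le> j \<Longrightarrow> j < n + d \<Longrightarrow> adapted j Z' \<Longrightarrow> (\<And>\<omega>. Z' \<omega> \<ge> 0) \<Longrightarrow>
      expectation (\<lambda>\<omega>. Z' \<omega> * W (Suc j) \<omega>) \<le> expectation (\<lambda>\<omega>. Z' \<omega> * W j \<omega>)"
  shows "c * expectation (\<lambda>\<omega>. Z \<omega> * of_bool (\<exists>j\<in>{n..n+d}. c \<le> W j \<omega>)) \<le> expectation (\<lambda>\<omega>. Z \<omega> * W n \<omega>)"
  using assms
proof (induction d arbitrary: n Z)
  case 0
  have "expectation (\<lambda>\<omega>. c * (Z \<omega> * of_bool (\<exists>j\<in>{n..n+0}. c \<le> W j \<omega>))) \<le> expectation (\<lambda>\<omega>. Z \<omega> * W n \<omega>)"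
  proof (rule integral_mono)
    have W: "adapted n (W n)" using "0.prems" by simp
    show "integrable M (\<lambda>\<omega>. Z \<omega> * W n \<omega>)" by (intro adapted_integrable[of n] adapted "0.prems" W)
    show "integrable M (\<lambda>\<omega>. c * (Z \<omega> * of_bool (\<exists>j\<in>{n..n+0}. c \<le> W j \<omega>)))"
      using adapted_comp[OF W, of "\<lambda>w. of_bool (c \<le> w)"]
      by (intro adapted_integrable[of n] adapted "0.prems") simp
    fix \<omega> show "c * (Z \<omega> * of_bool (\<exists>j\<in>{n..n+0}. c \<le> W j \<omega>)) \<le> Z \<omega> * W n \<omega>"
      using "0.prems"(2)[of \<omega>] "0.prems"(5)[of n \<omega>] mult_left_mono[of c "W n \<omega>" "Z \<omega>"] by (auto simp: mult.commute)
  qed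
  then show ?case by simp
next
  case (Suc d)
  have W: "adapted j (W j)" if "n \<le> j" "j \<le> n + Suc d" for j using Suc.prems(4) that by simp
  let ?Z = "\<lambda>\<omega>. Z \<omega> * of_bool (W n \<omega> < c)"
  have Z': "adapted n ?Z" "adapted n (\<lambda>\<omega>. Z \<omega> * of_bool (c \<le> W n \<omega>))"
    by (intro adapted Suc.prems(1) adapted_comp[OF W, of n]; simp)+
  have ex: "adapted (n + Suc d) (\<lambda>\<omega>. of_bool (\<exists>j\<in>{k..n + Suc d}. c \<le> W j \<omega>) :: real)" if "k \<ge> n" for k
    using that
    by (intro adapted_comp[where h=of_bool] adapted_ex adapted_comp[where h="\<lambda>w. c \<le> w"])
      (auto intro: adapted_mono[OF W])
  have int: "integrable M (\<lambda>\<omega>. Z \<omega> * of_bool (c \<le> W n \<omega>))"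
    "integrable M (\<lambda>\<omega>. ?Z \<omega> * of_bool (\<exists>j\<in>{Suc n..n + Suc d}. c \<le> W j \<omega>))"
    "integrable M (\<lambda>\<omega>. Z \<omega> * of_bool (c \<le> W n \<omega>) * W n \<omega>)"
    "integrable M (\<lambda>\<omega>. ?Z \<omega> * W n \<omega>)"
    by (intro adapted_integrable[of "n + Suc d"] adapted_mult adapted_mono[OF Suc.prems(1)]
        adapted_mono[OF Z'(1)] adapted_mono[OF Z'(2)] ex adapted_mono[OF W[of n]]; simp)+
  have "c * expectation (\<lambda>\<omega>. Z \<omega> * of_bool (\<exists>j\<in>{n..n + Suc d}. c \<le> W j \<omega>)) =
      c * expectation (\<lambda>\<omega>. Z \<omega> * of_bool (c \<le> W n \<omega>) + ?Z \<omega> * of_bool (\<exists>j\<in>{Suc n..n + Suc d}. c \<le> W j \<omega>))"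
  proof -
    have "{n..n + Suc d} = insert n {Suc n..n + Suc d}" by auto
    then show ?thesis
      by (intro arg_cong[where f="\<lambda>x. c * x"] Bochner_Integration.integral_cong refl) (auto simp: not_less)
  qed
  also have "\<dots> = c * expectation (\<lambda>\<omega>. Z \<omega> * of_bool (c \<le> W n \<omega>)) +
      c * expectation (\<lambda>\<omega>. ?Z \<omega> * of_bool (\<exists>j\<in>{Suc n..n + Suc d}. c \<le> W j \<omega>))"
    using int by (simp add: Bochner_Integration.integral_add distrib_left)
  also have "\<dots> \<le> expectation (\<lambda>\<omega>. Z \<omega> * of_bool (c \<le> W n \<omega>) * W n \<omega>) + expectation (\<lambda>\<omega>. ?Z \<omega> * W n \<omega>)"
  proof (rule add_mono)
    have "expectation (\<lambda>\<omega>. c * (Z \<omega> * of_bool (c \<le> W n \<omega>))) \<le> expectation (\<lambda>\<omega>. Z \<omega> * of_bool (c \<le> W n \<omega>) * W n \<omega>)"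
    proof (rule integral_mono)
      fix \<omega> show "c * (Z \<omega> * of_bool (c \<le> W n \<omega>)) \<le> Z \<omega> * of_bool (c \<le> W n \<omega>) * W n \<omega>"
        using Suc.prems(2)[of \<omega>] mult_left_mono[of c "W n \<omega>" "Z \<omega>"] by (auto simp: mult.commute)
    qed (use int in simp_all)
    then show "c * expectation (\<lambda>\<omega>. Z \<omega> * of_bool (c \<le> W n \<omega>)) \<le> expectation (\<lambda>\<omega>. Z \<omega> * of_bool (c \<le> W n \<omega>) * W n \<omega>)"
      by simp
    have "c * expectation (\<lambda>\<omega>. ?Z \<omega> * of_bool (\<exists>j\<in>{Suc n..Suc n + d}. c \<le> W j \<omega>)) \<le> expectation (\<lambda>\<omega>. ?Z \<omega> * W (Suc n) \<omega>)"
      using Suc.prems Z'(1) by (intro Suc.IH) (auto intro: adapted_mono)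
    also have "\<dots> \<le> expectation (\<lambda>\<omega>. ?Z \<omega> * W n \<omega>)"
      using Suc.prems(2) Z'(1) by (intro Suc.prems(6)) auto
    finally show "c * expectation (\<lambda>\<omega>. ?Z \<omega> * of_bool (\<exists>j\<in>{Suc n..n + Suc d}. c \<le> W j \<omega>)) \<le> expectation (\<lambda>\<omega>. ?Z \<omega> * W n \<omega>)"
      by simp
  qed
  also have "\<dots> = expectation (\<lambda>\<omega>. Z \<omega> * of_bool (c \<le> W n \<omega>) * W n \<omega> + ?Z \<omega> * W n \<omega>)"
    using int by (simp add: Bochner_Integration.integral_add)
  also have "\<dots> = expectation (\<lambda>\<omega>. Z \<omega> * W n \<omega>)"
    by (intro Bochner_Integration.integral_cong refl) (auto simp: not_less)
  finally show ?case .
qed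

end

subsection \<open>Upper bound\<close>

abbreviation L :: "nat \<Rightarrow> real" where "L n \<equiv> ln (ln (real n))"

definition lil_scale :: "nat \<Rightarrow> real" where
  "lil_scale n = sqrt (2 * real n * L n)"

lemma eventually_L_ge: "eventually (\<lambda>n. C \<le> L n) sequentially"
proof -
  have "filterlim (\<lambda>n::nat. ln (ln (real n))) at_top sequentially" by real_asymp
  then show ?thesis by (simp add: filterlim_at_top)
qed

lemma eventually_lil_scale_le:
  assumes "c > (1::real)"
  shows "eventually (\<lambda>n. \<forall>N. n \<le> N \<longrightarrow> real N \<le> c * n \<longrightarrow> lil_scale N \<le> c * lil_scale n) sequentially"
proof -
  have "eventually (\<lambda>n::nat. ln (ln (c * real n)) \<le> c * ln (ln (real n))) sequentially"
    using assms by real_asymp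
  with eventually_L_ge[of 1] eventually_gt_at_top[of 3] show ?thesis
  proof eventually_elim
    case (elim n)
    show ?case
    proof (intro allI impI)
      fix N assume N: "n \<le> N" "real N \<le> c * n"
      have "L n > 0" using elim(1) by linarith
      from ln_gt_zero_imp_gt_one[OF this] have n1: "ln (real n) > 1" using elim(2) by simp
      have "ln (real n) \<le> ln (real N)" using N elim by simp
      moreover have "ln (real N) \<le> ln (c * n)" using N elim by simp
      ultimately have "L N \<le> ln (ln (c * n))" using n1 by simp
      then have L: "L N \<le> c * L n" using elim(3) by simp
      have "L N \<ge> 0" using n1 \<open>ln (real n) \<le> ln (real N)\<close> by simp
      then have "2 * real N * L N \<le> 2 * (c * n) * (c * L n)"
        using N L by (intro mult_mono) auto
      also have "\<dots> = c\<^sup>2 * (2 * real n * L n)" by (simp add: power2_eq_square)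
      finally have "lil_scale N \<le> sqrt (c\<^sup>2 * (2 * real n * L n))" unfolding lil_scale_def by simp
      then show "lil_scale N \<le> c * lil_scale n"
        using assms by (simp add: lil_scale_def real_sqrt_mult)
    qed
  qed
qed

text \<open>With \<open>r\<close> the integer part of the logarithm of \<open>n\<close> to base
  \<open>c\<close>, one has \<open>c ^ r \<le> n < c ^ (r + 1)\<close>. The rounded right end of
  this block is still at least \<open>n\<close>, since \<open>n\<close> is an integer, and at most
  \<open>c * n\<close>.\<close>

lemma eventually_in_block:
  assumes c: "c > (1::real)" and P: "eventually P sequentially"
  shows "eventually (\<lambda>n. \<exists>r. P r \<and> n \<le> nat \<lfloor>c ^ (r + 1)\<rfloor> \<and> real (nat \<lfloor>c ^ (r + 1)\<rfloor>) \<le> c * n) sequentially"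
proof -
  define f where "f n = nat \<lfloor>log c (real n)\<rfloor>" for n :: nat
  have "filterlim (\<lambda>n::nat. log c (real n)) at_top sequentially"
    using c by real_asymp
  then have "filterlim f at_top sequentially"
    unfolding f_def
    by (rule filterlim_compose[OF filterlim_nat_sequentially filterlim_compose[OF filterlim_floor_sequentially]])
  then have "eventually (\<lambda>n. P (f n)) sequentially"
    using P by (simp add: filterlim_iff)
  with eventually_ge_at_top[of 1] show ?thesis
  proof eventually_elim
    case (elim n)
    have l0: "log c n \<ge> 0" using elim c by simp
    have r1: "real (f n) \<le> log c n" "log c n < real (f n) + 1"
      unfolding f_def using l0 by (auto simp: of_nat_nat)
    have "c ^ f n = c powr real (f n)" using c by (simp add: powr_realpow)
    also have "\<dots> \<le> c powr log c n" using r1 c by (intro powr_mono) auto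
    also have "\<dots> = n" using elim c by simp
    finally have 1: "c ^ f n \<le> n" .
    have "real n = c powr log c n" using elim c by simp
    also have "\<dots> \<le> c powr real (f n + 1)" using r1 c by (intro powr_mono) auto
    also have "\<dots> = c ^ (f n + 1)" using c by (subst powr_realpow) auto
    finally have "int n \<le> \<lfloor>c ^ (f n + 1)\<rfloor>" by (simp add: le_floor_iff)
    then have 2: "n \<le> nat \<lfloor>c ^ (f n + 1)\<rfloor>" by linarith
    have "real (nat \<lfloor>c ^ (f n + 1)\<rfloor>) \<le> c ^ (f n + 1)"
      using c by simp
    also have "\<dots> \<le> c * n" using 1 c by simp
    finally show ?case using 2 elim by blast
  qed
qed

text \<open>\<open>L\<close> of the block end is eventually at least \<open>ln (r * ln c)\<close>,
  so the terms are dominated by a multiple of \<open>r powr (- (1 + e))\<close>.\<close>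

lemma summable_block:
  assumes c: "c > (1::real)" and e: "e > 0"
  shows "summable (\<lambda>r. exp (- (1 + e) * L (nat \<lfloor>c ^ (r + 1)\<rfloor>)))"
proof (rule summable_comparison_test_ev)
  have "eventually (\<lambda>r::nat. c ^ (r + 1) - 1 \<ge> c ^ r) sequentially" using c by real_asymp
  moreover have "eventually (\<lambda>r::nat. real r * ln c \<ge> 1) sequentially" using c by real_asymp
  ultimately show "eventually (\<lambda>r. norm (exp (- (1 + e) * L (nat \<lfloor>c ^ (r + 1)\<rfloor>))) \<le>
      ln c powr (- (1 + e)) * real r powr (- (1 + e))) sequentially"
    using eventually_gt_at_top[of 0]
  proof eventually_elim
    case (elim r)
    have "c ^ r \<le> real (nat \<lfloor>c ^ (r + 1)\<rfloor>)"
    proof -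
      have "\<lfloor>c ^ (r + 1)\<rfloor> \<ge> 0" using c by simp
      then have "real (nat \<lfloor>c ^ (r + 1)\<rfloor>) = real_of_int \<lfloor>c ^ (r + 1)\<rfloor>" by (simp only: of_nat_nat)
      then show ?thesis using elim(1) by linarith
    qed
    moreover have "ln (c ^ r) = r * ln c" using c by (simp add: ln_realpow)
    moreover have "c ^ r > 0" using c by simp
    ultimately have "r * ln c \<le> ln (nat \<lfloor>c ^ (r + 1)\<rfloor>)" by (metis ln_mono order_less_le_trans)
    then have "ln (r * ln c) \<le> L (nat \<lfloor>c ^ (r + 1)\<rfloor>)" using elim by simp
    then have "exp (- (1 + e) * L (nat \<lfloor>c ^ (r + 1)\<rfloor>)) \<le> exp (- (1 + e) * ln (r * ln c))"
      using e by simp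
    also have "\<dots> = (r * ln c) powr (- (1 + e))" using elim c by (simp add: powr_def)
    also have "\<dots> = ln c powr (- (1 + e)) * real r powr (- (1 + e))" using elim c by (simp add: powr_mult)
    finally show ?case by simp
  qed
  show "summable (\<lambda>r. ln c powr (- (1 + e)) * real r powr (- (1 + e)))"
    using e by (intro summable_mult) (simp add: summable_real_powr_iff)
qed

context pm_walk
begin

lemma norm_R_le:
  "\<exists>n0\<ge>1. \<forall>n\<ge>n0. \<forall>d x. norm (R n d x) \<le> sqrt (C2 * ((real n + d) / n) powr (1 - s) * V x)"
proof -
  obtain n0 where n0: "n0 \<ge> 1" "\<And>n d x. n \<ge> n0 \<Longrightarrow> V (R n d x) \<le> ((real n + d) / n) powr (1 - s) * V x"
    using R_bound by blast
  have "norm (R n d x) \<le> sqrt (C2 * ((real n + d) / n) powr (1 - s) * V x)" if "n \<ge> n0" for n d x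
  proof (rule real_le_rsqrt)
    have "(norm (R n d x))\<^sup>2 \<le> C2 * V (R n d x)" by (rule C2)
    also have "\<dots> \<le> C2 * (((real n + d) / n) powr (1 - s) * V x)"
      using C2 n0(2)[OF that] by (intro mult_left_mono) auto
    finally show "(norm (R n d x))\<^sup>2 \<le> C2 * ((real n + d) / n) powr (1 - s) * V x" by (simp add: mult.assoc)
  qed
  then show ?thesis using n0(1) by blast
qed

text \<open>Exponentials of the predictions of \<open>x \<bullet> S N\<close>, multiplied by a
  compensator for the variance still to come, form a supermartingale \<open>W\<close>. The
  compensator is at least 1, so a large prediction forces a large \<open>W\<close>. Times start at
  \<open>n0\<close> because \<open>q_upper\<close> holds only from there on.\<close>

lemma max_tail:
  assumes x: "V x \<le> 1" and e: "e > 0"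
  shows "\<exists>n0\<ge>1. eventually (\<lambda>N. prob {\<omega> \<in> space M. \<exists>n\<in>{n0..N}. (1 + 2 * e) * lil_scale N \<le> R n (N - n) x \<bullet> S n \<omega>}
      \<le> exp (- (1 + e) * L N)) sequentially"
proof -
  obtain m1 where m1: "m1 \<ge> 1" "\<And>n d x. n \<ge> m1 \<Longrightarrow> q n d x \<le> (1 + e) * ((real n + d) * V x)"
    using q_upper[OF e] by blast
  obtain m2 where m2: "m2 \<ge> 1" "\<And>n d x. n \<ge> m2 \<Longrightarrow> norm (R n d x) \<le> sqrt (C2 * ((real n + d) / n) powr (1 - s) * V x)"
    using norm_R_le by blast
  define n0 where "n0 = max m1 m2"
  have n0: "n0 \<ge> 1" "n0 \<ge> m1" "n0 \<ge> m2" using m1 by (auto simp: n0_def)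
  obtain K where K: "\<And>\<omega>. \<omega> \<in> space M \<Longrightarrow> norm (S n0 \<omega>) \<le> K"
    using adapted_bounded[OF adapted_S_fun[where h=norm, OF order_refl, of n0]] by auto
  have K0: "K \<ge> 0" using K not_empty by (metis ex_in_conv norm_ge_zero order_trans)
  \<comment> \<open>The first \<open>n0\<close> steps contribute at most
    \<open>K' * sqrt (L N)\<close> to the exponent, which is at most \<open>2 * e * L N\<close> once
    \<open>L N\<close> is large.\<close>
  define K' where "K' = sqrt (2 * C2 / n0) * K"
  have "eventually (\<lambda>N. (K' / (2 * e))\<^sup>2 \<le> L N) sequentially" by (rule eventually_L_ge)
  with eventually_ge_at_top[of n0] eventually_L_ge[of 1]
  have "eventually (\<lambda>N. prob {\<omega> \<in> space M. \<exists>n\<in>{n0..N}. (1 + 2 * e) * lil_scale N \<le> R n (N - n) x \<bullet> S n \<omega>}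
      \<le> exp (- (1 + e) * L N)) sequentially"
  proof eventually_elim
    case (elim N)
    \<comment> \<open>The minimiser of the Chernoff exponent
      \<open>N * t\<^sup>2 / 2 - t * lil_scale N\<close>.\<close>
    define t where "t = sqrt (2 * L N / N)"
    define y where "y = (1 + 2 * e) * lil_scale N"
    have N1: "N \<ge> 1" using n0 elim by simp
    have t0: "t \<ge> 0" "t > 0" using elim N1 by (auto simp: t_def)
    have t2: "t\<^sup>2 = 2 * L N / N" using elim by (simp add: t_def)
    have ty: "t * y = (2 + 4 * e) * L N"
    proof -
      have "t * lil_scale N = sqrt ((2 * L N / N) * (2 * real N * L N))"
        unfolding t_def lil_scale_def by (rule real_sqrt_mult[symmetric])
      also have "(2 * L N / N) * (2 * real N * L N) = (2 * L N)\<^sup>2"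
        using N1 by (simp add: power2_eq_square)
      finally have "t * lil_scale N = \<bar>2 * L N\<bar>" by (simp only: real_sqrt_abs)
      then have "t * lil_scale N = 2 * L N" using elim by simp
      then show ?thesis by (simp add: y_def algebra_simps)
    qed
    define W where "W j \<omega> = exp (R j (N - j) (t *\<^sub>R x) \<bullet> S j \<omega>) * exp (q j (N - j) (t *\<^sub>R x) / 2)" for j \<omega>
    have adW: "adapted j (W j)" for j
      unfolding W_def by (intro adapted order_refl)
    have super: "expectation (\<lambda>\<omega>. Z \<omega> * W (Suc j) \<omega>) \<le> expectation (\<lambda>\<omega>. Z \<omega> * W j \<omega>)"
      if j: "n0 \<le> j" "j < N" and Z: "adapted j Z" "\<And>\<omega>. Z \<omega> \<ge> 0" for j and Z :: "'a \<Rightarrow> real"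
    proof -
      obtain d where d: "N - j = Suc d" "N - Suc j = d" using j by (metis Suc_diff_Suc)
      let ?z = "R (Suc j) d (t *\<^sub>R x)"
      have "expectation (\<lambda>\<omega>. Z \<omega> * W (Suc j) \<omega>) =
          mgf Z ?z (Suc j) * exp (q (Suc j) d (t *\<^sub>R x) / 2)"
        unfolding W_def d by (simp add: mult.assoc[symmetric])
      also have "\<dots> \<le> exp ((norm ?z)\<^sup>2 / 2) * mgf Z (T j ?z) j * exp (q (Suc j) d (t *\<^sub>R x) / 2)"
        using n0 j Z by (intro mult_right_mono mgf_step_upper) auto
      also have "\<dots> = expectation (\<lambda>\<omega>. Z \<omega> * W j \<omega>)"
        unfolding W_def d by (simp add: mult.assoc[symmetric] exp_add add_divide_distrib)
      finally show ?thesis .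
    qed
    define A where "A \<omega> \<longleftrightarrow> (\<exists>j\<in>{n0..N}. exp (t * y) \<le> W j \<omega>)" for \<omega>
    have adA: "adapted N A"
      unfolding A_def
      by (intro adapted_ex adapted_comp[where h="\<lambda>w. exp (t * y) \<le> w"] adapted_mono[OF adW]) auto
    define d where "d = N - n0"
    have d: "n0 + d = N" using elim by (simp add: d_def)
    have "exp (t * y) * expectation (\<lambda>\<omega>. 1 * of_bool (\<exists>j\<in>{n0..n0+d}. exp (t * y) \<le> W j \<omega>)) \<le> expectation (\<lambda>\<omega>. 1 * W n0 \<omega>)"
      using adW super by (intro maximal_inequality) (auto simp: adapted d W_def)
    then have "exp (t * y) * prob {\<omega> \<in> space M. A \<omega>} \<le> expectation (W n0)"
      using expectation_of_bool[OF adA] by (simp add: A_def d)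
    also have "expectation (W n0) \<le> expectation (\<lambda>\<omega>. exp ((1 + e) * L N + 2 * e * L N))"
    proof (rule integral_mono)
      show "integrable M (W n0)" by (rule adapted_integrable[OF adW])
      fix \<omega> assume \<omega>: "\<omega> \<in> space M"
      have "R n0 d (t *\<^sub>R x) \<bullet> S n0 \<omega> \<le> norm (R n0 d (t *\<^sub>R x)) * norm (S n0 \<omega>)"
        by (rule norm_cauchy_schwarz)
      also have "\<dots> \<le> (t * sqrt (C2 * (N / n0))) * K"
      proof (rule mult_mono)
        have "norm (R n0 d x) \<le> sqrt (C2 * ((real n0 + d) / n0) powr (1 - s) * V x)"
          by (rule m2) (use n0 in auto)
        also have "real n0 + d = N" using d by linarith
        also have "sqrt (C2 * (N / n0) powr (1 - s) * V x) \<le> sqrt (C2 * (N / n0))"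
        proof -
          have "(N / n0) powr (1 - s) \<le> (N / n0) powr 1"
            using s elim n0 by (intro powr_mono) auto
          then have "(N / n0) powr (1 - s) \<le> N / n0" using n0 N1 by simp
          then have "C2 * (N / n0) powr (1 - s) * V x \<le> C2 * (N / n0) * 1"
            using C2(1) x V_nonneg by (intro mult_mono mult_left_mono mult_nonneg_nonneg) auto
          then show ?thesis by simp
        qed
        finally show "norm (R n0 d (t *\<^sub>R x)) \<le> t * sqrt (C2 * (N / n0))"
          using t0 by (simp add: R_scale mult_left_mono)
      qed (use K[OF \<omega>] t0 C2 in auto)
      also have "\<dots> = K' * sqrt (L N)"
      proof -
        have "t * sqrt (C2 * (N / n0)) = sqrt (2 * L N / N * (C2 * (N / n0)))"
          unfolding t_def by (rule real_sqrt_mult[symmetric])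
        also have "2 * L N / N * (C2 * (N / n0)) = 2 * C2 / n0 * L N" using N1 by simp
        finally have "t * sqrt (C2 * (N / n0)) = sqrt (2 * C2 / n0) * sqrt (L N)"
          by (simp only: real_sqrt_mult)
        then show ?thesis unfolding K'_def by (simp only: mult_ac)
      qed
      also have "\<dots> \<le> 2 * e * L N"
      proof -
        have "K' / (2 * e) \<le> sqrt (L N)" using elim(3) by (rule real_le_rsqrt)
        then have "K' \<le> 2 * e * sqrt (L N)" using e by (simp add: field_simps)
        then have "K' * sqrt (L N) \<le> 2 * e * sqrt (L N) * sqrt (L N)"
          using elim by (intro mult_right_mono) auto
        also have "\<dots> = 2 * e * (sqrt (L N) * sqrt (L N))" by (rule mult.assoc)
        also have "sqrt (L N) * sqrt (L N) = L N" using elim by simp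
        finally show ?thesis .
      qed
      finally have 1: "R n0 d (t *\<^sub>R x) \<bullet> S n0 \<omega> \<le> 2 * e * L N" .
      have "q n0 d (t *\<^sub>R x) \<le> (1 + e) * ((real n0 + d) * V (t *\<^sub>R x))" by (rule m1) (use n0 in auto)
      also have "(real n0 + d) * V (t *\<^sub>R x) = real N * t\<^sup>2 * V x" using d by (simp add: V_scale)
      also have "\<dots> = 2 * L N * V x" using N1 by (simp add: t2)
      also have "(1 + e) * \<dots> \<le> (1 + e) * (2 * L N * 1)"
        using e x elim by (intro mult_left_mono) auto
      finally have 2: "q n0 d (t *\<^sub>R x) / 2 \<le> (1 + e) * L N" by simp
      show "W n0 \<omega> \<le> exp ((1 + e) * L N + 2 * e * L N)"
        unfolding W_def exp_add[symmetric] d_def[symmetric] using 1 2 by simp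
    qed simp
    finally have "exp (t * y) * prob {\<omega> \<in> space M. A \<omega>} \<le> exp ((1 + e) * L N + 2 * e * L N)"
      by (simp add: prob_space)
    then have "prob {\<omega> \<in> space M. A \<omega>} \<le> exp ((1 + e) * L N + 2 * e * L N) / exp (t * y)"
      by (simp add: field_simps)
    \<comment> \<open>The coefficients of \<open>L N\<close> add up as
      \<open>(1 + e) + 2 * e - (2 + 4 * e) = - (1 + e)\<close>.\<close>
    also have "\<dots> = exp (- (1 + e) * L N)"
      unfolding ty exp_diff[symmetric] by (simp add: algebra_simps)
    finally have "prob {\<omega> \<in> space M. A \<omega>} \<le> exp (- (1 + e) * L N)" .
    moreover have "prob {\<omega> \<in> space M. \<exists>n\<in>{n0..N}. y \<le> R n (N - n) x \<bullet> S n \<omega>} \<le> prob {\<omega> \<in> space M. A \<omega>}"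
    proof (rule finite_measure_mono)
      show "{\<omega> \<in> space M. A \<omega>} \<in> events" by (rule adapted_sets[OF adA])
      have "exp (t * y) \<le> W n \<omega>" if "y \<le> R n (N - n) x \<bullet> S n \<omega>" for n \<omega>
      proof -
        have "t * y \<le> t * (R n (N - n) x \<bullet> S n \<omega>)" using that t0 by (intro mult_left_mono) auto
        then show ?thesis
          unfolding W_def exp_add[symmetric] using q_nonneg[of n "N - n" "t *\<^sub>R x"] by (simp add: R_scale)
      qed
      then show "{\<omega> \<in> space M. \<exists>n\<in>{n0..N}. y \<le> R n (N - n) x \<bullet> S n \<omega>} \<subseteq> {\<omega> \<in> space M. A \<omega>}"
        unfolding A_def by blast
    qed
    ultimately show ?case unfolding y_def by linarith
  qed
  then show ?thesis using n0 by blast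
qed

text \<open>The maximal inequality controls the predictions at the block end, so \<open>x\<close>
  has to be compared with \<open>R n (N r - n) x\<close>, which is close to it inside a block of
  ratio \<open>c\<close>. The resulting error involves \<open>norm (S n \<omega>)\<close> itself;
  hence the a priori bound \<open>lil_bounded\<close> comes before the limit of \<open>c\<close> to
  1.\<close>

lemma upper_block:
  assumes x: "V x \<le> 1" and e: "e > 0" and c: "c > 1"
  shows "AE \<omega> in M. eventually (\<lambda>n. x \<bullet> S n \<omega> \<le> (1 + 2 * e) * (c * lil_scale n) +
    (exp (b * (c - 1)) - 1) * norm x * norm (S n \<omega>)) sequentially"
proof -
  obtain n0 where n0: "n0 \<ge> 1" and tail: "eventually (\<lambda>N. prob {\<omega> \<in> space M. \<exists>n\<in>{n0..N}. (1 + 2 * e) * lil_scale N \<le> R n (N - n) x \<bullet> S n \<omega>}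
      \<le> exp (- (1 + e) * L N)) sequentially"
    using max_tail[OF x e] by blast
  define N where "N r = nat \<lfloor>c ^ (r + 1)\<rfloor>" for r
  define A where "A r = {\<omega> \<in> space M. \<exists>n\<in>{n0..N r}. (1 + 2 * e) * lil_scale (N r) \<le> R n (N r - n) x \<bullet> S n \<omega>}" for r
  have A: "A r \<in> events" for r
    unfolding A_def
    by (intro adapted_sets[of "N r"] adapted_ex adapted_S_fun[where h="\<lambda>s. (1 + 2 * e) * lil_scale (N r) \<le> R _ _ x \<bullet> s"]) auto
  have "filterlim (\<lambda>r::nat. c ^ (r + 1)) at_top sequentially" using c by real_asymp
  then have "filterlim N at_top sequentially"
    unfolding N_def
    by (rule filterlim_compose[OF filterlim_nat_sequentially filterlim_compose[OF filterlim_floor_sequentially]])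
  from eventually_compose_filterlim[OF tail this]
  have "eventually (\<lambda>r. prob (A r) \<le> exp (- (1 + e) * L (N r))) sequentially"
    unfolding A_def .
  then have "eventually (\<lambda>r. norm (prob (A r)) \<le> exp (- (1 + e) * L (N r))) sequentially"
    by (rule eventually_mono) simp
  then have "summable (\<lambda>r. prob (A r))"
    by (rule summable_comparison_test_ev) (unfold N_def, rule summable_block[OF c e])
  then have "AE \<omega> in M. eventually (\<lambda>r. \<omega> \<in> space M - A r) sequentially"
    using A by (intro borel_cantelli_AE1) (auto simp: emeasure_eq_measure)
  then show ?thesis
  proof eventually_elim
    case (elim \<omega>)
    from eventually_in_block[OF c elim, folded N_def] eventually_ge_at_top[of n0]
      eventually_lil_scale_le[OF c]
    show ?case
    proof eventually_elim
      case (elim n)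
      then obtain r where r: "\<omega> \<in> space M - A r" "n \<le> N r" "real (N r) \<le> c * n" by blast
      let ?R = "R n (N r - n) x"
      have n1: "n \<ge> 1" using n0 elim by simp
      have "?R \<bullet> S n \<omega> \<le> (1 + 2 * e) * lil_scale (N r)"
        using r elim unfolding A_def by force
      also have "\<dots> \<le> (1 + 2 * e) * (c * lil_scale n)"
        using e elim r by (intro mult_left_mono) auto
      finally have 1: "?R \<bullet> S n \<omega> \<le> (1 + 2 * e) * (c * lil_scale n)" .
      have "norm (?R - x) \<le> (exp (b * real (N r - n) / n) - 1) * norm x" by (rule R_near[OF n1])
      also have "\<dots> \<le> (exp (b * (c - 1)) - 1) * norm x"
      proof -
        have "real (N r - n) / n \<le> c - 1" using r n1 by (simp add: of_nat_diff field_simps)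
        then have "b * (real (N r - n) / n) \<le> b * (c - 1)" using b by (intro mult_left_mono) auto
        then show ?thesis by (intro mult_right_mono) auto
      qed
      finally have 2: "norm (x - ?R) \<le> (exp (b * (c - 1)) - 1) * norm x" by (simp add: norm_minus_commute)
      have "x \<bullet> S n \<omega> = ?R \<bullet> S n \<omega> + (x - ?R) \<bullet> S n \<omega>" by (simp add: inner_diff_left)
      also have "(x - ?R) \<bullet> S n \<omega> \<le> norm (x - ?R) * norm (S n \<omega>)" by (rule norm_cauchy_schwarz)
      also have "\<dots> \<le> (exp (b * (c - 1)) - 1) * norm x * norm (S n \<omega>)"
        using 2 by (intro mult_right_mono) auto
      finally show ?case using 1 by simp
    qed
  qed
qed

text \<open>A bootstrap: for \<open>c\<close> close to 1 the errors of \<open>upper_block\<close>,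
  summed over all coordinates, amount to at most half of \<open>norm (S n \<omega>)\<close> and can
  be moved to the other side.\<close>

lemma lil_bounded: "\<exists>K>0. AE \<omega> in M. eventually (\<lambda>n. norm (S n \<omega>) \<le> K * lil_scale n) sequentially"
proof -
  \<comment> \<open>As \<open>V (axis v 1) \<le> C1\<close>, this scaling brings the coordinate
    functionals into the unit ball of \<open>V\<close>.\<close>
  define \<alpha> where "\<alpha> = 1 / sqrt C1"
  have \<alpha>: "\<alpha> > 0" using C1 by (simp add: \<alpha>_def)
  have V\<alpha>: "V (\<alpha> *\<^sub>R axis v 1) \<le> 1" "V (- (\<alpha> *\<^sub>R axis v 1)) \<le> 1" for v
  proof -
    have "V (axis v 1) \<le> C1 * (norm (axis v 1 :: real^'k))\<^sup>2" by (rule C1)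
    then have "V (axis v 1) \<le> C1" by (simp add: norm_axis_1)
    then have "\<alpha>\<^sup>2 * V (axis v 1) \<le> \<alpha>\<^sup>2 * C1" by (intro mult_left_mono) auto
    also have "\<dots> = 1" using C1(1) by (simp add: \<alpha>_def power_divide)
    finally show "V (\<alpha> *\<^sub>R axis v 1) \<le> 1" by (simp add: V_scale)
    then show "V (- (\<alpha> *\<^sub>R axis v 1)) \<le> 1" by simp
  qed
  define k where "k = real CARD('k)"
  have k: "k \<ge> 1" by (simp add: k_def Suc_leI)
  have "((\<lambda>c. (exp (b * (c - 1)) - 1) * k) \<longlongrightarrow> (exp (b * (1 - 1)) - 1) * k) (at_right 1)"
    by (intro tendsto_intros)
  then have "eventually (\<lambda>c. (exp (b * (c - 1)) - 1) * k < 1 / 2) (at_right 1)"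
    by (rule order_tendstoD) simp
  moreover have "eventually (\<lambda>c. c \<in> {1<..<2}) (at_right (1::real))"
    by (rule eventually_at_right_real) simp
  ultimately have "eventually (\<lambda>c. c \<in> {1<..<2} \<and> (exp (b * (c - 1)) - 1) * k < 1 / 2) (at_right 1)"
    by eventually_elim simp
  then obtain c where c: "c > 1" "c < 2" "(exp (b * (c - 1)) - 1) * k < 1 / 2"
    by (auto dest: eventually_happens' [rotated])
  define \<kappa> where "\<kappa> = exp (b * (c - 1)) - 1"
  have \<kappa>: "\<kappa> \<ge> 0" using b c by (simp add: \<kappa>_def)
  have "AE \<omega> in M. \<forall>v. eventually (\<lambda>n. (\<alpha> *\<^sub>R axis v 1) \<bullet> S n \<omega> \<le> (1 + 2 * 1) * (c * lil_scale n) +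
    \<kappa> * norm (\<alpha> *\<^sub>R axis v 1 :: real^'k) * norm (S n \<omega>)) sequentially"
    unfolding AE_all_countable \<kappa>_def by (intro allI upper_block c V\<alpha>) auto
  moreover have "AE \<omega> in M. \<forall>v. eventually (\<lambda>n. (- (\<alpha> *\<^sub>R axis v 1)) \<bullet> S n \<omega> \<le> (1 + 2 * 1) * (c * lil_scale n) +
    \<kappa> * norm (- (\<alpha> *\<^sub>R axis v 1) :: real^'k) * norm (S n \<omega>)) sequentially"
    unfolding AE_all_countable \<kappa>_def by (intro allI upper_block c V\<alpha>) auto
  \<comment> \<open>The 12 collects the factor \<open>1 + 2 * 1\<close>, the bound
    \<open>c < 2\<close>, and a factor 2 from absorbing half of the norm.\<close>
  ultimately have "AE \<omega> in M. eventually (\<lambda>n. norm (S n \<omega>) \<le> (12 * k / \<alpha>) * lil_scale n) sequentially"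
  proof eventually_elim
    case (elim \<omega>)
    have "eventually (\<lambda>n. \<forall>v. (\<alpha> *\<^sub>R axis v 1) \<bullet> S n \<omega> \<le> (1 + 2 * 1) * (c * lil_scale n) +
        \<kappa> * norm (\<alpha> *\<^sub>R axis v 1 :: real^'k) * norm (S n \<omega>)) sequentially"
      "eventually (\<lambda>n. \<forall>v. (- (\<alpha> *\<^sub>R axis v 1)) \<bullet> S n \<omega> \<le> (1 + 2 * 1) * (c * lil_scale n) +
        \<kappa> * norm (- (\<alpha> *\<^sub>R axis v 1) :: real^'k) * norm (S n \<omega>)) sequentially"
      using elim by (auto intro: eventually_all_finite)
    then show ?case using eventually_L_ge[of 0]
    proof eventually_elim
      case (elim n)
      have a0: "lil_scale n \<ge> 0" using elim(3) by (simp add: lil_scale_def)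
      have comp: "\<bar>S n \<omega> $ v\<bar> \<le> 3 * c / \<alpha> * lil_scale n + \<kappa> * norm (S n \<omega>)" for v
      proof -
        have "\<alpha> * (S n \<omega> $ v) \<le> 3 * (c * lil_scale n) + \<kappa> * \<alpha> * norm (S n \<omega>)"
          using elim(1)[rule_format, of v] \<alpha> by (simp add: inner_axis' norm_axis_1)
        moreover have "- \<alpha> * (S n \<omega> $ v) \<le> 3 * (c * lil_scale n) + \<kappa> * \<alpha> * norm (S n \<omega>)"
          using elim(2)[rule_format, of v] \<alpha> by (simp add: inner_axis' norm_axis_1)
        ultimately have "\<alpha> * \<bar>S n \<omega> $ v\<bar> \<le> 3 * (c * lil_scale n) + \<kappa> * \<alpha> * norm (S n \<omega>)"
          by (simp add: abs_if)
        then show ?thesis using \<alpha> by (simp add: field_simps)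
      qed
      have "norm (S n \<omega>) \<le> (\<Sum>v\<in>UNIV. \<bar>S n \<omega> $ v\<bar>)" by (rule norm_le_l1_cart)
      also have "\<dots> \<le> (\<Sum>v\<in>(UNIV::'k set). 3 * c / \<alpha> * lil_scale n + \<kappa> * norm (S n \<omega>))"
        by (intro sum_mono comp)
      also have "\<dots> = k * (3 * c / \<alpha> * lil_scale n) + (\<kappa> * k) * norm (S n \<omega>)"
        by (simp add: k_def algebra_simps)
      also have "\<dots> \<le> k * (3 * 2 / \<alpha> * lil_scale n) + 1 / 2 * norm (S n \<omega>)"
        using c \<alpha> a0 k by (intro add_mono mult_left_mono mult_right_mono divide_right_mono) (auto simp: \<kappa>_def)
      finally show ?case by (simp add: field_simps)
    qed
  qed
  then show ?thesis using k \<alpha> by (intro exI[of _ "12 * k / \<alpha>"]) auto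
qed

text \<open>Given the a priori bound, the error of \<open>upper_block\<close> is a multiple of
  \<open>lil_scale n\<close> whose coefficient vanishes as \<open>c\<close> decreases to 1.\<close>

lemma lil_upper:
  assumes x: "V x \<le> 1" and e: "e > 0"
  shows "AE \<omega> in M. eventually (\<lambda>n. x \<bullet> S n \<omega> \<le> (1 + e) * lil_scale n) sequentially"
proof -
  obtain K where K: "K > 0" "AE \<omega> in M. eventually (\<lambda>n. norm (S n \<omega>) \<le> K * lil_scale n) sequentially"
    using lil_bounded by blast
  have "((\<lambda>c. (1 + e / 2) * c + (exp (b * (c - 1)) - 1) * norm x * K) \<longlongrightarrow> (1 + e / 2) * 1 + (exp (b * (1 - 1)) - 1) * norm x * K) (at_right 1)"
    by (intro tendsto_intros)
  then have "eventually (\<lambda>c. (1 + e / 2) * c + (exp (b * (c - 1)) - 1) * norm x * K < 1 + e) (at_right 1)"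
    by (rule order_tendstoD) (use e in simp)
  moreover have "eventually (\<lambda>c. c \<in> {1<..<2}) (at_right (1::real))"
    by (rule eventually_at_right_real) simp
  ultimately have "eventually (\<lambda>c. c \<in> {1<..<2} \<and> (1 + e / 2) * c + (exp (b * (c - 1)) - 1) * norm x * K < 1 + e) (at_right 1)"
    by eventually_elim simp
  then obtain c where c: "c > 1" "(1 + e / 2) * c + (exp (b * (c - 1)) - 1) * norm x * K < 1 + e"
    by (auto dest: eventually_happens' [rotated])
  have "e / 4 > 0" using e by simp
  from upper_block[OF x this c(1)] K(2) show ?thesis
  proof eventually_elim
    case (elim \<omega>)
    then show ?case using eventually_L_ge[of 0]
    proof eventually_elim
      case (elim n)
      have a0: "lil_scale n \<ge> 0" using elim(3) by (simp add: lil_scale_def)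
      have "x \<bullet> S n \<omega> \<le> (1 + e / 2) * (c * lil_scale n) + (exp (b * (c - 1)) - 1) * norm x * norm (S n \<omega>)"
        using elim(1) by simp
      also have "\<dots> \<le> (1 + e / 2) * (c * lil_scale n) + (exp (b * (c - 1)) - 1) * norm x * (K * lil_scale n)"
        using elim(2) b c by (intro add_left_mono mult_left_mono mult_nonneg_nonneg) auto
      also have "\<dots> = ((1 + e / 2) * c + (exp (b * (c - 1)) - 1) * norm x * K) * lil_scale n"
        by (simp add: algebra_simps)
      also have "\<dots> \<le> (1 + e) * lil_scale n" using c a0 by (intro mult_right_mono) auto
      finally show ?case .
    qed
  qed
qed

end

subsection \<open>Exponential moments from below\<close>

lemma filterlim_fact: "filterlim (fact :: nat \<Rightarrow> nat) at_top sequentially"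
  by (rule filterlim_at_top_mono[OF filterlim_ident]) (simp add: fact_ge_self)

lemma filterlim_real_fact: "filterlim (\<lambda>r. real (fact r)) at_top sequentially"
  by (rule filterlim_compose[OF filterlim_real_sequentially filterlim_fact])

lemma eventually_L_fact_ge: "eventually (\<lambda>r. C \<le> L (fact (Suc r))) sequentially"
proof -
  have "filterlim (\<lambda>r. fact (Suc r) :: nat) at_top sequentially"
    by (rule filterlim_compose[OF filterlim_fact filterlim_Suc])
  from eventually_compose_filterlim[OF eventually_L_ge this] show ?thesis .
qed

text \<open>Crude, but it reduces comparisons between consecutive factorials to asymptotics in the
  single real variable \<open>fact r\<close>.\<close>

lemma fact_Suc_le: "r \<ge> 1 \<Longrightarrow> real (fact (Suc r)) \<le> 2 * (real (fact r))\<^sup>2"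
proof -
  assume "r \<ge> 1"
  have "Suc r \<le> 2 * fact r" using fact_ge_self[of r] \<open>r \<ge> 1\<close> by linarith
  then have "real (Suc r) \<le> real (2 * fact r)" by (simp only: of_nat_le_iff)
  then have "real (Suc r) \<le> 2 * real (fact r)" by simp
  then have *: "real (Suc r) * real (fact r) \<le> 2 * real (fact r) * real (fact r)"
    by (rule mult_right_mono) simp
  have "real (fact (Suc r)) = real (Suc r) * real (fact r)" by (simp add: algebra_simps)
  with * show ?thesis by (simp only: power2_eq_square mult.assoc)
qed

lemma fact_ge_6: "fact 3 \<le> (fact m :: nat) \<Longrightarrow> real (fact m) \<ge> 6"
proof -
  assume "fact 3 \<le> (fact m :: nat)"
  then have "6 \<le> (fact m :: nat)" by (simp add: fact_numeral)
  then show ?thesis by (metis of_nat_le_iff of_nat_numeral)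
qed

lemma L_fact_Suc_le: "r \<ge> 2 \<Longrightarrow> L (fact (Suc r)) \<le> ln (ln (2 * (real (fact r))\<^sup>2))"
proof -
  assume r: "r \<ge> 2"
  have "fact 3 \<le> (fact (Suc r) :: nat)" using r by (intro fact_mono_nat) simp
  then have 6: "real (fact (Suc r)) \<ge> 6" by (rule fact_ge_6)
  then have "ln (real (fact (Suc r))) > 0" by (simp del: fact_Suc)
  moreover have "ln (real (fact (Suc r))) \<le> ln (2 * (real (fact r))\<^sup>2)"
    using fact_Suc_le[of r] r 6 by (intro ln_mono) (auto simp del: fact_Suc)
  ultimately show ?thesis by (metis ln_mono)
qed

text \<open>Serves to absorb up to \<open>fact (Suc r)\<close> error terms, each exponentially small
  in \<open>fact r\<close>.\<close>

lemma eventually_fact_exp: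
  assumes "c > 0" "A > 0" "a > (0::real)"
  shows "eventually (\<lambda>r. c * real (fact (Suc r)) * exp (A * L (fact (Suc r))) \<le> exp (a * real (fact r))) sequentially"
proof -
  have "eventually (\<lambda>n::real. c * (2 * n\<^sup>2) * exp (A * ln (ln (2 * n\<^sup>2))) \<le> exp (a * n)) at_top"
    using assms by real_asymp
  from eventually_compose_filterlim[OF this filterlim_real_fact] eventually_ge_at_top[of 2]
  show ?thesis
  proof eventually_elim
    case (elim r)
    have "c * real (fact (Suc r)) * exp (A * L (fact (Suc r))) \<le>
        c * (2 * (real (fact r))\<^sup>2) * exp (A * ln (ln (2 * (real (fact r))\<^sup>2)))"
      using L_fact_Suc_le[of r] fact_Suc_le[of r] elim assms
      by (intro mult_mono mult_left_mono) (auto simp del: fact_Suc)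
    then show ?case using elim by linarith
  qed
qed

lemma eventually_L_fact_le:
  assumes "a > (0::real)"
  shows "eventually (\<lambda>r. L (fact (Suc r)) \<le> a * real (fact r)) sequentially"
proof -
  have "eventually (\<lambda>n::real. ln (ln (2 * n\<^sup>2)) \<le> a * n) at_top"
    using assms by real_asymp
  from eventually_compose_filterlim[OF this filterlim_real_fact] eventually_ge_at_top[of 2]
  show ?thesis
  proof eventually_elim
    case (elim r)
    then show ?case using L_fact_Suc_le[of r] by linarith
  qed
qed

text \<open>By \<open>ln (m!) \<le> m * ln m\<close>, the right side is at least
  \<open>(m * ln m) powr (- g)\<close> with \<open>m = r + 1\<close>, and \<open>g < 1\<close>
  absorbs the logarithm. The harmonic lower bound is what makes the sum of hitting probabilities
  diverge.\<close>

lemma eventually_exp_L_fact_ge: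
  assumes g: "0 \<le> g" "g < (1::real)"
  shows "eventually (\<lambda>r. 1 / (real r + 1) \<le> exp (- g * L (fact (Suc r)))) sequentially"
proof -
  \<comment> \<open>An exponent strictly between \<open>g\<close> and 1, hence positive even for
    \<open>g = 0\<close>.\<close>
  have "eventually (\<lambda>x::real. exp ((1 + g) / 2 * ln (x * ln x)) \<le> x) at_top"
    using g by real_asymp
  then have "eventually (\<lambda>r. exp ((1 + g) / 2 * ln (real (Suc r) * ln (real (Suc r)))) \<le> real (Suc r)) sequentially"
    by (rule eventually_compose_filterlim[OF _ filterlim_compose[OF filterlim_real_sequentially filterlim_Suc]])
  with eventually_ge_at_top[of 3] eventually_L_fact_ge[of 0] show ?thesis
  proof eventually_elim
    case (elim r)
    have f: "real (fact (Suc r)) \<le> real (Suc r) ^ Suc r"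
    proof -
      have "fact (Suc r) \<le> (of_nat (Suc r ^ Suc r) :: nat)" by (rule fact_le_power)
      then have "fact (Suc r) \<le> Suc r ^ Suc r" by (simp only: of_nat_id)
      then show ?thesis by (metis of_nat_le_iff of_nat_power)
    qed
    have "fact 3 \<le> (fact (Suc r) :: nat)" using elim by (intro fact_mono_nat) simp
    then have 6: "real (fact (Suc r)) \<ge> 6" by (rule fact_ge_6)
    then have "ln (real (fact (Suc r))) \<le> ln (real (Suc r) ^ Suc r)"
      using f by (subst ln_le_cancel_iff) (auto simp del: fact_Suc)
    also have "\<dots> = real (Suc r) * ln (real (Suc r))" by (rule ln_realpow)
    finally have "ln (real (fact (Suc r))) \<le> real (Suc r) * ln (real (Suc r))" .
    moreover have "ln (real (fact (Suc r))) > 0" using 6 by (simp del: fact_Suc)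
    ultimately have l: "L (fact (Suc r)) \<le> ln (real (Suc r) * ln (real (Suc r)))" by (metis ln_mono)
    have "g * L (fact (Suc r)) \<le> (1 + g) / 2 * L (fact (Suc r))"
      using g elim by (intro mult_right_mono) auto
    also have "\<dots> \<le> (1 + g) / 2 * ln (real (Suc r) * ln (real (Suc r)))"
      using g l by (intro mult_left_mono) auto
    finally have "exp (g * L (fact (Suc r))) \<le> real (Suc r)"
      using elim(3) by (meson exp_le_cancel_iff order_trans)
    then have "1 / real (Suc r) \<le> 1 / exp (g * L (fact (Suc r)))"
      by (intro divide_left_mono) auto
    then show ?case by (simp add: exp_minus field_simps del: fact_Suc)
  qed
qed

context pm_walk
begin

definition small_drift :: "real \<Rightarrow> nat \<Rightarrow> 'a \<Rightarrow> bool" where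
  "small_drift \<delta> j \<omega> \<longleftrightarrow> (\<forall>v. \<bar>drift j \<omega> $ v\<bar> \<le> \<delta>)"

lemma adapted_small_drift: "j \<le> n \<Longrightarrow> adapted n (\<lambda>\<omega>. h (small_drift \<delta> j \<omega>))"
  unfolding small_drift_def by (rule adapted_drift)

text \<open>The second-order lower bound for a step needs a small drift. The mass on which the drift is
  large is subtracted step by step; \<open>large_drift_mgf\<close> shows that it is exponentially small in \<open>n\<close>.\<close>

lemma mgf_lower:
  fixes Z :: "'a \<Rightarrow> real"
  assumes "n \<ge> 1" and Z: "adapted n Z" "\<And>\<omega>. Z \<omega> \<ge> 0"
    and \<delta>: "\<And>m t. \<bar>m\<bar> \<le> \<delta> \<Longrightarrow> \<bar>t\<bar> \<le> \<delta> \<Longrightarrow> exp (t * m + (1 - e) * t\<^sup>2 / 2) \<le> cosh t + m * sinh t"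
    and x: "\<And>j. n < j \<Longrightarrow> j \<le> n + d \<Longrightarrow> norm (R j (n + d - j) x) \<le> \<delta>"
  shows "exp ((1 - e) * q n d x / 2) * mgf Z (R n d x) n
    \<le> mgf Z x (n + d) +
      (\<Sum>j=n..<n+d. exp ((1 - e) * q j (n + d - j) x / 2) *
        expectation (\<lambda>\<omega>. Z \<omega> * of_bool (\<not> small_drift \<delta> j \<omega>) * exp (R j (n + d - j) x \<bullet> S j \<omega>)))"
  using assms(1,2,3,5)
proof (induction d arbitrary: n)
  case (Suc d)
  let ?y = "R (Suc n) d x"
  let ?err = "\<lambda>j. exp ((1 - e) * q j (Suc n + d - j) x / 2) *
        expectation (\<lambda>\<omega>. Z \<omega> * of_bool (\<not> small_drift \<delta> j \<omega>) * exp (R j (Suc n + d - j) x \<bullet> S j \<omega>))"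
  have ad: "adapted n (\<lambda>\<omega>. Z \<omega> * of_bool (small_drift \<delta> n \<omega>))" "adapted n (\<lambda>\<omega>. Z \<omega> * of_bool (\<not> small_drift \<delta> n \<omega>))"
    by (intro adapted_mult Suc.prems(2) adapted_small_drift order_refl)+
  have int: "integrable M (\<lambda>\<omega>. Z \<omega> * of_bool (small_drift \<delta> n \<omega>) * exp (T n ?y \<bullet> S n \<omega>))"
    "integrable M (\<lambda>\<omega>. Z \<omega> * of_bool (\<not> small_drift \<delta> n \<omega>) * exp (T n ?y \<bullet> S n \<omega>))"
    by (intro adapted_integrable[of n] adapted_mult[OF ad(1)] adapted_mult[OF ad(2)] adapted_exp_inner order_refl)+
  have "mgf Z (T n ?y) n =
      expectation (\<lambda>\<omega>. Z \<omega> * of_bool (small_drift \<delta> n \<omega>) * exp (T n ?y \<bullet> S n \<omega>) +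
        Z \<omega> * of_bool (\<not> small_drift \<delta> n \<omega>) * exp (T n ?y \<bullet> S n \<omega>))"
    by (intro Bochner_Integration.integral_cong refl) auto
  also have "\<dots> = expectation (\<lambda>\<omega>. Z \<omega> * of_bool (small_drift \<delta> n \<omega>) * exp (T n ?y \<bullet> S n \<omega>)) +
      expectation (\<lambda>\<omega>. Z \<omega> * of_bool (\<not> small_drift \<delta> n \<omega>) * exp (T n ?y \<bullet> S n \<omega>))"
    by (rule Bochner_Integration.integral_add[OF int])
  finally have split: "mgf Z (T n ?y) n = \<dots>" .
  have "exp ((1 - e) * (norm ?y)\<^sup>2 / 2) * expectation (\<lambda>\<omega>. Z \<omega> * of_bool (small_drift \<delta> n \<omega>) * exp (T n ?y \<bullet> S n \<omega>))
      \<le> expectation (\<lambda>\<omega>. Z \<omega> * of_bool (small_drift \<delta> n \<omega>) * exp (?y \<bullet> S (Suc n) \<omega>))"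
    using Suc.prems ad(1) \<delta> Suc.prems(4)[of "Suc n"]
    by (intro mgf_step_lower[where \<delta>=\<delta>]) (auto simp: small_drift_def split: if_splits)
  also have "\<dots> \<le> mgf Z ?y (Suc n)"
  proof (rule integral_mono)
    show "integrable M (\<lambda>\<omega>. Z \<omega> * of_bool (small_drift \<delta> n \<omega>) * exp (?y \<bullet> S (Suc n) \<omega>))"
      by (intro adapted_integrable[of "Suc n"] adapted_mult adapted_mono[OF Suc.prems(2)] adapted_small_drift adapted_exp_inner) auto
    show "integrable M (\<lambda>\<omega>. Z \<omega> * exp (?y \<bullet> S (Suc n) \<omega>))"
      by (intro adapted_integrable[of "Suc n"] adapted_mult adapted_mono[OF Suc.prems(2)] adapted_exp_inner) auto
  qed (use Suc.prems(3) in auto)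
  finally have 1: "exp ((1 - e) * (norm ?y)\<^sup>2 / 2) * expectation (\<lambda>\<omega>. Z \<omega> * of_bool (small_drift \<delta> n \<omega>) * exp (T n ?y \<bullet> S n \<omega>))
      \<le> mgf Z ?y (Suc n)" .
  have IH: "exp ((1 - e) * q (Suc n) d x / 2) * mgf Z ?y (Suc n)
      \<le> mgf Z x (Suc n + d) + (\<Sum>j=Suc n..<Suc n+d. ?err j)"
    using Suc.prems by (intro Suc.IH) (auto intro: adapted_mono)
  have "exp ((1 - e) * q n (Suc d) x / 2) * mgf Z (R n (Suc d) x) n =
      exp ((1 - e) * q (Suc n) d x / 2) * (exp ((1 - e) * (norm ?y)\<^sup>2 / 2) *
        expectation (\<lambda>\<omega>. Z \<omega> * of_bool (small_drift \<delta> n \<omega>) * exp (T n ?y \<bullet> S n \<omega>))) + ?err n"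
    unfolding R.simps split
    by (simp add: exp_add[symmetric] distrib_left add_divide_distrib mult.assoc[symmetric] del: of_bool_not_iff)
  also have "\<dots> \<le> exp ((1 - e) * q (Suc n) d x / 2) * mgf Z ?y (Suc n) + ?err n"
    using 1 by (intro add_right_mono mult_left_mono) auto
  also have "\<dots> \<le> mgf Z x (Suc n + d) + ((\<Sum>j=Suc n..<Suc n+d. ?err j) + ?err n)"
    using IH by simp
  also have "(\<Sum>j=Suc n..<Suc n+d. ?err j) + ?err n = (\<Sum>j=n..<Suc n+d. ?err j)"
    by (subst (2) sum.atLeast_Suc_lessThan) auto
  finally show ?case by simp
qed simp

text \<open>Chernoff's bound for one coordinate at a time:
  \<open>(n + d) * drift (n + d) \<omega> $ v\<close> is the linear functional
  \<open>(B *v axis v 1) \<bullet> S (n + d) \<omega>\<close>, so a large drift is paid for by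
  shifting \<open>x\<close> by \<open>l\<close> times that vector, with either sign.\<close>

lemma large_drift_mgf:
  fixes Z :: "'a \<Rightarrow> real"
  assumes n: "n \<ge> 1" and Z: "adapted n Z" "\<And>\<omega>. Z \<omega> \<ge> 0" and l: "l > 0" and bound:
    "\<And>y. y \<in> range (\<lambda>v. x + l *\<^sub>R (B *v axis v 1)) \<union> range (\<lambda>v. x - l *\<^sub>R (B *v axis v 1)) \<Longrightarrow>
      mgf Z y (n + d) \<le> C"
  shows "expectation (\<lambda>\<omega>. Z \<omega> * of_bool (\<not> small_drift \<delta> (n + d) \<omega>) * exp (x \<bullet> S (n + d) \<omega>))
    \<le> 2 * real CARD('k) * exp (- l * \<delta> * real (n + d)) * C"
proof -
  let ?j = "n + d"
  let ?u = "\<lambda>v. l *\<^sub>R (B *v axis v 1)"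
  let ?w = "exp (- l * \<delta> * ?j)"
  have dr: "?j * drift ?j \<omega> $ v = (B *v axis v 1) \<bullet> S ?j \<omega>" for v \<omega>
  proof -
    have "(B *v axis v 1) \<bullet> S ?j \<omega> = (S ?j \<omega> v* B) \<bullet> axis v 1"
      by (simp only: dot_lmul_matrix inner_commute[of "B *v axis v 1"])
    then show ?thesis using n by (simp add: drift_def inner_axis)
  qed
  have int: "integrable M (\<lambda>\<omega>. Z \<omega> * exp (y \<bullet> S ?j \<omega>))" for y
    by (intro adapted_integrable[of ?j] adapted_mult adapted_mono[OF Z(1)] adapted_exp_inner) auto
  have "expectation (\<lambda>\<omega>. Z \<omega> * of_bool (\<not> small_drift \<delta> ?j \<omega>) * exp (x \<bullet> S ?j \<omega>)) \<le>
      expectation (\<lambda>\<omega>. \<Sum>v\<in>UNIV. ?w * (Z \<omega> * exp ((x + ?u v) \<bullet> S ?j \<omega>)) + ?w * (Z \<omega> * exp ((x - ?u v) \<bullet> S ?j \<omega>)))"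
  proof (rule integral_mono)
    show "integrable M (\<lambda>\<omega>. Z \<omega> * of_bool (\<not> small_drift \<delta> ?j \<omega>) * exp (x \<bullet> S ?j \<omega>))"
      by (intro adapted_integrable[of ?j] adapted_mult adapted_mono[OF Z(1)] adapted_small_drift adapted_exp_inner) auto
    show "integrable M (\<lambda>\<omega>. \<Sum>v\<in>UNIV. ?w * (Z \<omega> * exp ((x + ?u v) \<bullet> S ?j \<omega>)) + ?w * (Z \<omega> * exp ((x - ?u v) \<bullet> S ?j \<omega>)))"
      by (intro Bochner_Integration.integrable_sum Bochner_Integration.integrable_add integrable_mult_right int)
    fix \<omega> assume "\<omega> \<in> space M"
    let ?f = "\<lambda>v. ?w * (Z \<omega> * exp ((x + ?u v) \<bullet> S ?j \<omega>)) + ?w * (Z \<omega> * exp ((x - ?u v) \<bullet> S ?j \<omega>))"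
    have f0: "?f v \<ge> 0" for v using Z by simp
    show "Z \<omega> * of_bool (\<not> small_drift \<delta> ?j \<omega>) * exp (x \<bullet> S ?j \<omega>) \<le> (\<Sum>v\<in>UNIV. ?f v)"
    proof (cases "small_drift \<delta> ?j \<omega>")
      case True
      then show ?thesis using f0 by (auto intro: sum_nonneg)
    next
      case False
      then obtain v where v: "\<bar>drift ?j \<omega> $ v\<bar> > \<delta>" by (auto simp: small_drift_def not_le)
      have E: "?w * (Z \<omega> * exp ((x + ?u v) \<bullet> S ?j \<omega>)) = Z \<omega> * exp (x \<bullet> S ?j \<omega>) * exp (l * ?j * (drift ?j \<omega> $ v - \<delta>))"
        "?w * (Z \<omega> * exp ((x - ?u v) \<bullet> S ?j \<omega>)) = Z \<omega> * exp (x \<bullet> S ?j \<omega>) * exp (l * ?j * (- drift ?j \<omega> $ v - \<delta>))"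
      proof -
        have comm: "a * (z * c) = z * p * r" if "a * c = p * r" for a z c p r :: real
          using that by (metis mult.assoc mult.left_commute)
        have "?w * exp ((x + ?u v) \<bullet> S ?j \<omega>) = exp (x \<bullet> S ?j \<omega>) * exp (l * ?j * (drift ?j \<omega> $ v - \<delta>))"
          "?w * exp ((x - ?u v) \<bullet> S ?j \<omega>) = exp (x \<bullet> S ?j \<omega>) * exp (l * ?j * (- drift ?j \<omega> $ v - \<delta>))"
          unfolding exp_add[symmetric] inner_add_left inner_diff_left inner_scaleR_left dr[symmetric]
          by (simp_all add: algebra_simps)
        then show "?w * (Z \<omega> * exp ((x + ?u v) \<bullet> S ?j \<omega>)) = Z \<omega> * exp (x \<bullet> S ?j \<omega>) * exp (l * ?j * (drift ?j \<omega> $ v - \<delta>))"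
          "?w * (Z \<omega> * exp ((x - ?u v) \<bullet> S ?j \<omega>)) = Z \<omega> * exp (x \<bullet> S ?j \<omega>) * exp (l * ?j * (- drift ?j \<omega> $ v - \<delta>))"
          by (simp_all only: comm)
      qed
      have ge: "Z \<omega> * exp (x \<bullet> S ?j \<omega>) * 1 \<le> Z \<omega> * exp (x \<bullet> S ?j \<omega>) * exp (l * ?j * t)" if "t \<ge> 0" for t
        using that l Z by (intro mult_left_mono) auto
      have "Z \<omega> * exp (x \<bullet> S ?j \<omega>) \<le> ?f v"
        using v ge[of "drift ?j \<omega> $ v - \<delta>"] ge[of "- drift ?j \<omega> $ v - \<delta>"] Z(2)[of \<omega>]
        unfolding E by (cases "drift ?j \<omega> $ v \<ge> 0") (auto intro: add_increasing add_increasing2)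
      also have "\<dots> \<le> (\<Sum>v\<in>UNIV. ?f v)" using f0 by (intro member_le_sum) auto
      finally show ?thesis using False by simp
    qed
  qed
  also have "\<dots> = (\<Sum>v\<in>UNIV. ?w * mgf Z ((x + ?u v)) ?j + ?w * mgf Z ((x - ?u v)) ?j)"
    by (subst Bochner_Integration.integral_sum) (simp_all add: int Bochner_Integration.integral_add)
  also have "\<dots> \<le> (\<Sum>v\<in>(UNIV::'k set). ?w * C + ?w * C)"
    by (intro sum_mono add_mono mult_left_mono bound) auto
  finally show ?thesis by (simp add: mult_ac)
qed

end

context pm_walk
begin

text \<open>With this scaling, \<open>tilt N *\<^sub>R \<theta> \<bullet> S N\<close> is \<open>2 L N\<close> times the inner product of \<open>\<theta>\<close> with the normalised
  sum.\<close>

definition tilt :: "nat \<Rightarrow> real" where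
  "tilt N = sqrt (2 * L N / N)"

lemma tilt_square: "N \<ge> 1 \<Longrightarrow> L N \<ge> 0 \<Longrightarrow> (tilt N)\<^sup>2 = 2 * L N / N"
  by (simp add: tilt_def)

lemma tilt_V: "N \<ge> 1 \<Longrightarrow> L N \<ge> 0 \<Longrightarrow> N * V (tilt N *\<^sub>R x) = 2 * L N * V x"
  by (simp add: V_scale tilt_square)

lemma tilt_lil_scale: "N \<ge> 1 \<Longrightarrow> L N \<ge> 0 \<Longrightarrow> tilt N * lil_scale N = 2 * L N"
proof -
  assume N: "N \<ge> 1" "L N \<ge> 0"
  have "tilt N * lil_scale N = sqrt ((2 * L N / N) * (2 * real N * L N))"
    unfolding tilt_def lil_scale_def by (rule real_sqrt_mult[symmetric])
  also have "(2 * L N / N) * (2 * real N * L N) = (2 * L N)\<^sup>2"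
    using N by (simp add: power2_eq_square)
  finally have "tilt N * lil_scale N = \<bar>2 * L N\<bar>" by (simp only: real_sqrt_abs)
  then show ?thesis using N by simp
qed

text \<open>Closes the recursions at their starting time: Cauchy-Schwarz bounds the exponent
  wherever \<open>Z\<close> is nonzero.\<close>

lemma mgf_initial:
  fixes Z :: "'a \<Rightarrow> real"
  assumes Z: "adapted n Z" "\<And>\<omega>. Z \<omega> \<ge> 0"
    and K: "\<And>\<omega>. Z \<omega> \<noteq> 0 \<Longrightarrow> norm (S n \<omega>) \<le> K" and x: "norm x * K \<le> C"
  shows "mgf Z x n \<le> exp C * expectation Z"
    and "exp (- C) * expectation Z \<le> mgf Z x n"
proof -
  have int: "integrable M (\<lambda>\<omega>. Z \<omega> * exp (x \<bullet> S n \<omega>))" "integrable M (\<lambda>\<omega>. exp c * Z \<omega>)" for c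
    by (intro adapted_integrable[of n] adapted_mult adapted_const adapted_exp_inner Z order_refl)+
  have bd: "\<bar>x \<bullet> S n \<omega>\<bar> \<le> C" if "Z \<omega> \<noteq> 0" for \<omega>
  proof -
    have "\<bar>x \<bullet> S n \<omega>\<bar> \<le> norm x * norm (S n \<omega>)" by (rule Cauchy_Schwarz_ineq2)
    also have "\<dots> \<le> norm x * K" using K[OF that] by (rule mult_left_mono) simp
    finally show ?thesis using x by simp
  qed
  have "mgf Z x n \<le> expectation (\<lambda>\<omega>. exp C * Z \<omega>)"
  proof (intro integral_mono int)
    fix \<omega> show "Z \<omega> * exp (x \<bullet> S n \<omega>) \<le> exp C * Z \<omega>"
      using bd[of \<omega>] Z(2)[of \<omega>] by (cases "Z \<omega> = 0") (auto simp: mult.commute intro!: mult_left_mono)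
  qed
  then show "mgf Z x n \<le> exp C * expectation Z" by simp
  have "expectation (\<lambda>\<omega>. exp (- C) * Z \<omega>) \<le> mgf Z x n"
  proof (intro integral_mono int)
    fix \<omega> show "exp (- C) * Z \<omega> \<le> Z \<omega> * exp (x \<bullet> S n \<omega>)"
      using bd[of \<omega>] Z(2)[of \<omega>] by (cases "Z \<omega> = 0") (auto simp: mult.commute intro!: mult_left_mono)
  qed
  then show "exp (- C) * expectation Z \<le> mgf Z x n" by simp
qed

lemma V_R_le: "\<exists>n0\<ge>1. \<forall>n\<ge>n0. \<forall>d x. V (R n d x) \<le> (real n + d) / n * V x"
proof -
  obtain n0 where n0: "n0 \<ge> 1" "\<And>n d x. n \<ge> n0 \<Longrightarrow> V (R n d x) \<le> ((real n + d) / n) powr (1 - s) * V x"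
    using R_bound by blast
  have "V (R n d x) \<le> (real n + d) / n * V x" if "n \<ge> n0" for n d x
  proof -
    have "((real n + d) / n) powr (1 - s) \<le> ((real n + d) / n) powr 1"
      using s n0 that by (intro powr_mono) auto
    also have "\<dots> = (real n + d) / n" using n0 that by simp
    finally show ?thesis using n0(2)[OF that, of d x] V_nonneg[of x]
      by (meson mult_right_mono order_trans)
  qed
  then show ?thesis using n0 by blast
qed

text \<open>Forgetting of the past: with \<open>n = r!\<close> and \<open>N = (r + 1)!\<close> the
  square of the left side is of order \<open>(L N)\<^sup>2 * (n / N) powr s\<close>, and
  \<open>n / N = 1 / (r + 1)\<close> tends to 0. The factor \<open>K * sqrt (n * L N)\<close> is the
  size that \<open>lil_bounded\<close> allows for \<open>S n\<close>.\<close>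

lemma initial_term:
  assumes "\<kappa> > 0"
  shows "eventually (\<lambda>r. norm (R (fact r) (fact (Suc r) - fact r) (tilt (fact (Suc r)) *\<^sub>R x)) *
    (K * sqrt (fact r * L (fact (Suc r)))) \<le> \<kappa> * L (fact (Suc r))) sequentially"
proof -
  obtain n0 where n0: "n0 \<ge> 1" "\<And>n d x. n \<ge> n0 \<Longrightarrow> norm (R n d x) \<le> sqrt (C2 * ((real n + d) / n) powr (1 - s) * V x)"
    using norm_R_le by blast
  define A where "A = 2 * C2 * V x * K\<^sup>2"
  have "filterlim (\<lambda>r::nat. (real r + 1) powr s) at_top sequentially" using s by real_asymp
  then have "eventually (\<lambda>r. A / \<kappa>\<^sup>2 \<le> (real r + 1) powr s) sequentially"
    by (simp add: filterlim_at_top)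
  with eventually_L_fact_ge[of 0] eventually_ge_at_top[of n0] eventually_ge_at_top[of 1] show ?thesis
  proof eventually_elim
    case (elim r)
    define n N where "n = (fact r :: nat)" and "N = (fact (Suc r) :: nat)"
    have nN: "real N = (real r + 1) * real n" unfolding n_def N_def by (simp add: algebra_simps)
    have n1: "n \<ge> 1" "N \<ge> 1" "n \<le> N" "n \<ge> n0"
      using fact_ge_self[of r] elim unfolding n_def N_def by (auto intro: fact_mono_nat simp del: fact_Suc)
    have L0: "L N \<ge> 0" using elim(1) by (simp add: N_def)
    have "norm (R n (N - n) (tilt N *\<^sub>R x)) \<le> sqrt (C2 * ((real n + real (N - n)) / n) powr (1 - s) * V (tilt N *\<^sub>R x))"
      by (rule n0) (use n1 in auto)
    also have "real n + real (N - n) = N" using n1 by simp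
    also have "real N / n = real r + 1" using n1 by (simp add: nN)
    also have "V (tilt N *\<^sub>R x) = 2 * L N * V x / N"
      using tilt_V[of N x] n1 L0 by (simp add: field_simps)
    finally have "norm (R n (N - n) (tilt N *\<^sub>R x)) * (\<bar>K\<bar> * sqrt (n * L N)) \<le>
        sqrt (C2 * (real r + 1) powr (1 - s) * (2 * L N * V x / N)) * (\<bar>K\<bar> * sqrt (n * L N))"
      using L0 by (intro mult_right_mono) auto
    moreover have "norm (R n (N - n) (tilt N *\<^sub>R x)) * (K * sqrt (n * L N)) \<le>
        norm (R n (N - n) (tilt N *\<^sub>R x)) * (\<bar>K\<bar> * sqrt (n * L N))"
      using L0 by (intro mult_left_mono mult_right_mono) auto
    ultimately have "norm (R n (N - n) (tilt N *\<^sub>R x)) * (K * sqrt (n * L N)) \<le>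
        sqrt (C2 * (real r + 1) powr (1 - s) * (2 * L N * V x / N)) * (\<bar>K\<bar> * sqrt (n * L N))"
      by linarith
    also have "\<dots> = sqrt (C2 * (real r + 1) powr (1 - s) * (2 * L N * V x / N) * (K\<^sup>2 * (n * L N)))"
    proof -
      have "sqrt a * (\<bar>K\<bar> * sqrt c) = sqrt (a * (K\<^sup>2 * c))" for a c by (simp add: real_sqrt_mult)
      then show ?thesis .
    qed
    also have "C2 * (real r + 1) powr (1 - s) * (2 * L N * V x / N) * (K\<^sup>2 * (n * L N)) =
        A * ((real r + 1) powr (1 - s) * (n / N)) * (L N)\<^sup>2"
      by (simp add: A_def power2_eq_square)
    also have "(real r + 1) powr (1 - s) * (n / N) = (real r + 1) powr (- s)"
    proof -
      have "n / N = 1 / (real r + 1)" using n1 by (simp add: nN)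
      then have "n / N = (real r + 1) powr (- 1)" by (simp add: powr_minus_divide)
      moreover have "(real r + 1) powr (1 - s) * (real r + 1) powr (- 1) = (real r + 1) powr (- s)"
        by (simp only: powr_add[symmetric]) simp
      ultimately show ?thesis by (simp only:)
    qed
    also have "A * (real r + 1) powr (- s) * (L N)\<^sup>2 \<le> \<kappa>\<^sup>2 * (L N)\<^sup>2"
    proof (rule mult_right_mono)
      have "A \<le> \<kappa>\<^sup>2 * (real r + 1) powr s" using elim assms by (simp add: field_simps)
      then show "A * (real r + 1) powr (- s) \<le> \<kappa>\<^sup>2" by (simp add: powr_minus field_simps)
    qed simp
    finally have "norm (R n (N - n) (tilt N *\<^sub>R x)) * (K * sqrt (n * L N)) \<le> sqrt ((\<kappa> * L N)\<^sup>2)"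
      by (simp add: power_mult_distrib)
    also have "\<dots> = \<kappa> * L N" using assms L0 by simp
    finally show ?case by (simp only: n_def N_def of_nat_fact)
  qed
qed

text \<open>The quantifier over \<open>Z\<close> stands inside \<open>eventually\<close>, so one
  threshold for \<open>r\<close> serves all weights and indicators of arbitrary past events can be
  inserted. Half of the loss \<eta> is due to \<open>q_upper\<close>, half to
  \<open>initial_term\<close>.\<close>

lemma tilt_mgf_upper:
  assumes eta: "\<eta> > 0" and K: "K \<ge> 0"
  shows "eventually (\<lambda>r. \<forall>Z. adapted (fact r) Z \<longrightarrow> (\<forall>\<omega>. Z \<omega> \<ge> 0) \<longrightarrow>
    (\<forall>\<omega>. Z \<omega> \<noteq> 0 \<longrightarrow> norm (S (fact r) \<omega>) \<le> K * sqrt (fact r * L (fact (Suc r)))) \<longrightarrow>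
    mgf Z (tilt (fact (Suc r)) *\<^sub>R x) (fact (Suc r)) \<le>
      exp (L (fact (Suc r)) * (V x + \<eta>)) * expectation Z) sequentially"
proof -
  define e where "e = \<eta> / (2 * (V x + 1))"
  have e: "e > 0" "e * V x \<le> \<eta> / 2" using eta V_nonneg[of x] by (auto simp: e_def field_simps)
  obtain n0 where n0: "n0 \<ge> 1" "\<And>n d x. n \<ge> n0 \<Longrightarrow> q n d x \<le> (1 + e) * ((real n + d) * V x)"
    using q_upper[OF e(1)] by blast
  have "\<eta> / 2 > 0" using eta by simp
  from initial_term[OF this, of x K] eventually_ge_at_top[of n0] eventually_ge_at_top[of 1] eventually_L_fact_ge[of 0]
  show ?thesis
  proof eventually_elim
    case (elim r)
    define n N where "n = (fact r :: nat)" and "N = (fact (Suc r) :: nat)"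
    define y where "y = tilt N *\<^sub>R x"
    have n1: "n \<ge> 1" "N \<ge> 1" "n \<le> N" "n \<ge> n0"
      using fact_ge_self[of r] elim unfolding n_def N_def by (auto intro: fact_mono_nat simp del: fact_Suc)
    have L0: "L N \<ge> 0" using elim by (simp add: N_def)
    have init: "norm (R n (N - n) y) * (K * sqrt (n * L N)) \<le> \<eta> / 2 * L N"
      using elim(1) by (simp only: n_def N_def y_def of_nat_fact)
    have "mgf Z y N \<le> exp (L N * (V x + \<eta>)) * expectation Z"
      if Z: "adapted n Z" "\<forall>\<omega>. Z \<omega> \<ge> 0" "\<forall>\<omega>. Z \<omega> \<noteq> 0 \<longrightarrow> norm (S n \<omega>) \<le> K * sqrt (n * L N)" for Z
    proof -
      have EZ: "expectation Z \<ge> 0" using Z by (intro integral_nonneg_AE) auto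
      have "mgf Z y (n + (N - n)) \<le>
          exp (q n (N - n) y / 2) * mgf Z (R n (N - n) y) n"
        using Z n1 by (intro mgf_upper) auto
      also have "\<dots> \<le> exp (q n (N - n) y / 2) * (exp (\<eta> / 2 * L N) * expectation Z)"
        using Z init by (intro mult_left_mono mgf_initial) auto
      also have "\<dots> = exp (q n (N - n) y / 2 + \<eta> / 2 * L N) * expectation Z" by (simp add: exp_add)
      also have "\<dots> \<le> exp (L N * (V x + \<eta>)) * expectation Z"
      proof -
        have "q n (N - n) y \<le> (1 + e) * ((real n + real (N - n)) * V y)" by (rule n0) (use n1 in auto)
        also have "real n + real (N - n) = N" using n1 by simp
        also have "N * V y = 2 * L N * V x" unfolding y_def by (rule tilt_V) (use n1 L0 in auto)
        finally have "q n (N - n) y / 2 \<le> L N * (V x + e * V x)" by (simp add: algebra_simps)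
        also have "\<dots> \<le> L N * (V x + \<eta> / 2)" using e L0 by (intro mult_left_mono) auto
        finally have "q n (N - n) y / 2 + \<eta> / 2 * L N \<le> L N * (V x + \<eta>)" by (simp add: algebra_simps)
        then show ?thesis using EZ by (intro mult_right_mono) auto
      qed
      finally show ?thesis using n1 by simp
    qed
    then show ?case by (simp only: n_def N_def y_def of_nat_fact) auto
  qed
qed

text \<open>\<open>mgf_lower\<close> between consecutive factorials. In the main term,
  \<open>q_lower\<close> loses \<open>n * V (R n (N - n) y)\<close>, negligible by
  \<open>R_bound\<close>. In the error terms, large drift at time \<open>j\<close> gains
  \<open>exp (- a * j)\<close> against factors of size \<open>exp (A * L N)\<close>, and
  \<open>n\<close> outgrows \<open>L N\<close>.\<close>

lemma tilt_mgf_lower: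
  assumes eta: "\<eta> > 0" and K: "K \<ge> 0"
  shows "eventually (\<lambda>r. \<forall>Z. adapted (fact r) Z \<longrightarrow> (\<forall>\<omega>. Z \<omega> \<ge> 0) \<longrightarrow>
    (\<forall>\<omega>. Z \<omega> \<noteq> 0 \<longrightarrow> norm (S (fact r) \<omega>) \<le> K * sqrt (fact r * L (fact (Suc r)))) \<longrightarrow>
    exp (L (fact (Suc r)) * (V x - \<eta>)) * expectation Z \<le>
      mgf Z (tilt (fact (Suc r)) *\<^sub>R x) (fact (Suc r))) sequentially"
proof -
  define e where "e = min (1/2) (\<eta> / (8 * (V x + 1)))"
  have e: "e > 0" "e < 1" using eta V_nonneg[of x] by (auto simp: e_def)
  have eV: "e * V x \<le> \<eta> / 8"
  proof -
    have "e * V x \<le> \<eta> / (8 * (V x + 1)) * V x" by (intro mult_right_mono V_nonneg) (simp add: e_def)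
    also have "\<dots> \<le> \<eta> / 8" using eta V_nonneg[of x] by (simp add: field_simps)
    finally show ?thesis .
  qed
  obtain \<delta> where \<delta>: "\<delta> > 0" "\<And>m t. \<bar>m\<bar> \<le> \<delta> \<Longrightarrow> \<bar>t\<bar> \<le> \<delta> \<Longrightarrow> exp (t * m + (1 - e) * t\<^sup>2 / 2) \<le> cosh t + m * sinh t"
    using cosh_sinh_lower[OF e(1)] by blast
  obtain m1 where m1: "m1 \<ge> 1" "\<And>n d x. n \<ge> m1 \<Longrightarrow> q n d x \<le> (1 + 1) * ((real n + d) * V x)"
    using q_upper[of 1] by auto
  obtain m2 where m2: "m2 \<ge> 1" "\<And>n d x. n \<ge> m2 \<Longrightarrow> V (R n d x) \<le> (real n + d) / n * V x"
    using V_R_le by blast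
  obtain m3 where m3: "m3 \<ge> 1" "\<And>n d x. n \<ge> m3 \<Longrightarrow> V (R n d x) \<le> ((real n + d) / n) powr (1 - s) * V x"
    using R_bound by blast
  define C where "C = C1 * b\<^sup>2 + 1"
  have C: "C > 0" using C1 by (simp add: C_def add_nonneg_pos)
  have VB: "V (B *v axis v 1) \<le> C" for v
    using C3(2)[of "axis v 1"] by (simp add: C3_def C_def norm_axis_1)
  \<comment> \<open>The minimiser of \<open>4 * C * l\<^sup>2 - l * \<delta>\<close>; the minimum is
    \<open>- a\<close>.\<close>
  define l where "l = \<delta> / (8 * C)"
  have l: "l > 0" using \<delta> C by (simp add: l_def)
  define a where "a = l * \<delta> / 2"
  have a: "a > 0" using l \<delta> by (simp add: a_def)
  \<comment> \<open>\<open>2 * V x\<close> comes from the prefactor with \<open>q\<close>, and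
    \<open>8 * V x + K\<^sup>2 * C2\<close> from the moment bound \<open>Cj\<close>; the 1 ensures
    positivity.\<close>
  define A where "A = 10 * V x + K\<^sup>2 * C2 + 1"
  have A: "A > 0" using V_nonneg[of x] C2 by (simp add: A_def add_nonneg_pos)
  define k where "k = real CARD('k)"
  have k: "k > 0" by (simp add: k_def)
  have "\<eta> / 4 > 0" using eta by simp
  note init = initial_term[OF this, of x K]
  have "filterlim (\<lambda>r::nat. (real r + 1) powr s) at_top sequentially" using s by real_asymp
  then have ev1: "eventually (\<lambda>r. 8 * V x / \<eta> \<le> (real r + 1) powr s) sequentially"
    by (simp add: filterlim_at_top)
  have "\<delta>\<^sup>2 / (2 * C2 * (V x + 1)) > 0" using \<delta> C2 V_nonneg[of x] by simp
  note ev2 = eventually_L_fact_le[OF this]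
  have "2 * k > 0" "A + \<eta> > 0" using k A eta by auto
  note ev3 = eventually_fact_exp[OF this a]
  define m0 where "m0 = max (max m1 m2) m3"
  from init ev1 ev2 ev3 eventually_ge_at_top[of m0] eventually_ge_at_top[of 1] eventually_L_fact_ge[of "max 0 (2 / \<eta>)"]
  show ?thesis
  proof eventually_elim
    case (elim r)
    define n N where "n = (fact r :: nat)" and "N = (fact (Suc r) :: nat)"
    define y where "y = tilt N *\<^sub>R x"
    have n1: "n \<ge> 1" "N \<ge> 1" "n \<le> N" "n \<ge> m1" "n \<ge> m2" "n \<ge> m3"
      using fact_ge_self[of r] elim unfolding n_def N_def m0_def by (auto intro: fact_mono_nat simp del: fact_Suc)
    have nN: "real N = (real r + 1) * real n" unfolding n_def N_def by (simp add: algebra_simps)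
    have "0 \<le> L N \<and> 2 / \<eta> \<le> L N" using elim(7) by (simp only: N_def max.bounded_iff)
    then have L0: "L N \<ge> 0" "L N * \<eta> \<ge> 2" using eta by (simp_all add: field_simps)
    have init: "norm (R n (N - n) y) * (K * sqrt (n * L N)) \<le> \<eta> / 4 * L N"
      using elim(1) by (simp only: n_def N_def y_def of_nat_fact)
    have el2: "L N \<le> \<delta>\<^sup>2 / (2 * C2 * (V x + 1)) * n" using elim(3) by (simp only: n_def N_def)
    have el3: "2 * k * N * exp ((A + \<eta>) * L N) \<le> exp (a * n)" using elim(4) by (simp only: n_def N_def)
    have NV: "N * V y = 2 * L N * V x" unfolding y_def by (rule tilt_V) (use n1 L0 in auto)
    have jV: "j * V (R j (N - j) y) \<le> 2 * L N * V x" if "n \<le> j" "j \<le> N" for j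
    proof -
      have "V (R j (N - j) y) \<le> (real j + real (N - j)) / j * V y"
        by (rule m2) (use that n1 in auto)
      also have "real j + real (N - j) = N" using that by simp
      finally show ?thesis using that n1 NV by (simp add: field_simps)
    qed
    \<comment> \<open>The pulled-back arguments must meet the smallness condition of
      \<open>cosh_sinh_lower\<close>. At times \<open>j \<ge> n\<close> their \<open>V\<close> is at
      most of order \<open>L N / n\<close>, which tends to 0 along factorials.\<close>
    have small: "norm (R j (N - j) y) \<le> \<delta>" if "n < j" "j \<le> N" for j
    proof (rule power2_le_imp_le)
      have "(norm (R j (N - j) y))\<^sup>2 \<le> C2 * V (R j (N - j) y)" by (rule C2)
      also have "\<dots> \<le> C2 * (2 * L N * V x / n)"
      proof (rule mult_left_mono)
        have "n * V (R j (N - j) y) \<le> j * V (R j (N - j) y)" using that V_nonneg by (intro mult_right_mono) auto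
        also have "\<dots> \<le> 2 * L N * V x" using jV that by simp
        finally show "V (R j (N - j) y) \<le> 2 * L N * V x / n" using n1 by (simp add: field_simps)
      qed (use C2 in simp)
      also have "\<dots> = 2 * C2 * V x / n * L N" by simp
      also have "\<dots> \<le> 2 * C2 * (V x + 1) / n * (\<delta>\<^sup>2 / (2 * C2 * (V x + 1)) * n)"
        using el2 L0 C2 V_nonneg[of x] by (intro mult_mono divide_right_mono) auto
      also have "\<dots> = \<delta>\<^sup>2"
      proof -
        have pd: "p / n * (d / p * n) = d" if "p > 0" for p d :: real using that n1 by simp
        have "V x + 1 > 0" using V_nonneg[of x] by simp
        then show ?thesis using C2(1) by (intro pd) simp
      qed
      finally show "(norm (R j (N - j) y))\<^sup>2 \<le> \<delta>\<^sup>2" .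
    qed (use \<delta> in simp)
    have "exp (L N * (V x - \<eta>)) * expectation Z \<le> mgf Z y N"
      if Z: "adapted n Z" "\<forall>\<omega>. Z \<omega> \<ge> 0" "\<forall>\<omega>. Z \<omega> \<noteq> 0 \<longrightarrow> norm (S n \<omega>) \<le> K * sqrt (n * L N)" for Z
    proof -
      have EZ: "expectation Z \<ge> 0" using Z by (intro integral_nonneg_AE) auto
      let ?err = "\<lambda>j. exp ((1 - e) * q j (N - j) y / 2) *
        expectation (\<lambda>\<omega>. Z \<omega> * of_bool (\<not> small_drift \<delta> j \<omega>) * exp (R j (N - j) y \<bullet> S j \<omega>))"
      have main: "exp ((1 - e) * q n (N - n) y / 2) * mgf Z (R n (N - n) y) n
          \<le> mgf Z y N + (\<Sum>j=n..<N. ?err j)"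
        using mgf_lower[of n Z \<delta> e "N - n" y] Z n1 \<delta>(2) small by simp
      have err: "?err j \<le> 2 * k * exp (A * L N - a * n) * expectation Z" if j: "n \<le> j" "j < N" for j
      proof -
        define d where "d = j - n"
        have jd: "n + d = j" using j by (simp add: d_def)
        have qj: "exp ((1 - e) * q j (N - j) y / 2) \<le> exp (2 * L N * V x)"
        proof -
          have "q j (N - j) y \<le> (1 + 1) * ((real j + real (N - j)) * V y)"
            by (rule m1) (use n1 j in auto)
          also have "real j + real (N - j) = N" using j by simp
          finally have "q j (N - j) y \<le> 4 * L N * V x" unfolding NV by simp
          moreover have "(1 - e) * q j (N - j) y \<le> 1 * q j (N - j) y"
            using e q_nonneg by (intro mult_right_mono) auto
          ultimately show ?thesis by simp
        qed
        define Cj where "Cj = exp ((8 * V x + K\<^sup>2 * C2) * L N + 4 * l\<^sup>2 * C * j) * expectation Z"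
        \<comment> \<open>A rough upper bound, with \<open>q_upper\<close> taken at
          \<open>e = 1\<close>; the constants \<open>A\<close> and \<open>l\<close> are tuned to
          it.\<close>
        have bound: "mgf Z z (n + d) \<le> Cj"
          if Vz: "V z \<le> 2 * V (R j (N - j) y) + 2 * l\<^sup>2 * C" for z
        proof -
          have jVz: "j * V z \<le> 4 * L N * V x + 2 * l\<^sup>2 * C * j"
          proof -
            have "j * V z \<le> j * (2 * V (R j (N - j) y) + 2 * l\<^sup>2 * C)" using Vz by (rule mult_left_mono) simp
            then show ?thesis using jV[of j] j by (simp add: algebra_simps)
          qed
          have q: "q n d z / 2 \<le> 4 * L N * V x + 2 * l\<^sup>2 * C * j"
          proof -
            have "q n d z \<le> (1 + 1) * ((real n + d) * V z)" by (rule m1) (use n1 in auto)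
            also have "real n + d = j" using jd by linarith
            finally show ?thesis using jVz by simp
          qed
          have r: "norm (R n d z) * (K * sqrt (n * L N)) \<le> K\<^sup>2 * C2 * L N + (4 * L N * V x + 2 * l\<^sup>2 * C * j)"
          proof -
            define P Q where "P = K\<^sup>2 * C2 * L N" and "Q = real j * V z"
            have PQ: "P \<ge> 0" "Q \<ge> 0" using C2 L0 V_nonneg[of z] by (auto simp: P_def Q_def)
            have "(norm (R n d z))\<^sup>2 \<le> C2 * V (R n d z)" by (rule C2)
            also have "\<dots> \<le> C2 * ((real n + d) / n * V z)" using m2(2)[of n d z] n1 C2 by (intro mult_left_mono) auto
            also have "real n + d = j" using jd by linarith
            also have "C2 * (j / n * V z) = C2 * Q / n" by (simp add: Q_def)
            finally have "norm (R n d z) \<le> sqrt (C2 * Q / n)" by (rule real_le_rsqrt)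
            then have "norm (R n d z) * (K * sqrt (n * L N)) \<le> sqrt (C2 * Q / n) * (K * sqrt (n * L N))"
              using K L0 by (intro mult_right_mono) auto
            also have "\<dots> = sqrt (C2 * Q / n * (K\<^sup>2 * (n * L N)))"
            proof -
              have "sqrt a * (K * sqrt c) = sqrt (a * (K\<^sup>2 * c))" for a c using K by (simp add: real_sqrt_mult)
              then show ?thesis .
            qed
            also have "C2 * Q / n * (K\<^sup>2 * (n * L N)) = P * Q" using n1 by (simp add: P_def)
            also have "sqrt (P * Q) \<le> (P + Q) / 2" using PQ by (rule arith_geo_mean_sqrt)
            also have "\<dots> \<le> P + Q" using PQ by simp
            finally show ?thesis using jVz by (simp add: P_def Q_def)
          qed
          have "mgf Z z (n + d) \<le> exp (q n d z / 2) * mgf Z (R n d z) n"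
            using Z n1 by (intro mgf_upper) auto
          also have "\<dots> \<le> exp (4 * L N * V x + 2 * l\<^sup>2 * C * j) * (exp (K\<^sup>2 * C2 * L N + (4 * L N * V x + 2 * l\<^sup>2 * C * j)) * expectation Z)"
            using Z q r by (intro mult_mono mgf_initial(1)) (auto intro: integral_nonneg_AE)
          also have "\<dots> = Cj" unfolding Cj_def mult.assoc[symmetric] exp_add[symmetric] by (simp add: algebra_simps)
          finally show ?thesis .
        qed
        have "expectation (\<lambda>\<omega>. Z \<omega> * of_bool (\<not> small_drift \<delta> (n + d) \<omega>) * exp (R j (N - j) y \<bullet> S (n + d) \<omega>))
            \<le> 2 * real CARD('k) * exp (- l * \<delta> * real (n + d)) * Cj"
        proof (rule large_drift_mgf)
          fix z assume z: "z \<in> range (\<lambda>v. R j (N - j) y + l *\<^sub>R (B *v axis v 1)) \<union> range (\<lambda>v. R j (N - j) y - l *\<^sub>R (B *v axis v 1))"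
          have lB: "V (l *\<^sub>R (B *v axis v 1)) \<le> l\<^sup>2 * C" for v
            unfolding V_scale by (intro mult_left_mono VB) simp
          from z obtain v where "z = R j (N - j) y + l *\<^sub>R (B *v axis v 1) \<or> z = R j (N - j) y + - (l *\<^sub>R (B *v axis v 1))"
            by auto
          then have "V z \<le> 2 * V (R j (N - j) y) + 2 * V (l *\<^sub>R (B *v axis v 1))"
            using V_add_le[of "R j (N - j) y" "l *\<^sub>R (B *v axis v 1)"] V_add_le[of "R j (N - j) y" "- (l *\<^sub>R (B *v axis v 1))"]
            by auto
          also have "\<dots> \<le> 2 * V (R j (N - j) y) + 2 * l\<^sup>2 * C" using lB[of v] by simp
          finally show "mgf Z z (n + d) \<le> Cj" by (rule bound)
        qed (use n1 Z l in auto)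
        then have "?err j \<le> exp (2 * L N * V x) * (2 * k * exp (- l * \<delta> * j) * Cj)"
          using qj Z(2) unfolding jd k_def[symmetric]
          by (intro mult_mono) (auto intro!: integral_nonneg_AE)
        also have "\<dots> = 2 * k * (exp (2 * L N * V x + (- l * \<delta> * j + ((8 * V x + K\<^sup>2 * C2) * L N + 4 * l\<^sup>2 * C * j))) * expectation Z)"
          unfolding Cj_def exp_add by (simp add: mult_ac)
        also have "\<dots> \<le> 2 * k * (exp (A * L N - a * n) * expectation Z)"
        proof -
          have "4 * l\<^sup>2 * C = a"
            using C by (simp add: a_def l_def power2_eq_square field_simps)
          then have "2 * L N * V x + (- l * \<delta> * j + ((8 * V x + K\<^sup>2 * C2) * L N + 4 * l\<^sup>2 * C * j)) = (A - 1) * L N - a * j"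
            by (simp add: A_def a_def algebra_simps)
          also have "\<dots> \<le> A * L N - a * n"
          proof -
            have "a * n \<le> a * j" using j a by simp
            then show ?thesis using L0 by (simp add: algebra_simps)
          qed
          finally show ?thesis using k EZ by (intro mult_left_mono mult_right_mono) auto
        qed
        finally show ?thesis by (simp add: mult.assoc)
      qed
      have sumerr: "(\<Sum>j=n..<N. ?err j) \<le> exp (- \<eta> * L N) * expectation Z"
      proof -
        have "(\<Sum>j=n..<N. ?err j) \<le> (\<Sum>j=n..<N. 2 * k * exp (A * L N - a * n) * expectation Z)"
          by (intro sum_mono err) auto
        also have "\<dots> = real (N - n) * (2 * k * exp (A * L N - a * n) * expectation Z)" by simp
        also have "\<dots> \<le> real N * (2 * k * exp (A * L N - a * n) * expectation Z)"
          using k EZ by (intro mult_right_mono) auto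
        also have "\<dots> = (2 * k * N * exp ((A + \<eta>) * L N)) * (exp (- \<eta> * L N - a * n) * expectation Z)"
        proof -
          have "exp (A * L N - a * n) = exp ((A + \<eta>) * L N) * exp (- \<eta> * L N - a * n)"
            by (simp add: exp_add[symmetric] algebra_simps)
          then show ?thesis by simp
        qed
        also have "\<dots> \<le> exp (a * n) * (exp (- \<eta> * L N - a * n) * expectation Z)"
          using el3 EZ by (intro mult_right_mono) auto
        also have "\<dots> = exp (- \<eta> * L N) * expectation Z"
          by (simp add: mult.assoc[symmetric] exp_add[symmetric])
        finally show ?thesis .
      qed
      have lower: "exp (L N * (V x - \<eta> / 2)) * expectation Z \<le>
          exp ((1 - e) * q n (N - n) y / 2) * mgf Z (R n (N - n) y) n"
      proof -
        have "q n (N - n) y \<ge> (real n + real (N - n)) * V y - real n * V (R n (N - n) y)"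
          using q_lower[of n "N - n" y] n1 by simp
        moreover have "real n + real (N - n) = N" using n1 by simp
        moreover have "n * V (R n (N - n) y) \<le> L N * \<eta> / 4"
        proof -
          have "V (R n (N - n) y) \<le> ((real n + real (N - n)) / n) powr (1 - s) * V y"
            by (rule m3) (use n1 in auto)
          also have "(real n + real (N - n)) / n = real r + 1" using n1 by (simp add: nN)
          finally have "n * V (R n (N - n) y) \<le> n * ((real r + 1) powr (1 - s) * V y)" by (rule mult_left_mono) simp
          also have "\<dots> = (real r + 1) powr (- s) * (N * V y)"
          proof -
            have "(real r + 1) powr (1 - s) = (real r + 1) powr (- s) * (real r + 1)"
              using powr_add[of "real r + 1" "- s" 1] by simp
            then show ?thesis unfolding nN by simp
          qed
          also have "\<dots> = 2 * L N * (V x * (real r + 1) powr (- s))" unfolding NV by simp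
          also have "\<dots> \<le> 2 * L N * (\<eta> / 8)"
          proof (rule mult_left_mono)
            have "V x \<le> \<eta> / 8 * (real r + 1) powr s" using elim(2) eta by (simp add: field_simps)
            then show "V x * (real r + 1) powr (- s) \<le> \<eta> / 8" by (simp add: powr_minus field_simps)
          qed (use L0 in simp)
          finally show ?thesis by (simp add: mult.commute)
        qed
        ultimately have "q n (N - n) y \<ge> L N * (2 * V x - \<eta> / 4)" using NV by (simp add: algebra_simps)
        then have "(1 - e) * q n (N - n) y \<ge> (1 - e) * (L N * (2 * V x - \<eta> / 4))"
          using e by (intro mult_left_mono) auto
        moreover have "(1 - e) * (L N * (2 * V x - \<eta> / 4)) \<ge> L N * (2 * V x - \<eta> / 2)"
        proof -
          have "(1 - e) * (2 * V x - \<eta> / 4) = 2 * V x - \<eta> / 4 - 2 * (e * V x) + e * \<eta> / 4"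
            by (simp add: field_simps)
          also have "\<dots> \<ge> 2 * V x - \<eta> / 2" using eV e eta by (simp add: zero_le_mult_iff add_increasing2)
          finally have "L N * (2 * V x - \<eta> / 2) \<le> L N * ((1 - e) * (2 * V x - \<eta> / 4))"
            using L0 by (intro mult_left_mono) auto
          then show ?thesis by (simp only: mult.left_commute)
        qed
        ultimately have "L N * (2 * V x - \<eta> / 2) \<le> (1 - e) * q n (N - n) y" by (rule order_trans[rotated])
        moreover have "L N * (V x - \<eta> / 2) = L N * (2 * V x - \<eta> / 2) / 2 - \<eta> / 4 * L N"
          by (simp add: field_simps)
        ultimately have "L N * (V x - \<eta> / 2) \<le> (1 - e) * q n (N - n) y / 2 + (- (\<eta> / 4 * L N))"
          by linarith
        then have "exp (L N * (V x - \<eta> / 2)) * expectation Z \<le> exp ((1 - e) * q n (N - n) y / 2 + (- (\<eta> / 4 * L N))) * expectation Z"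
          using EZ by (intro mult_right_mono) auto
        also have "\<dots> = exp ((1 - e) * q n (N - n) y / 2) * (exp (- (\<eta> / 4 * L N)) * expectation Z)"
          unfolding exp_add by simp
        also have "\<dots> \<le> exp ((1 - e) * q n (N - n) y / 2) * mgf Z (R n (N - n) y) n"
          using Z init by (intro mult_left_mono mgf_initial(2)) auto
        finally show ?thesis .
      qed
      \<comment> \<open>The error sum is no larger than the claimed bound because
        \<open>V x \<ge> 0\<close>, and \<open>L N * \<eta> \<ge> 2\<close> makes the gap between
        the exponents \<open>V x - \<eta>\<close> and \<open>V x - \<eta> / 2\<close> worth a factor
        2.\<close>
      have "exp (L N * (V x - \<eta>)) + exp (- \<eta> * L N) \<le> exp (L N * (V x - \<eta> / 2))"
      proof -
        have "exp (- \<eta> * L N) \<le> exp (L N * (V x - \<eta>))"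
          using L0 V_nonneg[of x] by (simp add: algebra_simps)
        then have "exp (L N * (V x - \<eta>)) + exp (- \<eta> * L N) \<le> 2 * exp (L N * (V x - \<eta>))" by simp
        also have "\<dots> \<le> exp (L N * \<eta> / 2) * exp (L N * (V x - \<eta>))"
        proof (rule mult_right_mono)
          show "2 \<le> exp (L N * \<eta> / 2)" using exp_ge_add_one_self[of "L N * \<eta> / 2"] L0 by linarith
        qed simp
        also have "\<dots> = exp (L N * (V x - \<eta> / 2))" by (simp add: exp_add[symmetric] algebra_simps)
        finally show ?thesis .
      qed
      then have "(exp (L N * (V x - \<eta>)) + exp (- \<eta> * L N)) * expectation Z \<le> exp (L N * (V x - \<eta> / 2)) * expectation Z"
        using EZ by (rule mult_right_mono)
      then show ?thesis using main sumerr lower by (simp add: distrib_right)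
    qed
    then show ?case by (simp only: n_def N_def y_def of_nat_fact) auto
  qed
qed

end

context pm_walk
begin

subsection \<open>Lower bound\<close>

definition hit :: "real^'k \<Rightarrow> real \<Rightarrow> nat \<Rightarrow> 'a \<Rightarrow> bool" where
  "hit x \<epsilon> N \<omega> \<longleftrightarrow> (\<forall>v. \<bar>S N \<omega> $ v / lil_scale N - x $ v\<bar> < \<epsilon>)"

lemma adapted_hit: "m \<le> n \<Longrightarrow> adapted n (\<lambda>\<omega>. h (hit x \<epsilon> m \<omega>))"
  unfolding hit_def by (rule adapted_S_fun)

lemma V_axis: "V (axis v 1) \<le> C1"
  using C1(2)[of "axis v 1"] by (simp add: norm_axis_1)

lemma tilt_inner: "N \<ge> 1 \<Longrightarrow> L N > 0 \<Longrightarrow> tilt N *\<^sub>R x \<bullet> S N \<omega> = 2 * L N * (\<Sum>v\<in>UNIV. x $ v * (S N \<omega> $ v / lil_scale N))"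
proof -
  assume N: "N \<ge> 1" "L N > 0"
  have a: "lil_scale N > 0" using N by (simp add: lil_scale_def)
  have "tilt N *\<^sub>R x \<bullet> S N \<omega> = tilt N * (\<Sum>v\<in>UNIV. x $ v * S N \<omega> $ v)"
    by (simp add: inner_vec_def sum_distrib_left mult.assoc)
  also have "\<dots> = tilt N * lil_scale N * (\<Sum>v\<in>UNIV. x $ v * (S N \<omega> $ v / lil_scale N))"
    using a by (simp add: sum_distrib_left)
  also have "tilt N * lil_scale N = 2 * L N" using N by (intro tilt_lil_scale) auto
  finally show ?thesis .
qed

text \<open>Under the measure tilted by \<open>\<theta>\<close> the normalised sum concentrates at \<open>G \<theta>\<close>, because perturbing \<open>\<theta>\<close>
  by \<open>\<plusminus> t\<close> along a coordinate axis changes \<open>V\<close> by \<open>\<plusminus> 2 t (G \<theta>)\<close> to first order. Undoing the tilt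
  costs at most \<open>exp (- g L N)\<close>.\<close>

lemma lower_prob_small:
  fixes \<theta> :: "real^'k"
  defines "x \<equiv> G *v \<theta>"
  assumes eps: "\<epsilon> > 0" and K: "K \<ge> 0"
  defines "g \<equiv> V \<theta> + \<epsilon>\<^sup>2 / (2 * C1) + 2 * \<epsilon> * (\<Sum>v\<in>UNIV. \<bar>\<theta> $ v\<bar>)"
  shows "eventually (\<lambda>r. \<forall>P. adapted (fact r) P \<longrightarrow>
    (\<forall>\<omega>. P \<omega> \<longrightarrow> norm (S (fact r) \<omega>) \<le> K * sqrt (fact r * L (fact (Suc r)))) \<longrightarrow>
    exp (- g * L (fact (Suc r))) * prob {\<omega> \<in> space M. P \<omega>} \<le>
      prob {\<omega> \<in> space M. P \<omega> \<and> hit x \<epsilon> (fact (Suc r)) \<omega>}) sequentially"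
proof -
  \<comment> \<open>The minimiser of \<open>t\<^sup>2 * C1 - 2 * t * \<epsilon>\<close>, the change
    of exponent when a miss of one coordinate by \<epsilon> is estimated through the tilt
    \<open>\<theta>' t v\<close>. The minimum is \<open>- 4 * \<eta>\<close>.\<close>
  define t where "t = \<epsilon> / C1"
  have t: "t > 0" using eps C1 by (simp add: t_def)
  define \<eta> where "\<eta> = t * \<epsilon> / 4"
  have \<eta>: "\<eta> > 0" using t eps by (simp add: \<eta>_def)
  define k where "k = real CARD('k)"
  have k: "k > 0" by (simp add: k_def)
  define \<theta>' where "\<theta>' c v = \<theta> + c *\<^sub>R axis v 1" for c :: real and v
  have V\<theta>': "V (\<theta>' c v) \<le> V \<theta> + 2 * c * x $ v + c\<^sup>2 * C1" for c v
  proof -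
    have "\<theta> \<bullet> (G *v (c *\<^sub>R axis v 1)) = c * x $ v"
      using G_sym[of \<theta> "axis v 1"] by (simp add: matrix_vector_mult_scaleR x_def inner_axis')
    moreover have "c\<^sup>2 * V (axis v 1) \<le> c\<^sup>2 * C1" by (intro mult_left_mono V_axis) simp
    ultimately show ?thesis unfolding \<theta>'_def V_add V_scale by simp
  qed
  have ev1: "eventually (\<lambda>r. \<forall>v. \<forall>Z. adapted (fact r) Z \<longrightarrow> (\<forall>\<omega>. Z \<omega> \<ge> 0) \<longrightarrow>
    (\<forall>\<omega>. Z \<omega> \<noteq> 0 \<longrightarrow> norm (S (fact r) \<omega>) \<le> K * sqrt (fact r * L (fact (Suc r)))) \<longrightarrow>
    mgf Z (tilt (fact (Suc r)) *\<^sub>R \<theta>' c v) (fact (Suc r)) \<le>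
      exp (L (fact (Suc r)) * (V (\<theta>' c v) + \<eta>)) * expectation Z) sequentially" for c
    by (intro eventually_all_finite tilt_mgf_upper \<eta> K)
  have "eventually (\<lambda>r. ln (4 * k) / (2 * \<eta>) \<le> L (fact (Suc r))) sequentially"
    "eventually (\<lambda>r. ln 2 / \<eta> \<le> L (fact (Suc r))) sequentially"
    by (rule eventually_L_fact_ge)+
  with ev1[of t] ev1[of "-t"] tilt_mgf_lower[OF \<eta> K, of \<theta>] eventually_L_fact_ge[of 1]
  show ?thesis
  proof eventually_elim
    case (elim r)
    define n N where "n = (fact r :: nat)" and "N = (fact (Suc r) :: nat)"
    have n1: "n \<ge> 1" "N \<ge> 1" "n \<le> N"
      unfolding n_def N_def by (auto intro: fact_mono_nat simp del: fact_Suc)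
    have L1: "L N \<ge> 1" using elim(4) by (simp only: N_def)
    have Lk: "ln (4 * k) \<le> L N * (2 * \<eta>)" "ln 2 \<le> L N * \<eta>"
      using elim(5,6) \<eta> unfolding N_def by (simp_all add: pos_divide_le_eq del: fact_Suc)
    have fr: "(fact r :: real) = real n" by (simp add: n_def)
    note up1 = elim(1)[unfolded fr, folded n_def N_def, rule_format]
    note up2 = elim(2)[unfolded fr, folded n_def N_def, rule_format]
    note low = elim(3)[unfolded fr, folded n_def N_def, rule_format]
    define U where "U \<omega> v = S N \<omega> $ v / lil_scale N" for \<omega> v
    have inner: "tilt N *\<^sub>R y \<bullet> S N \<omega> = 2 * L N * (\<Sum>v\<in>UNIV. y $ v * U \<omega> v)" for y \<omega>
      unfolding U_def using n1 L1 by (intro tilt_inner) auto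
    have inner': "tilt N *\<^sub>R \<theta>' c v \<bullet> S N \<omega> = tilt N *\<^sub>R \<theta> \<bullet> S N \<omega> + 2 * L N * c * U \<omega> v" for c v \<omega>
    proof -
      have "tilt N *\<^sub>R \<theta>' c v \<bullet> S N \<omega> = tilt N *\<^sub>R \<theta> \<bullet> S N \<omega> + c * (tilt N *\<^sub>R axis v 1 \<bullet> S N \<omega>)"
        by (simp add: \<theta>'_def inner_add_left algebra_simps)
      also have "tilt N *\<^sub>R axis v 1 \<bullet> S N \<omega> = 2 * L N * U \<omega> v"
        unfolding inner by (simp add: axis_def if_distrib if_distribR sum.delta cong: if_cong)
      finally show ?thesis by simp
    qed
    have gx: "\<theta> \<bullet> x = V \<theta>" by (simp add: V_def x_def)
    have "exp (- g * L N) * prob {\<omega> \<in> space M. P \<omega>} \<le> prob {\<omega> \<in> space M. P \<omega> \<and> hit x \<epsilon> N \<omega>}"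
      if P: "adapted n P" "\<forall>\<omega>. P \<omega> \<longrightarrow> norm (S n \<omega>) \<le> K * sqrt (n * L N)" for P
    proof -
      define Z where "Z \<omega> = (of_bool (P \<omega>) :: real)" for \<omega>
      have Z: "adapted n Z" "\<And>\<omega>. Z \<omega> \<ge> 0" unfolding Z_def using P by (auto intro: adapted_comp)
      have Z': "adapted n Z" "\<forall>\<omega>. Z \<omega> \<ge> 0" "\<forall>\<omega>. Z \<omega> \<noteq> 0 \<longrightarrow> norm (S n \<omega>) \<le> K * sqrt (n * L N)"
        using Z P by (auto simp: Z_def)
      have EZ: "expectation Z = prob {\<omega> \<in> space M. P \<omega>}"
        unfolding Z_def by (rule expectation_of_bool[OF P(1)])
      have EZ0: "expectation Z \<ge> 0" unfolding EZ by simp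
      let ?w = "\<lambda>\<omega>. exp (tilt N *\<^sub>R \<theta> \<bullet> S N \<omega>)"
      have adN: "adapted N Z" using Z(1) n1(3) by (rule adapted_mono)
      have adH: "adapted N (\<lambda>\<omega>. of_bool (hit x \<epsilon> N \<omega>) :: real)" "adapted N (\<lambda>\<omega>. of_bool (\<not> hit x \<epsilon> N \<omega>) :: real)"
        by (intro adapted_hit order_refl)+
      have int: "integrable M (\<lambda>\<omega>. Z \<omega> * of_bool (hit x \<epsilon> N \<omega>) * ?w \<omega>)"
        "integrable M (\<lambda>\<omega>. Z \<omega> * of_bool (\<not> hit x \<epsilon> N \<omega>) * ?w \<omega>)"
        "integrable M (\<lambda>\<omega>. Z \<omega> * exp (tilt N *\<^sub>R y \<bullet> S N \<omega>))" for y
        by (intro adapted_integrable[of N] adapted_mult adN adH adapted_exp_inner order_refl)+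
      have miss: "expectation (\<lambda>\<omega>. Z \<omega> * of_bool (\<not> hit x \<epsilon> N \<omega>) * ?w \<omega>) \<le>
          2 * k * exp (L N * (V \<theta> - 3 * \<eta>)) * expectation Z"
      proof -
        let ?f = "\<lambda>v \<omega>. exp (- 2 * L N * t * (x $ v + \<epsilon>)) * (Z \<omega> * exp (tilt N *\<^sub>R \<theta>' t v \<bullet> S N \<omega>))"
        let ?h = "\<lambda>v \<omega>. exp (2 * L N * t * (x $ v - \<epsilon>)) * (Z \<omega> * exp (tilt N *\<^sub>R \<theta>' (- t) v \<bullet> S N \<omega>))"
        have f: "?f v \<omega> = Z \<omega> * ?w \<omega> * exp (2 * L N * t * (U \<omega> v - x $ v - \<epsilon>))"
          and h: "?h v \<omega> = Z \<omega> * ?w \<omega> * exp (2 * L N * t * (x $ v - U \<omega> v - \<epsilon>))" for v \<omega>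
        proof -
          have comm: "a * (z * c) = z * p * r" if "a * c = p * r" for a z c p r :: real
            using that by (metis mult.assoc mult.left_commute)
          show "?f v \<omega> = Z \<omega> * ?w \<omega> * exp (2 * L N * t * (U \<omega> v - x $ v - \<epsilon>))"
            by (rule comm) (unfold inner' exp_add[symmetric], simp add: algebra_simps)
          show "?h v \<omega> = Z \<omega> * ?w \<omega> * exp (2 * L N * t * (x $ v - U \<omega> v - \<epsilon>))"
            by (rule comm) (unfold inner' exp_add[symmetric], simp add: algebra_simps)
        qed
        have fh0: "?f v \<omega> \<ge> 0" "?h v \<omega> \<ge> 0" for v \<omega> using Z by auto
        have "expectation (\<lambda>\<omega>. Z \<omega> * of_bool (\<not> hit x \<epsilon> N \<omega>) * ?w \<omega>) \<le> expectation (\<lambda>\<omega>. \<Sum>v\<in>UNIV. ?f v \<omega> + ?h v \<omega>)"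
        proof (rule integral_mono)
          show "integrable M (\<lambda>\<omega>. Z \<omega> * of_bool (\<not> hit x \<epsilon> N \<omega>) * ?w \<omega>)" by (rule int)
          show "integrable M (\<lambda>\<omega>. \<Sum>v\<in>UNIV. ?f v \<omega> + ?h v \<omega>)"
            by (intro Bochner_Integration.integrable_sum Bochner_Integration.integrable_add integrable_mult_right int)
          fix \<omega>
          show "Z \<omega> * of_bool (\<not> hit x \<epsilon> N \<omega>) * ?w \<omega> \<le> (\<Sum>v\<in>UNIV. ?f v \<omega> + ?h v \<omega>)"
          proof (cases "hit x \<epsilon> N \<omega>")
            case True
            then show ?thesis using fh0 by (auto intro!: sum_nonneg add_nonneg_nonneg)
          next
            case False
            then obtain v where v: "\<bar>U \<omega> v - x $ v\<bar> \<ge> \<epsilon>" by (auto simp: hit_def U_def not_less)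
            have ge: "Z \<omega> * ?w \<omega> * 1 \<le> Z \<omega> * ?w \<omega> * exp (2 * L N * t * z)" if "z \<ge> 0" for z
              using that t L1 Z by (intro mult_left_mono) auto
            have "Z \<omega> * ?w \<omega> \<le> ?f v \<omega> + ?h v \<omega>"
            proof (cases "U \<omega> v \<ge> x $ v")
              case True
              then have "Z \<omega> * ?w \<omega> \<le> ?f v \<omega>" using v ge[of "U \<omega> v - x $ v - \<epsilon>"] unfolding f by simp
              then show ?thesis using fh0(2)[of v \<omega>] by linarith
            next
              case False
              then have "Z \<omega> * ?w \<omega> \<le> ?h v \<omega>" using v ge[of "x $ v - U \<omega> v - \<epsilon>"] unfolding h by simp
              then show ?thesis using fh0(1)[of v \<omega>] by linarith
            qed
            also have "\<dots> \<le> (\<Sum>v\<in>UNIV. ?f v \<omega> + ?h v \<omega>)"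
              by (rule member_le_sum) (use fh0 in \<open>auto intro!: add_nonneg_nonneg\<close>)
            finally show ?thesis using False by simp
          qed
        qed
        also have "\<dots> = (\<Sum>v\<in>UNIV. expectation (\<lambda>\<omega>. ?f v \<omega> + ?h v \<omega>))"
          by (rule Bochner_Integration.integral_sum) (intro Bochner_Integration.integrable_add integrable_mult_right int)
        also have "\<dots> = (\<Sum>v\<in>UNIV. expectation (?f v) + expectation (?h v))"
          by (intro sum.cong refl Bochner_Integration.integral_add integrable_mult_right int)
        also have "\<dots> \<le> (\<Sum>v\<in>(UNIV::'k set). exp (L N * (V \<theta> - 3 * \<eta>)) * expectation Z + exp (L N * (V \<theta> - 3 * \<eta>)) * expectation Z)"
        proof (intro sum_mono add_mono)
          fix v
          have tt: "t\<^sup>2 * C1 = t * \<epsilon>" using C1(1) by (simp add: t_def power2_eq_square)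
          have "expectation (?f v) = exp (- 2 * L N * t * (x $ v + \<epsilon>)) * mgf Z (tilt N *\<^sub>R \<theta>' t v) N"
            by simp
          also have "\<dots> \<le> exp (- 2 * L N * t * (x $ v + \<epsilon>)) * (exp (L N * (V (\<theta>' t v) + \<eta>)) * expectation Z)"
            using Z' by (intro mult_left_mono up1) auto
          also have "\<dots> \<le> exp (- 2 * L N * t * (x $ v + \<epsilon>)) * (exp (L N * (V \<theta> + 2 * t * x $ v + t * \<epsilon> + \<eta>)) * expectation Z)"
            using V\<theta>'[of t v] EZ0 L1 unfolding tt by (intro mult_left_mono mult_right_mono) auto
          also have "\<dots> = exp (L N * (V \<theta> - 3 * \<eta>)) * expectation Z"
            unfolding mult.assoc[symmetric] exp_add[symmetric] by (simp add: \<eta>_def algebra_simps)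
          finally show "expectation (?f v) \<le> exp (L N * (V \<theta> - 3 * \<eta>)) * expectation Z" .
          have "expectation (?h v) = exp (2 * L N * t * (x $ v - \<epsilon>)) * mgf Z (tilt N *\<^sub>R \<theta>' (- t) v) N"
            by simp
          also have "\<dots> \<le> exp (2 * L N * t * (x $ v - \<epsilon>)) * (exp (L N * (V (\<theta>' (- t) v) + \<eta>)) * expectation Z)"
            using Z' by (intro mult_left_mono up2) auto
          also have "\<dots> \<le> exp (2 * L N * t * (x $ v - \<epsilon>)) * (exp (L N * (V \<theta> - 2 * t * x $ v + t * \<epsilon> + \<eta>)) * expectation Z)"
            using V\<theta>'[of "- t" v] EZ0 L1 tt by (intro mult_left_mono mult_right_mono) auto
          also have "\<dots> = exp (L N * (V \<theta> - 3 * \<eta>)) * expectation Z"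
            unfolding mult.assoc[symmetric] exp_add[symmetric] by (simp add: \<eta>_def algebra_simps)
          finally show "expectation (?h v) \<le> exp (L N * (V \<theta> - 3 * \<eta>)) * expectation Z" .
        qed
        finally show ?thesis by (simp add: k_def mult_ac)
      qed
      \<comment> \<open>Misses carry at most half of the tilted mass: the exponent
        \<open>V \<theta> - 3 * \<eta>\<close> against \<open>V \<theta> - \<eta>\<close> outweighs
        the \<open>2 * k\<close> one-sided events.\<close>
      have half: "2 * k * exp (L N * (V \<theta> - 3 * \<eta>)) \<le> exp (L N * (V \<theta> - \<eta>)) / 2"
      proof -
        have "exp (ln (4 * k)) \<le> exp (L N * (2 * \<eta>))" unfolding exp_le_cancel_iff by (rule Lk)
        then have "4 * k \<le> exp (L N * (2 * \<eta>))" using k by simp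
        then have "4 * k * exp (L N * (V \<theta> - 3 * \<eta>)) \<le> exp (L N * (2 * \<eta>)) * exp (L N * (V \<theta> - 3 * \<eta>))"
          by (rule mult_right_mono) simp
        also have "\<dots> = exp (L N * (V \<theta> - \<eta>))" by (simp add: exp_add[symmetric] algebra_simps)
        finally show ?thesis by simp
      qed
      have "exp (L N * (V \<theta> - \<eta>)) * expectation Z \<le> expectation (\<lambda>\<omega>. Z \<omega> * ?w \<omega>)"
        using Z' by (intro low) auto
      also have "\<dots> = expectation (\<lambda>\<omega>. Z \<omega> * of_bool (hit x \<epsilon> N \<omega>) * ?w \<omega> + Z \<omega> * of_bool (\<not> hit x \<epsilon> N \<omega>) * ?w \<omega>)"
        by (intro Bochner_Integration.integral_cong refl) auto
      also have "\<dots> = expectation (\<lambda>\<omega>. Z \<omega> * of_bool (hit x \<epsilon> N \<omega>) * ?w \<omega>) +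
          expectation (\<lambda>\<omega>. Z \<omega> * of_bool (\<not> hit x \<epsilon> N \<omega>) * ?w \<omega>)"
        by (rule Bochner_Integration.integral_add[OF int(1,2)])
      finally have "exp (L N * (V \<theta> - \<eta>)) * expectation Z \<le>
          expectation (\<lambda>\<omega>. Z \<omega> * of_bool (hit x \<epsilon> N \<omega>) * ?w \<omega>) + exp (L N * (V \<theta> - \<eta>)) / 2 * expectation Z"
        using miss mult_right_mono[OF half EZ0] by linarith
      then have "exp (L N * (V \<theta> - \<eta>)) / 2 * expectation Z \<le> expectation (\<lambda>\<omega>. Z \<omega> * of_bool (hit x \<epsilon> N \<omega>) * ?w \<omega>)"
        by (simp add: field_simps)
      \<comment> \<open>On a hit the weight \<open>?w\<close> is bounded, since the inner product of
        \<theta> with the normalised sum is within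
        \<open>\<epsilon> * (\<Sum>v\<in>UNIV. \<bar>\<theta> $ v\<bar>)\<close> of
        \<open>\<theta> \<bullet> x = V \<theta>\<close>.\<close>
      also have "\<dots> \<le> expectation (\<lambda>\<omega>. exp (2 * L N * (V \<theta> + \<epsilon> * (\<Sum>v\<in>UNIV. \<bar>\<theta> $ v\<bar>))) * (of_bool (P \<omega> \<and> hit x \<epsilon> N \<omega>)))"
      proof (rule integral_mono)
        have "adapted N (\<lambda>\<omega>. Z \<omega> * of_bool (hit x \<epsilon> N \<omega>))" by (intro adapted_mult adN adH)
        then show "integrable M (\<lambda>\<omega>. exp (2 * L N * (V \<theta> + \<epsilon> * (\<Sum>v\<in>UNIV. \<bar>\<theta> $ v\<bar>))) * (of_bool (P \<omega> \<and> hit x \<epsilon> N \<omega>)))"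
          unfolding of_bool_conj Z_def[symmetric] by (intro integrable_mult_right adapted_integrable)
        fix \<omega>
        show "Z \<omega> * of_bool (hit x \<epsilon> N \<omega>) * ?w \<omega> \<le> exp (2 * L N * (V \<theta> + \<epsilon> * (\<Sum>v\<in>UNIV. \<bar>\<theta> $ v\<bar>))) * (of_bool (P \<omega> \<and> hit x \<epsilon> N \<omega>))"
        proof (cases "hit x \<epsilon> N \<omega>")
          case True
          have "(\<Sum>v\<in>UNIV. \<theta> $ v * U \<omega> v) \<le> (\<Sum>v\<in>UNIV. \<theta> $ v * x $ v + \<epsilon> * \<bar>\<theta> $ v\<bar>)"
          proof (rule sum_mono)
            fix v
            have "\<bar>U \<omega> v - x $ v\<bar> \<le> \<epsilon>" using True by (auto simp: hit_def U_def less_imp_le)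
            then have "\<bar>\<theta> $ v\<bar> * \<bar>U \<omega> v - x $ v\<bar> \<le> \<bar>\<theta> $ v\<bar> * \<epsilon>" by (intro mult_left_mono) auto
            then have "\<theta> $ v * (U \<omega> v - x $ v) \<le> \<epsilon> * \<bar>\<theta> $ v\<bar>"
              by (metis abs_ge_self abs_mult mult.commute order_trans)
            then show "\<theta> $ v * U \<omega> v \<le> \<theta> $ v * x $ v + \<epsilon> * \<bar>\<theta> $ v\<bar>" by (simp add: algebra_simps)
          qed
          also have "\<dots> = V \<theta> + \<epsilon> * (\<Sum>v\<in>UNIV. \<bar>\<theta> $ v\<bar>)"
            unfolding gx[symmetric] by (simp add: sum.distrib sum_distrib_left inner_vec_def)
          finally have "?w \<omega> \<le> exp (2 * L N * (V \<theta> + \<epsilon> * (\<Sum>v\<in>UNIV. \<bar>\<theta> $ v\<bar>)))"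
            unfolding inner using L1 by (simp add: mult_left_mono)
          then show ?thesis using True by (simp add: Z_def)
        qed simp
      qed (rule int)
      also have "\<dots> = exp (2 * L N * (V \<theta> + \<epsilon> * (\<Sum>v\<in>UNIV. \<bar>\<theta> $ v\<bar>))) * prob {\<omega> \<in> space M. P \<omega> \<and> hit x \<epsilon> N \<omega>}"
      proof -
        have "adapted N (\<lambda>\<omega>. P \<omega> \<and> hit x \<epsilon> N \<omega>)"
          by (rule adapted_comp2[OF adapted_mono[OF P(1) n1(3)] adapted_hit[OF order_refl, where h="\<lambda>b. b"]])
        from expectation_of_bool[OF this] show ?thesis by simp
      qed
      finally have fin: "exp (L N * (V \<theta> - \<eta>)) / 2 * expectation Z \<le> exp (2 * L N * (V \<theta> + \<epsilon> * (\<Sum>v\<in>UNIV. \<bar>\<theta> $ v\<bar>))) * prob {\<omega> \<in> space M. P \<omega> \<and> hit x \<epsilon> N \<omega>}" .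
      have "exp (- g * L N) * expectation Z * exp (2 * L N * (V \<theta> + \<epsilon> * (\<Sum>v\<in>UNIV. \<bar>\<theta> $ v\<bar>))) \<le> exp (L N * (V \<theta> - \<eta>)) / 2 * expectation Z"
      proof -
        have "exp (ln 2) \<le> exp (L N * \<eta>)" unfolding exp_le_cancel_iff by (rule Lk)
        then have "2 \<le> exp (L N * \<eta>)" by simp
        moreover have "exp (L N * (V \<theta> - \<eta>)) = exp (L N * \<eta>) * (exp (- g * L N) * exp (2 * L N * (V \<theta> + \<epsilon> * (\<Sum>v\<in>UNIV. \<bar>\<theta> $ v\<bar>))))"
        proof -
          have "2 * \<eta> = \<epsilon>\<^sup>2 / (2 * C1)" by (simp add: \<eta>_def t_def power2_eq_square)
          then have "g = V \<theta> + 2 * \<eta> + 2 * \<epsilon> * (\<Sum>v\<in>UNIV. \<bar>\<theta> $ v\<bar>)" by (simp add: g_def)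
          then show ?thesis unfolding exp_add[symmetric] by (simp add: algebra_simps)
        qed
        ultimately have "2 * (exp (- g * L N) * exp (2 * L N * (V \<theta> + \<epsilon> * (\<Sum>v\<in>UNIV. \<bar>\<theta> $ v\<bar>)))) \<le> exp (L N * (V \<theta> - \<eta>))"
          by (metis exp_ge_zero mult_nonneg_nonneg mult_right_mono)
        then have "(exp (- g * L N) * exp (2 * L N * (V \<theta> + \<epsilon> * (\<Sum>v\<in>UNIV. \<bar>\<theta> $ v\<bar>)))) * expectation Z \<le> exp (L N * (V \<theta> - \<eta>)) / 2 * expectation Z"
          using EZ0 by (intro mult_right_mono) auto
        then show ?thesis by (simp only: mult_ac)
      qed
      then have "exp (2 * L N * (V \<theta> + \<epsilon> * (\<Sum>v\<in>UNIV. \<bar>\<theta> $ v\<bar>))) * (exp (- g * L N) * expectation Z) \<le>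
          exp (2 * L N * (V \<theta> + \<epsilon> * (\<Sum>v\<in>UNIV. \<bar>\<theta> $ v\<bar>))) * prob {\<omega> \<in> space M. P \<omega> \<and> hit x \<epsilon> N \<omega>}"
        using fin by (simp only: mult_ac)
      then have "exp (- g * L N) * expectation Z \<le> prob {\<omega> \<in> space M. P \<omega> \<and> hit x \<epsilon> N \<omega>}"
        by (rule mult_left_le_imp_le) simp
      then show ?thesis unfolding EZ .
    qed
    then show ?case by (simp only: n_def N_def of_nat_fact) auto
  qed
qed

text \<open>Given a past satisfying \<open>good r\<close>, a hit at time \<open>fact (Suc r)\<close>
  has probability at least \<open>1 / (r + 1)\<close>. Consecutive misses therefore multiply factors
  \<open>1 - 1 / (r + 1)\<close>, whose product telescopes to 0. \<open>good\<close> is built into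
  \<open>miss\<close> because the conditional estimate requires it; almost surely it holds from some
  \<open>r\<close> on, by \<open>lil_bounded\<close>.\<close>

lemma lil_lower:
  assumes \<theta>: "V \<theta> < 1" and eps: "\<epsilon> > 0"
  shows "AE \<omega> in M. frequently (\<lambda>n. hit (G *v \<theta>) \<epsilon> n \<omega>) sequentially"
proof -
  let ?x = "G *v \<theta>"
  \<comment> \<open>As the radius shrinks, the exponent in \<open>lower_prob_small\<close> tends to
    \<open>V \<theta> < 1\<close>; a hit with a smaller radius is also one with radius
    \<epsilon>.\<close>
  have "((\<lambda>e. V \<theta> + e\<^sup>2 / (2 * C1) + 2 * e * (\<Sum>v\<in>UNIV. \<bar>\<theta> $ v\<bar>)) \<longlongrightarrow> V \<theta> + 0\<^sup>2 / (2 * C1) + 2 * 0 * (\<Sum>v\<in>UNIV. \<bar>\<theta> $ v\<bar>)) (at_right 0)"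
    using C1(1) by (intro tendsto_intros) auto
  then have "eventually (\<lambda>e. V \<theta> + e\<^sup>2 / (2 * C1) + 2 * e * (\<Sum>v\<in>UNIV. \<bar>\<theta> $ v\<bar>) < 1) (at_right 0)"
    by (rule order_tendstoD) (use \<theta> in simp)
  moreover have "eventually (\<lambda>e. e \<in> {0<..<\<epsilon>}) (at_right (0::real))"
    by (rule eventually_at_right_real) (rule eps)
  ultimately have "eventually (\<lambda>e. e \<in> {0<..<\<epsilon>} \<and> V \<theta> + e\<^sup>2 / (2 * C1) + 2 * e * (\<Sum>v\<in>UNIV. \<bar>\<theta> $ v\<bar>) < 1) (at_right 0)"
    by eventually_elim simp
  then obtain e where e: "e > 0" "e < \<epsilon>" "V \<theta> + e\<^sup>2 / (2 * C1) + 2 * e * (\<Sum>v\<in>UNIV. \<bar>\<theta> $ v\<bar>) < 1"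
    by (auto dest: eventually_happens' [rotated])
  define g where "g = V \<theta> + e\<^sup>2 / (2 * C1) + 2 * e * (\<Sum>v\<in>UNIV. \<bar>\<theta> $ v\<bar>)"
  have g: "0 \<le> g" "g < 1" using e C1(1) V_nonneg[of \<theta>] by (auto simp: g_def intro!: add_nonneg_nonneg mult_nonneg_nonneg sum_nonneg)
  obtain K where K: "K > 0" "AE \<omega> in M. eventually (\<lambda>n. norm (S n \<omega>) \<le> K * lil_scale n) sequentially"
    using lil_bounded by blast
  \<comment> \<open>\<open>lil_scale n\<close> equals \<open>sqrt 2 * sqrt (n * L n)\<close>,
    whereas \<open>lower_prob_small\<close> measures the past by
    \<open>sqrt (n * L N)\<close>.\<close>
  define K' where "K' = K * sqrt 2"
  have K': "K' \<ge> 0" using K by (simp add: K'_def)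
  define good where "good r \<omega> \<longleftrightarrow> norm (S (fact r) \<omega>) \<le> K' * sqrt (fact r * L (fact (Suc r)))" for r \<omega>
  have ad_good: "adapted n (good r)" if "fact r \<le> n" for n r
    unfolding good_def using that by (rule adapted_S_fun)
  from lower_prob_small[OF e(1) K', of \<theta>, folded g_def good_def] eventually_exp_L_fact_ge[OF g]
  have "eventually (\<lambda>r. \<forall>P. adapted (fact r) P \<longrightarrow> (\<forall>\<omega>. P \<omega> \<longrightarrow> good r \<omega>) \<longrightarrow>
    1 / (real r + 1) * prob {\<omega> \<in> space M. P \<omega>} \<le> prob {\<omega> \<in> space M. P \<omega> \<and> hit ?x e (fact (Suc r)) \<omega>}) sequentially"
  proof eventually_elim
    case (elim r)
    show ?case
    proof (intro allI impI)
      fix P assume "adapted (fact r) P" "\<forall>\<omega>. P \<omega> \<longrightarrow> good r \<omega>"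
      then have "exp (- g * L (fact (Suc r))) * prob {\<omega> \<in> space M. P \<omega>} \<le> prob {\<omega> \<in> space M. P \<omega> \<and> hit ?x e (fact (Suc r)) \<omega>}"
        using elim(1) by blast
      then show "1 / (real r + 1) * prob {\<omega> \<in> space M. P \<omega>} \<le> prob {\<omega> \<in> space M. P \<omega> \<and> hit ?x e (fact (Suc r)) \<omega>}"
        using mult_right_mono[OF elim(2) measure_nonneg] order_trans by blast
    qed
  qed
  then obtain r0 where r0: "\<And>r P. r \<ge> r0 \<Longrightarrow> adapted (fact r) P \<Longrightarrow> (\<And>\<omega>. P \<omega> \<Longrightarrow> good r \<omega>) \<Longrightarrow>
    1 / (real r + 1) * prob {\<omega> \<in> space M. P \<omega>} \<le> prob {\<omega> \<in> space M. P \<omega> \<and> hit ?x e (fact (Suc r)) \<omega>}"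
    unfolding eventually_sequentially by blast
  define miss where "miss r \<omega> \<longleftrightarrow> good r \<omega> \<and> \<not> hit ?x e (fact (Suc r)) \<omega>" for r \<omega>
  have ad_miss: "adapted n (miss r)" if "fact (Suc r) \<le> n" for r n
  proof -
    have "fact r \<le> (fact (Suc r) :: nat)" by (intro fact_mono_nat) simp
    then show ?thesis
      unfolding miss_def using that by (intro adapted_comp2[where h="\<lambda>a b. a \<and> \<not> b"] ad_good adapted_hit[where h="\<lambda>b. b"]) auto
  qed
  have ad_all: "adapted (fact (a + m)) (\<lambda>\<omega>. \<forall>r\<in>{a..<a+m}. miss r \<omega>)" for a m
    by (intro adapted_all ad_miss fact_mono_nat) auto
  have null: "AE \<omega> in M. \<not> (\<forall>r\<ge>a. miss r \<omega>)" if a: "a \<ge> max r0 1" for a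
  proof -
    define p where "p m = prob {\<omega> \<in> space M. \<forall>r\<in>{a..<a+m}. miss r \<omega>}" for m
    have step: "p (Suc m) \<le> (1 - 1 / (real (a + m) + 1)) * p m" for m
    proof -
      define P where "P \<omega> \<longleftrightarrow> (\<forall>r\<in>{a..<a+m}. miss r \<omega>) \<and> good (a + m) \<omega>" for \<omega>
      have P: "adapted (fact (a + m)) P"
        unfolding P_def by (rule adapted_comp2[OF ad_all ad_good]) simp
      let ?H = "\<lambda>\<omega>. hit ?x e (fact (Suc (a + m))) \<omega>"
      have le: "1 / (real (a + m) + 1) * prob {\<omega> \<in> space M. P \<omega>} \<le> prob {\<omega> \<in> space M. P \<omega> \<and> ?H \<omega>}"
      proof (rule r0)
        show "adapted (fact (a + m)) P" by (rule P)
      qed (use a in \<open>simp_all add: P_def\<close>)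
      have PN: "adapted (fact (Suc (a + m))) P" using P by (rule adapted_mono) (intro fact_mono_nat, simp)
      have sets: "{\<omega> \<in> space M. P \<omega>} \<in> events" "{\<omega> \<in> space M. P \<omega> \<and> ?H \<omega>} \<in> events"
        using adapted_sets[OF P] adapted_sets[OF adapted_comp2[OF PN adapted_hit[OF order_refl, where h="\<lambda>b. b"]]] by auto
      have "{\<omega> \<in> space M. \<forall>r\<in>{a..<a+Suc m}. miss r \<omega>} = {\<omega> \<in> space M. P \<omega>} - {\<omega> \<in> space M. P \<omega> \<and> ?H \<omega>}"
        by (auto simp: P_def miss_def less_Suc_eq)
      then have "p (Suc m) = prob {\<omega> \<in> space M. P \<omega>} - prob {\<omega> \<in> space M. P \<omega> \<and> ?H \<omega>}"
        unfolding p_def using sets by (auto intro: finite_measure_Diff)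
      also have "\<dots> \<le> (1 - 1 / (real (a + m) + 1)) * prob {\<omega> \<in> space M. P \<omega>}"
        using le by (simp add: algebra_simps)
      also have "\<dots> \<le> (1 - 1 / (real (a + m) + 1)) * p m"
      proof (rule mult_left_mono)
        show "prob {\<omega> \<in> space M. P \<omega>} \<le> p m"
          unfolding p_def by (intro finite_measure_mono adapted_sets[OF ad_all]) (auto simp: P_def)
      qed simp
      finally show ?thesis .
    qed
    have pm: "p m \<le> a / (a + m)" for m
    proof (induction m)
      case 0
      then show ?case using a by (simp add: p_def)
    next
      case (Suc m)
      have "p (Suc m) \<le> (1 - 1 / (real (a + m) + 1)) * p m" by (rule step)
      also have "\<dots> \<le> (1 - 1 / (real (a + m) + 1)) * (a / (a + m))"
        by (intro mult_left_mono Suc) simp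
      also have "\<dots> = a / (a + Suc m)"
      proof -
        have "(1 - 1 / (z + 1)) * (y / z) = y / (z + 1)" if "z > 0" for y z :: real using that by (simp add: field_simps)
        from this[of "real (a + m)" a] show ?thesis using a by simp
      qed
      finally show ?case .
    qed
    have sets: "{\<omega> \<in> space M. \<forall>r\<ge>a. miss r \<omega>} \<in> events"
    proof -
      have "{\<omega> \<in> space M. \<forall>r\<ge>a. miss r \<omega>} = (\<Inter>m. {\<omega> \<in> space M. \<forall>r\<in>{a..<a+m}. miss r \<omega>})"
        by (auto) (metis add_diff_inverse_nat atLeastLessThan_iff lessI nat_less_le not_less add_Suc_right)
      also have "\<dots> \<in> events" using adapted_sets[OF ad_all] by auto
      finally show ?thesis .
    qed
    have "prob {\<omega> \<in> space M. \<forall>r\<ge>a. miss r \<omega>} \<le> a / (a + m)" for m :: nat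
    proof -
      have "prob {\<omega> \<in> space M. \<forall>r\<ge>a. miss r \<omega>} \<le> p m"
        unfolding p_def by (intro finite_measure_mono adapted_sets[OF ad_all]) auto
      then show ?thesis using pm[of m] by simp
    qed
    moreover have "(\<lambda>m::nat. real a / (a + m)) \<longlonglongrightarrow> 0" by real_asymp
    ultimately have "prob {\<omega> \<in> space M. \<forall>r\<ge>a. miss r \<omega>} \<le> 0"
      by (intro LIMSEQ_le_const) auto
    then have "prob {\<omega> \<in> space M. \<forall>r\<ge>a. miss r \<omega>} = 0" using measure_nonneg by (rule antisym)
    then show ?thesis by (rule iffD1[OF prob_Collect_eq_0[OF sets]])
  qed
  have "AE \<omega> in M. \<forall>a. a \<ge> max r0 1 \<longrightarrow> \<not> (\<forall>r\<ge>a. miss r \<omega>)"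
    unfolding AE_all_countable using null by (auto intro: AE_impI)
  with K(2) show ?thesis
  proof eventually_elim
    case (elim \<omega>)
    have "eventually (\<lambda>r. norm (S (fact r) \<omega>) \<le> K * lil_scale (fact r)) sequentially"
      by (rule eventually_compose_filterlim[OF elim(1) filterlim_fact])
    with eventually_ge_at_top[of 2] have "eventually (\<lambda>r. good r \<omega>) sequentially"
    proof eventually_elim
      case (elim r)
      have "fact 2 \<le> (fact r :: nat)" using elim by (intro fact_mono_nat) simp
      then have f2: "real (fact r) \<ge> 2" by (metis fact_2 of_nat_le_iff of_nat_numeral)
      have "fact r \<le> (fact (Suc r) :: nat)" by (intro fact_mono_nat) simp
      then have "real (fact r) \<le> real (fact (Suc r))" by (simp only: of_nat_le_iff)
      then have "ln (real (fact r)) \<le> ln (real (fact (Suc r)))" using f2 by (intro ln_mono) auto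
      moreover have "ln (real (fact r)) > 0" using f2 by simp
      ultimately have "L (fact r) \<le> L (fact (Suc r))" by (metis ln_mono)
      then have "lil_scale (fact r) \<le> sqrt (2 * (fact r * L (fact (Suc r))))"
        unfolding lil_scale_def by (simp add: mult.assoc)
      also have "\<dots> = sqrt 2 * sqrt (fact r * L (fact (Suc r)))" by (rule real_sqrt_mult)
      finally have "K * lil_scale (fact r) \<le> K * (sqrt 2 * sqrt (fact r * L (fact (Suc r))))"
        using K(1) by (intro mult_left_mono) auto
      then show ?case using elim unfolding good_def K'_def by simp
    qed
    then obtain r1 where r1: "\<And>r. r \<ge> r1 \<Longrightarrow> good r \<omega>" unfolding eventually_sequentially by blast
    show "frequently (\<lambda>n. hit ?x \<epsilon> n \<omega>) sequentially"
      unfolding frequently_sequentially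
    proof
      fix m
      define a where "a = max (max r0 1) (max r1 m)"
      obtain r where r: "r \<ge> a" "\<not> miss r \<omega>" using elim(2) unfolding a_def by (meson max.cobounded1)
      then have "hit ?x e (fact (Suc r)) \<omega>" using r1[of r] by (auto simp: miss_def a_def)
      then have "hit ?x \<epsilon> (fact (Suc r)) \<omega>" unfolding hit_def using e(2) by (meson less_trans)
      moreover have "m \<le> fact (Suc r)" using fact_ge_self[of "Suc r"] r(1) unfolding a_def by linarith
      ultimately show "\<exists>n\<ge>m. hit ?x \<epsilon> n \<omega>" by blast
    qed
  qed
qed

end

subsection \<open>The set of limit points\<close>

text \<open>Frequent visits to every ball suffice: dependent choice selects increasing indices with
  distances below \<open>1 / (i + 1)\<close>.\<close>

lemma seq_limit_points_iff:
  fixes y :: "nat \<Rightarrow> 'a::metric_space"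
  shows "l \<in> seq_limit_points y \<longleftrightarrow> (\<forall>e>0. frequently (\<lambda>n. dist (y n) l < e) sequentially)"
proof
  assume "l \<in> seq_limit_points y"
  then obtain r :: "nat \<Rightarrow> nat" where r: "strict_mono r" "(y \<circ> r) \<longlonglongrightarrow> l"
    unfolding seq_limit_points_def by blast
  show "\<forall>e>0. frequently (\<lambda>n. dist (y n) l < e) sequentially"
  proof (intro allI impI)
    fix e :: real assume "e > 0"
    with r(2) obtain n0 where n0: "\<And>n. n \<ge> n0 \<Longrightarrow> dist (y (r n)) l < e"
      unfolding lim_sequentially comp_def by blast
    show "frequently (\<lambda>n. dist (y n) l < e) sequentially"
      unfolding frequently_sequentially
    proof
      fix m
      have "m \<le> r (max m n0)" using seq_suble[OF r(1), of "max m n0"] by simp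
      then show "\<exists>n\<ge>m. dist (y n) l < e" using n0[of "max m n0"] by auto
    qed
  qed
next
  assume *: "\<forall>e>0. frequently (\<lambda>n. dist (y n) l < e) sequentially"
  have ex: "\<exists>n>m. dist (y n) l < 1 / (real i + 1)" for i m :: nat
  proof -
    have "frequently (\<lambda>n. dist (y n) l < 1 / (real i + 1)) sequentially" using * by simp
    then show ?thesis unfolding frequently_sequentially by (meson Suc_le_lessD)
  qed
  have "\<exists>r. \<forall>i. dist (y (r i)) l < 1 / (real i + 1) \<and> r i < r (Suc i)"
    by (rule dependent_nat_choice[where P="\<lambda>i n. dist (y n) l < 1 / (real i + 1)" and Q="\<lambda>_. (<)"])
      (use ex in blast)+
  then obtain r where r: "\<And>i. dist (y (r i)) l < 1 / (real i + 1)" "\<And>i. r i < r (Suc i)" by blast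
  have "(\<lambda>i. y (r i)) \<longlonglongrightarrow> l"
  proof (rule metric_tendsto_imp_tendsto)
    show "(\<lambda>i::nat. 1 / (real i + 1)) \<longlonglongrightarrow> 0" by real_asymp
    show "eventually (\<lambda>i. dist (y (r i)) l \<le> dist (1 / (real i + 1)) 0) sequentially"
      using r(1) by (auto intro!: always_eventually less_imp_le)
  qed
  then show "l \<in> seq_limit_points y"
    unfolding seq_limit_points_def using r(2) by (auto simp: strict_mono_Suc_iff comp_def)
qed

context lyapunov
begin

lemma invertible_G: "invertible G"
proof -
  have "x = 0" if "G *v x = 0" for x
    using G_pos[of x] that by auto
  then have "inj ((*v) G)"
    by (intro linear_injective_0[THEN iffD2] matrix_vector_mul_linear) auto
  then show ?thesis by (simp add: invertible_left_inverse matrix_left_invertible_injective)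
qed

lemma matrix_inv_G: "matrix_inv G *v (G *v x) = x" "G *v (matrix_inv G *v x) = x"
proof -
  have "matrix_inv G ** G = mat 1" "G ** matrix_inv G = mat 1"
    using invertible_G unfolding invertible_def matrix_inv_def by (metis (mono_tags, lifting) someI_ex)+
  then show "matrix_inv G *v (G *v x) = x" "G *v (matrix_inv G *v x) = x"
    by (simp_all add: matrix_vector_mul_assoc)
qed

text \<open>The substitution \<open>y = G *v x\<close> turns
  \<open>y \<bullet> (matrix_inv G *v y)\<close> into \<open>V x\<close>, so the ellipsoid is
  parametrised by the tilts \<theta> of the lower bound.\<close>

lemma cov_ellipsoid_eq: "cov_ellipsoid G = {G *v x |x. V x \<le> 1}"
proof -
  have "(y v* matrix_inv G) \<bullet> y = V (matrix_inv G *v y)" for y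
    unfolding V_def dot_lmul_matrix matrix_inv_G by (rule inner_commute)
  then show ?thesis
    unfolding cov_ellipsoid_def by (auto simp: matrix_inv_G) (metis matrix_inv_G(2))
qed

end

context pm_walk
begin

text \<open>Null sets are collected over a countable dense subset of the open unit ball of
  \<open>V\<close>, and density extends both halves. The upper half places limit points in the polar
  set of this ball; the lower half reaches its image under \<open>G\<close> and, by approximation,
  the boundary.\<close>

theorem lil:
  "AE \<omega> in M. compact (closure ((\<lambda>n. (1 / lil_scale n) *\<^sub>R S n \<omega>) ` {3..})) \<and>
    seq_limit_points (\<lambda>n. (1 / lil_scale n) *\<^sub>R S n \<omega>) = cov_ellipsoid G"
proof -
  obtain D :: "(real^'k) set" where D: "countable D" "\<And>U. open U \<Longrightarrow> U \<noteq> {} \<Longrightarrow> \<exists>d\<in>D. d \<in> U"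
    using countable_dense_exists[where 'a="real^'k"] by blast
  define D' where "D' = {d \<in> D. V d < 1}"
  have D': "countable D'" "\<And>d. d \<in> D' \<Longrightarrow> V d < 1" using D(1) by (auto simp: D'_def)
  have "open {\<theta>. V \<theta> < 1}"
    using open_Collect_less[OF continuous_V[of UNIV] continuous_on_const] .
  then have dense: "\<exists>d\<in>D'. d \<in> U" if "open U" "\<theta> \<in> U" "V \<theta> < 1" for U \<theta>
    using D(2)[of "U \<inter> {\<theta>. V \<theta> < 1}"] that unfolding D'_def by (auto intro: open_Int)
  obtain K where K: "AE \<omega> in M. eventually (\<lambda>n. norm (S n \<omega>) \<le> K * lil_scale n) sequentially"
    using lil_bounded by blast
  have up: "AE \<omega> in M. \<forall>d\<in>D'. \<forall>m. eventually (\<lambda>n. d \<bullet> S n \<omega> \<le> (1 + 1 / (real m + 1)) * lil_scale n) sequentially"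
    unfolding AE_ball_countable[OF D'(1)] AE_all_countable
    using D'(2) by (intro ballI allI lil_upper) (auto intro: less_imp_le)
  have low: "AE \<omega> in M. \<forall>d\<in>D'. \<forall>m. frequently (\<lambda>n. hit (G *v d) (1 / (real m + 1)) n \<omega>) sequentially"
    unfolding AE_ball_countable[OF D'(1)] AE_all_countable
    using D'(2) by (intro ballI allI lil_lower) auto
  from K up low show ?thesis
  proof eventually_elim
    case (elim \<omega>)
    define y where "y n = (1 / lil_scale n) *\<^sub>R S n \<omega>" for n
    have pos: "eventually (\<lambda>n. lil_scale n > 0) sequentially"
      using eventually_L_ge[of 1] eventually_gt_at_top[of 0]
      by eventually_elim (simp add: lil_scale_def)
    have "eventually (\<lambda>n. norm (y n) \<le> K) sequentially"
      using elim(1) pos by eventually_elim (simp add: y_def field_simps)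
    then have "Bseq y" by (rule BfunI)
    then have "bounded (range y)" by (simp add: Bseq_eq_bounded)
    then have "bounded (y ` {3..})" by (rule bounded_subset) auto
    then have cpt: "compact (closure (y ` {3..}))" by (simp add: compact_closure)
    have sub: "l \<in> cov_ellipsoid G" if l: "l \<in> seq_limit_points y" for l
    proof -
      obtain r :: "nat \<Rightarrow> nat" where r: "strict_mono r" "(y \<circ> r) \<longlonglongrightarrow> l"
        using l unfolding seq_limit_points_def by blast
      have dl: "d \<bullet> l \<le> 1" if d: "d \<in> D'" for d
      proof (rule field_le_epsilon)
        fix e :: real assume "e > 0"
        then obtain m where m: "1 / (real m + 1) < e" by (metis add.commute nat_approx_posE of_nat_Suc)
        have "eventually (\<lambda>n. d \<bullet> S n \<omega> \<le> (1 + 1 / (real m + 1)) * lil_scale n) sequentially" using elim(2) d by blast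
        then have "eventually (\<lambda>n. d \<bullet> y n \<le> 1 + 1 / (real m + 1)) sequentially"
          using pos by eventually_elim (simp add: y_def pos_divide_le_eq)
        then have ev: "eventually (\<lambda>n. d \<bullet> (y \<circ> r) n \<le> 1 + 1 / (real m + 1)) sequentially"
          unfolding comp_def by (rule eventually_compose_filterlim[OF _ filterlim_subseq[OF r(1)]])
        have "(\<lambda>n. d \<bullet> (y \<circ> r) n) \<longlonglongrightarrow> d \<bullet> l" by (intro tendsto_inner tendsto_const r(2))
        from tendsto_upperbound[OF this ev] have "d \<bullet> l \<le> 1 + 1 / (real m + 1)" by simp
        then show "d \<bullet> l \<le> 1 + e" using m by simp
      qed
      have all: "\<theta> \<bullet> l \<le> 1" if \<theta>: "V \<theta> < 1" for \<theta>
      proof (rule ccontr)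
        assume "\<not> \<theta> \<bullet> l \<le> 1"
        then have "\<theta> \<in> {\<theta>. 1 < \<theta> \<bullet> l}" by simp
        moreover have "open {\<theta>. 1 < \<theta> \<bullet> l}" by (intro open_Collect_less continuous_intros)
        ultimately obtain d where "d \<in> D'" "1 < d \<bullet> l" using dense[OF _ _ \<theta>] by blast
        then show False using dl[of d] by simp
      qed
      define \<phi> where "\<phi> = matrix_inv G *v l"
      have G\<phi>: "G *v \<phi> = l" by (simp add: \<phi>_def matrix_inv_G)
      have "V \<phi> \<le> 1"
      proof (rule ccontr)
        assume "\<not> V \<phi> \<le> 1"
        then have v: "V \<phi> > 1" by simp
        \<comment> \<open>A contradiction needs
          \<open>t\<^sup>2 * V \<phi> < 1 < t * V \<phi>\<close>; this \<open>t\<close> satisfies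
          both because \<open>4 * V \<phi> < (V \<phi> + 1)\<^sup>2\<close> and
          \<open>V \<phi> > 1\<close>.\<close>
        define t where "t = 2 / (V \<phi> + 1)"
        have "(V \<phi> - 1)\<^sup>2 > 0" using v by simp
        then have "4 * V \<phi> < (V \<phi> + 1)\<^sup>2" by (simp add: power2_eq_square algebra_simps)
        then have "V (t *\<^sub>R \<phi>) < 1" using v by (simp add: V_scale t_def power_divide)
        then have "t *\<^sub>R \<phi> \<bullet> l \<le> 1" by (rule all)
        moreover have "\<phi> \<bullet> l = V \<phi>" by (simp add: V_def G\<phi>)
        ultimately have "t * V \<phi> \<le> 1" by simp
        then show False using v by (simp add: t_def field_simps)
      qed
      then show ?thesis using G\<phi> by (auto simp: cov_ellipsoid_eq)
    qed
    have sup: "x \<in> seq_limit_points y" if "x \<in> cov_ellipsoid G" for x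
      unfolding seq_limit_points_iff
    proof (intro allI impI)
      fix e :: real assume e: "e > 0"
      obtain \<phi> where \<phi>: "x = G *v \<phi>" "V \<phi> \<le> 1" using \<open>x \<in> cov_ellipsoid G\<close> by (auto simp: cov_ellipsoid_eq)
      let ?U = "{\<theta>. dist (G *v \<theta>) x < e / 2}"
      have "open ?U" by (intro open_Collect_less continuous_intros matrix_vector_mult_linear_continuous_on)
      \<comment> \<open>A boundary point of the ellipsoid is approached from inside by scaling,
        since \<open>lil_lower\<close> requires \<open>V\<close> strictly below 1.\<close>
      have "((\<lambda>t. dist (G *v (t *\<^sub>R \<phi>)) x) \<longlongrightarrow> dist (1 *\<^sub>R (G *v \<phi>)) x) (at_left 1)"
        unfolding matrix_vector_mult_scaleR by (intro tendsto_intros)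
      then have "eventually (\<lambda>t. dist (G *v (t *\<^sub>R \<phi>)) x < e / 2) (at_left 1)"
        by (rule order_tendstoD) (use e \<phi> in simp)
      moreover have "eventually (\<lambda>t. t \<in> {0<..<1}) (at_left (1::real))" by (rule eventually_at_left_real) simp
      ultimately have "eventually (\<lambda>t. t \<in> {0<..<1} \<and> dist (G *v (t *\<^sub>R \<phi>)) x < e / 2) (at_left 1)"
        by eventually_elim simp
      then obtain t :: real where t: "0 < t" "t < 1" "dist (G *v (t *\<^sub>R \<phi>)) x < e / 2"
        by (auto dest: eventually_happens' [rotated])
      have "V (t *\<^sub>R \<phi>) \<le> t\<^sup>2 * 1" unfolding V_scale by (intro mult_left_mono \<phi>) simp
      also have "\<dots> < 1" using t by (simp add: power_less_one_iff)
      finally obtain d where d: "d \<in> D'" "dist (G *v d) x < e / 2"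
        using dense[OF \<open>open ?U\<close>, of "t *\<^sub>R \<phi>"] t by auto
      have "e / (2 * CARD('k)) > 0" using e by simp
      then obtain m where m: "1 / (real m + 1) < e / (2 * CARD('k))" by (metis add.commute nat_approx_posE of_nat_Suc)
      have "frequently (\<lambda>n. hit (G *v d) (1 / (real m + 1)) n \<omega>) sequentially" using elim(3) d by blast
      then show "frequently (\<lambda>n. dist (y n) x < e) sequentially"
      proof (rule frequently_elim1)
        fix n assume h: "hit (G *v d) (1 / (real m + 1)) n \<omega>"
        have "dist (y n) (G *v d) \<le> (\<Sum>v\<in>UNIV. \<bar>(y n - G *v d) $ v\<bar>)"
          unfolding dist_norm by (rule norm_le_l1_cart)
        also have "\<dots> \<le> (\<Sum>v\<in>(UNIV::'k set). 1 / (real m + 1))"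
          using h by (intro sum_mono) (auto simp: hit_def y_def intro: less_imp_le)
        also have "\<dots> = CARD('k) * (1 / (real m + 1))" by simp
        also have "\<dots> < CARD('k) * (e / (2 * CARD('k)))" using m by (intro mult_strict_left_mono) auto
        also have "\<dots> = e / 2" by simp
        finally show "dist (y n) x < e" using d(2) dist_triangle[of "y n" x "G *v d"] by simp
      qed
    qed
    show ?case using cpt sub sup unfolding y_def[symmetric] by blast
  qed
qed

end

subsection \<open>Stability and the Lyapunov equation\<close>

definition mpow :: "real^'n^'n \<Rightarrow> nat \<Rightarrow> real^'n^'n" where
  "mpow A m = (((**) A) ^^ m) (mat 1)"

lemma mpow_0 [simp]: "mpow A 0 = mat 1"
  and mpow_Suc: "mpow A (Suc m) = A ** mpow A m"
  by (simp_all add: mpow_def)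

lemma mpow_Suc2: "mpow A (Suc m) = mpow A m ** A"
  by (induction m) (simp_all add: mpow_Suc matrix_mul_assoc)

lemma mpow_scaleR: "mpow (t *\<^sub>R A) m = t ^ m *\<^sub>R mpow A m"
  by (induction m) (simp_all add: mpow_Suc scalar_matrix_assoc matrix_scalar_ac mult.commute)

lemma mpow_transpose: "mpow (transpose A) m = transpose (mpow A m)"
  by (induction m) (simp_all add: mpow_Suc2[of A] mpow_Suc[of "transpose A"] matrix_transpose_mul transpose_mat)

lemma complex_matrix_mul: "complex_matrix (A ** B) = complex_matrix A ** complex_matrix B"
  by (simp add: complex_matrix_def matrix_matrix_mult_def vec_eq_iff)

lemma complex_matrix_mat: "complex_matrix (mat 1) = mat 1"
  by (simp add: complex_matrix_def mat_def vec_eq_iff)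

lemma complex_matrix_mpow: "complex_matrix (mpow A m) *v x = ((*v) (complex_matrix A) ^^ m) x"
  by (induction m) (simp_all add: complex_matrix_mat mpow_Suc complex_matrix_mul matrix_vector_mul_assoc[symmetric])

text \<open>A real matrix is annihilated by a polynomial. Splitting off its roots \<open>l\<close> one at a time,
  \<open>C\<^sup>i x\<close> satisfies a first-order recursion with factor \<open>l\<close> if \<open>l\<close> is an eigenvalue; otherwise
  \<open>C - l I\<close> is injective and the factor can be cancelled.\<close>

definition poly_shift :: "complex poly \<Rightarrow> (nat \<Rightarrow> complex^'n) \<Rightarrow> complex^'n" where
  "poly_shift q u = (\<Sum>i\<le>degree q. coeff q i *s u i)"

lemma poly_shift_bound:
  assumes "degree q \<le> n"
  shows "poly_shift q u = (\<Sum>i\<le>n. coeff q i *s u i)"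
  unfolding poly_shift_def using assms
  by (intro sum.mono_neutral_left) (auto simp: coeff_eq_0)

text \<open>A linear factor acts on a sequence as a first-order difference operator, so roots can be
  split off one by one.\<close>

lemma poly_shift_factor:
  "poly_shift ([:- a, 1:] * q) u = poly_shift q (\<lambda>i. u (Suc i) - a *s u i)"
proof -
  have deg: "degree ([:- a, 1:] * q) \<le> Suc (degree q)"
    using degree_mult_le[of "[:- a, 1:]" q] by simp
  have c: "coeff ([:- a, 1:] * q) i = coeff (pCons 0 q) i - a * coeff q i" for i
    by (simp add: algebra_simps)
  have "poly_shift ([:- a, 1:] * q) u $ v = poly_shift q (\<lambda>i. u (Suc i) - a *s u i) $ v" for v
  proof -
    have "poly_shift ([:- a, 1:] * q) u $ v = (\<Sum>i\<le>Suc (degree q). (coeff (pCons 0 q) i - a * coeff q i) * u i $ v)"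
      unfolding poly_shift_bound[OF deg] c by (simp only: sum_component vector_smult_component)
    also have "\<dots> = (\<Sum>i\<le>Suc (degree q). coeff (pCons 0 q) i * u i $ v) - (\<Sum>i\<le>Suc (degree q). a * coeff q i * u i $ v)"
      by (simp only: left_diff_distrib sum_subtractf)
    also have "(\<Sum>i\<le>Suc (degree q). coeff (pCons 0 q) i * u i $ v) = (\<Sum>i\<le>degree q. coeff q i * u (Suc i) $ v)"
      by (subst sum.atMost_Suc_shift) simp
    also have "(\<Sum>i\<le>Suc (degree q). a * coeff q i * u i $ v) = (\<Sum>i\<le>degree q. a * coeff q i * u i $ v)"
      by (simp add: coeff_eq_0)
    also have "(\<Sum>i\<le>degree q. coeff q i * u (Suc i) $ v) - (\<Sum>i\<le>degree q. a * coeff q i * u i $ v) =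
        poly_shift q (\<lambda>i. u (Suc i) - a *s u i) $ v"
      by (simp add: poly_shift_def sum_component sum_subtractf algebra_simps)
    finally show ?thesis .
  qed
  then show ?thesis by (simp add: vec_eq_iff)
qed

text \<open>Repeated vectors are a separate case, since dependence of the image set does not see
  them.\<close>

lemma linear_dependence_sequence:
  fixes f :: "nat \<Rightarrow> 'a::euclidean_space"
  shows "\<exists>c. (\<exists>i\<le>DIM('a). c i \<noteq> 0) \<and> (\<Sum>i\<le>DIM('a). c i *\<^sub>R f i) = 0"
proof (cases "inj_on f {..DIM('a)}")
  case True
  then have "card (f ` {..DIM('a)}) = DIM('a) + 1" by (simp add: card_image)
  then have "dependent (f ` {..DIM('a)})" by (intro dependent_biggerset) simp
  then obtain u where u: "\<exists>v\<in>f ` {..DIM('a)}. u v \<noteq> 0" "(\<Sum>v\<in>f ` {..DIM('a)}. u v *\<^sub>R v) = 0"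
    using dependent_finite[of "f ` {..DIM('a)}"] by auto
  then show ?thesis using True by (intro exI[of _ "u \<circ> f"]) (auto simp: sum.reindex)
next
  case False
  then obtain i j where ij: "i \<le> DIM('a)" "j \<le> DIM('a)" "i \<noteq> j" "f i = f j" by (auto simp: inj_on_def)
  define c where "c m = (if m = i then 1 else if m = j then - 1 else 0 :: real)" for m
  have "(\<Sum>m\<le>DIM('a). c m *\<^sub>R f m) = (\<Sum>m\<in>{i, j}. c m *\<^sub>R f m)"
    using ij by (intro sum.mono_neutral_right) (auto simp: c_def)
  also have "\<dots> = 0" using ij by (simp add: c_def)
  finally show ?thesis using ij by (intro exI[of _ c]) (auto simp: c_def)
qed

text \<open>The powers of \<open>A\<close> up to the dimension of the matrix space are linearly
  dependent; the coefficients of a dependence form the polynomial.\<close>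

lemma annihilating_poly:
  fixes A :: "real^'n^'n"
  obtains p :: "complex poly" where "p \<noteq> 0" "\<And>x. poly_shift p (\<lambda>i. ((*v) (complex_matrix A) ^^ i) x) = 0"
proof -
  let ?d = "DIM(real^'n^'n)"
  obtain c where c: "\<exists>i\<le>?d. c i \<noteq> 0" "(\<Sum>i\<le>?d. c i *\<^sub>R mpow A i) = 0"
    using linear_dependence_sequence[of "mpow A"] by blast
  define p where "p = (\<Sum>i\<le>?d. monom (complex_of_real (c i)) i)"
  have coeff: "coeff p i = (if i \<le> ?d then complex_of_real (c i) else 0)" for i
    by (simp add: p_def coeff_sum sum.delta)
  have "p \<noteq> 0" using c(1) coeff by (metis coeff_0 of_real_eq_0_iff)
  have deg: "degree p \<le> ?d" by (rule degree_le) (simp add: coeff)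
  have "poly_shift p (\<lambda>i. ((*v) (complex_matrix A) ^^ i) x) $ v = 0" for x v
  proof -
    have "poly_shift p (\<lambda>i. ((*v) (complex_matrix A) ^^ i) x) $ v =
        (\<Sum>i\<le>?d. complex_of_real (c i) * (\<Sum>w\<in>UNIV. complex_of_real (mpow A i $ v $ w) * x $ w))"
      unfolding poly_shift_bound[OF deg] complex_matrix_mpow[symmetric]
      by (simp add: coeff sum_component matrix_vector_mult_def complex_matrix_def)
    also have "\<dots> = (\<Sum>w\<in>UNIV. (\<Sum>i\<le>?d. complex_of_real (c i * mpow A i $ v $ w)) * x $ w)"
      unfolding sum_distrib_left sum_distrib_right by (subst sum.swap) (simp add: mult.assoc)
    also have "\<dots> = (\<Sum>w\<in>UNIV. complex_of_real ((\<Sum>i\<le>?d. c i *\<^sub>R mpow A i) $ v $ w) * x $ w)"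
      by (simp add: sum_component)
    also have "\<dots> = 0" unfolding c(2) by simp
    finally show ?thesis .
  qed
  then show ?thesis using that \<open>p \<noteq> 0\<close> by (simp add: vec_eq_iff)
qed

text \<open>Every eigenvalue is a root of the annihilating polynomial.\<close>

lemma finite_eigenvalues: "finite (eigenvalues (complex_matrix A))"
proof -
  obtain p :: "complex poly" where p: "p \<noteq> 0" "\<And>x. poly_shift p (\<lambda>i. ((*v) (complex_matrix A) ^^ i) x) = 0"
    by (rule annihilating_poly[of A]) blast
  have "poly p l = 0" if l: "l \<in> eigenvalues (complex_matrix A)" for l
  proof -
    obtain x where x: "x \<noteq> 0" "complex_matrix A *v x = l *s x" using l by (auto simp: eigenvalues_def)
    have it: "((*v) (complex_matrix A) ^^ i) x = l ^ i *s x" for i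
      by (induction i) (simp_all add: vector_scalar_commute x(2) vector_smult_assoc mult.commute)
    obtain v where v: "x $ v \<noteq> 0" using x(1) by (auto simp: vec_eq_iff)
    have "0 = poly_shift p (\<lambda>i. l ^ i *s x) $ v" using p(2)[of x] by (simp add: it)
    also have "\<dots> = poly p l * x $ v"
      by (simp add: poly_shift_def sum_component poly_altdef sum_distrib_right mult.assoc)
    finally show ?thesis using v by simp
  qed
  then have "eigenvalues (complex_matrix A) \<subseteq> {l. poly p l = 0}" by blast
  then show ?thesis using poly_roots_finite[OF p(1)] by (rule finite_subset)
qed

lemma contraction_tendsto_0:
  fixes a e :: "nat \<Rightarrow> real"
  assumes "\<And>k. a k \<ge> 0" "\<And>k. a (Suc k) \<le> r * a k + e k" "0 \<le> r" "r < 1" "e \<longlonglongrightarrow> 0"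
  shows "a \<longlonglongrightarrow> 0"
proof (rule LIMSEQ_I)
  fix d :: real assume d: "d > 0"
  \<comment> \<open>With this threshold, \<open>d / 2\<close> is the fixed point of the recursion
    \<open>a = r * a + (1 - r) * d / 2\<close>.\<close>
  have "(1 - r) * d / 2 > 0" using assms d by simp
  from order_tendstoD(2)[OF assms(5) this] obtain K where K: "\<And>k. k \<ge> K \<Longrightarrow> e k < (1 - r) * d / 2"
    unfolding eventually_sequentially by blast
  have bound: "a (K + j) \<le> r ^ j * a K + d / 2" for j
  proof (induction j)
    case (Suc j)
    have "a (K + Suc j) \<le> r * a (K + j) + e (K + j)" using assms(2) by simp
    also have "\<dots> \<le> r * (r ^ j * a K + d / 2) + (1 - r) * d / 2"
      using Suc K[of "K + j"] assms by (intro add_mono mult_left_mono) auto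
    also have "\<dots> = r ^ Suc j * a K + d / 2" by (simp add: field_simps)
    finally show ?case .
  qed (use d in simp)
  have "(\<lambda>j. r ^ j * a K) \<longlonglongrightarrow> 0 * a K"
    using assms by (intro tendsto_mult tendsto_const LIMSEQ_realpow_zero)
  then have "eventually (\<lambda>j. r ^ j * a K < d / 2) sequentially"
    by (rule order_tendstoD) (use d in simp)
  then obtain J where J: "\<And>j. j \<ge> J \<Longrightarrow> r ^ j * a K < d / 2" unfolding eventually_sequentially by blast
  have "norm (a n - 0) < d" if "n \<ge> K + J" for n
  proof -
    have "n = K + (n - K)" "n - K \<ge> J" using that by simp_all
    then show ?thesis using bound[of "n - K"] J[of "n - K"] assms(1)[of n] by simp
  qed
  then show "\<exists>no. \<forall>n\<ge>no. norm (a n - 0) < d" by blast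
qed

lemma iterate_tendsto_0:
  fixes C :: "complex^'n^'n"
  assumes eig: "\<And>l. l \<in> eigenvalues C \<Longrightarrow> cmod l < 1"
    and "p \<noteq> 0" "poly_shift p (\<lambda>i. ((*v) C ^^ i) x) = 0"
  shows "(\<lambda>i. ((*v) C ^^ i) x $ v) \<longlonglongrightarrow> 0"
  using assms(2,3)
proof (induction "degree p" arbitrary: p x v rule: less_induct)
  case less
  have lin: "((*v) C ^^ i) (C *v y - l *s y) = ((*v) C ^^ Suc i) y - l *s ((*v) C ^^ i) y"
    "((*v) C ^^ i) (C *v y - l *s y) = C *v (((*v) C ^^ i) y) - l *s ((*v) C ^^ i) y" for i l y
    by (induction i) (simp_all add: matrix_vector_mult_diff_distrib vector_scalar_commute)
  show ?case
  proof (cases "degree p = 0")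
    case True
    then obtain c where "p = [:c:]" by (rule degree_eq_zeroE)
    then have "x = 0" using less.prems by (simp add: poly_shift_def vec_eq_iff)
    moreover have "((*v) C ^^ i) 0 = 0" for i by (induction i) simp_all
    ultimately show ?thesis by simp
  next
    case False
    then obtain l where "poly p l = 0"
      using fundamental_theorem_of_algebra[of p] by (auto simp: constant_degree)
    then obtain q where q: "p = [:- l, 1:] * q" by (auto simp: poly_eq_0_iff_dvd)
    have q0: "q \<noteq> 0" using q less.prems by auto
    have "degree p = degree [:- l, 1:] + degree q" unfolding q by (rule degree_mult_eq) (use q0 in auto)
    then have dq: "degree q < degree p" by simp
    let ?y = "C *v x - l *s x"
    have y: "poly_shift q (\<lambda>i. ((*v) C ^^ i) ?y) = 0"
      using less.prems(2) unfolding q poly_shift_factor lin(1) .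
    show ?thesis
    proof (cases "l \<in> eigenvalues C")
      case True
      have "(\<lambda>i. ((*v) C ^^ i) ?y $ v) \<longlonglongrightarrow> 0" by (rule less.hyps[OF dq q0 y])
      then have e: "(\<lambda>i. cmod (((*v) C ^^ i) ?y $ v)) \<longlonglongrightarrow> 0" by (rule tendsto_norm_zero)
      have "(\<lambda>i. cmod (((*v) C ^^ i) x $ v)) \<longlonglongrightarrow> 0"
      proof (rule contraction_tendsto_0[OF _ _ _ eig[OF True] e])
        fix i
        have "((*v) C ^^ Suc i) x $ v = l * ((*v) C ^^ i) x $ v + ((*v) C ^^ i) ?y $ v"
          unfolding lin(1) by simp
        then show "cmod (((*v) C ^^ Suc i) x $ v) \<le> cmod l * cmod (((*v) C ^^ i) x $ v) + cmod (((*v) C ^^ i) ?y $ v)"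
          by (metis norm_mult norm_triangle_ineq)
      qed auto
      then show ?thesis by (rule tendsto_norm_zero_cancel)
    next
      case False
      let ?z = "poly_shift q (\<lambda>i. ((*v) C ^^ i) x)"
      have "C *v ?z - l *s ?z = poly_shift q (\<lambda>i. ((*v) C ^^ i) ?y)"
      proof -
        have "C *v ?z = (\<Sum>i\<le>degree q. coeff q i *s (C *v ((*v) C ^^ i) x))"
          unfolding poly_shift_def by (simp add: vec.linear_sum[OF matrix_vector_mul_linear_gen] vector_scalar_commute)
        then show ?thesis
          unfolding lin(2) poly_shift_def
          by (simp add: vec_eq_iff sum_component sum_subtractf[symmetric] sum_distrib_left algebra_simps)
      qed
      then have "C *v ?z = l *s ?z" using y by simp
      then have "?z = 0" using False by (auto simp: eigenvalues_def)
      then show ?thesis by (rule less.hyps[OF dq q0])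
    qed
  qed
qed

lemma mpow_tendsto_0:
  fixes C :: "real^'n^'n"
  assumes "\<And>l. l \<in> eigenvalues (complex_matrix C) \<Longrightarrow> cmod l < 1"
  shows "(\<lambda>k. mpow C k $ i $ j) \<longlonglongrightarrow> 0"
proof -
  obtain p :: "complex poly" where p: "p \<noteq> 0" "\<And>x. poly_shift p (\<lambda>i. ((*v) (complex_matrix C) ^^ i) x) = 0"
    by (rule annihilating_poly[of C]) blast
  have "(\<lambda>k. ((*v) (complex_matrix C) ^^ k) (axis j 1) $ i) \<longlonglongrightarrow> 0"
    by (rule iterate_tendsto_0[OF assms p])
  moreover have "((*v) (complex_matrix C) ^^ k) (axis j 1) $ i = complex_of_real (mpow C k $ i $ j)" for k
    unfolding complex_matrix_mpow[symmetric]
    by (simp add: complex_matrix_def matrix_vector_mult_def axis_def if_distrib sum.delta cong: if_cong)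
  ultimately have "(\<lambda>k. complex_of_real (mpow C k $ i $ j)) \<longlonglongrightarrow> complex_of_real 0" by simp
  then show ?thesis by (simp only: tendsto_of_real_iff)
qed

lemma norm_matrix_vector_le:
  fixes A :: "real^'n^'m"
  shows "norm (A *v x) \<le> (\<Sum>i\<in>UNIV. \<Sum>j\<in>UNIV. \<bar>A $ i $ j\<bar>) * norm x"
proof -
  have "norm (A *v x) \<le> (\<Sum>i\<in>UNIV. \<bar>(A *v x) $ i\<bar>)" by (rule norm_le_l1_cart)
  also have "\<dots> \<le> (\<Sum>i\<in>UNIV. \<Sum>j\<in>UNIV. \<bar>A $ i $ j\<bar> * norm x)"
    unfolding matrix_vector_mult_def
    by (auto intro!: sum_mono order_trans[OF sum_abs] mult_left_mono component_le_norm_cart simp: abs_mult)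
  also have "\<dots> = (\<Sum>i\<in>UNIV. \<Sum>j\<in>UNIV. \<bar>A $ i $ j\<bar>) * norm x" by (simp add: sum_distrib_right)
  finally show ?thesis .
qed

text \<open>An explicit Euler step turns the eigenvalue \<open>l\<close> into
  \<open>1 + h * l\<close>, of squared modulus
  \<open>1 + h * (2 * Re l + h * (cmod l)\<^sup>2)\<close>. As there are finitely many eigenvalues,
  one \<open>h\<close> serves all; stability of the flow is thereby reduced to powers of a
  matrix.\<close>

lemma exists_stable_step:
  fixes A :: "real^'n^'n"
  assumes "\<And>l. l \<in> eigenvalues (complex_matrix A) \<Longrightarrow> Re l < 0"
  shows "\<exists>h>0. \<forall>l \<in> eigenvalues (complex_matrix (mat 1 + h *\<^sub>R A)). cmod l < 1"
proof -
  let ?E = "eigenvalues (complex_matrix A)"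
  have "eventually (\<lambda>h. cmod (1 + of_real h * l) < 1) (at_right 0)" if "l \<in> ?E" for l
  proof -
    have neg: "Re l < 0" using assms that by blast
    have "((\<lambda>h. 2 * Re l + h * (cmod l)\<^sup>2) \<longlongrightarrow> 2 * Re l + 0 * (cmod l)\<^sup>2) (at_right 0)"
      by (intro tendsto_intros)
    then have "eventually (\<lambda>h. 2 * Re l + h * (cmod l)\<^sup>2 < 0) (at_right 0)"
      by (rule order_tendstoD) (use neg in simp)
    moreover have "eventually (\<lambda>h. h > 0) (at_right (0::real))" by (simp add: eventually_at_filter)
    ultimately show ?thesis
    proof eventually_elim
      case (elim h)
      have "(cmod (1 + of_real h * l))\<^sup>2 = 1 + h * (2 * Re l + h * (cmod l)\<^sup>2)"
        by (simp only: cmod_power2) (simp add: power2_eq_square algebra_simps)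
      also have "\<dots> < 1\<^sup>2" using elim by (simp add: mult_less_0_iff)
      finally show ?case by (rule power2_less_imp_less) simp
    qed
  qed
  then have "eventually (\<lambda>h. \<forall>l\<in>?E. cmod (1 + of_real h * l) < 1) (at_right 0)"
    by (intro eventually_ball_finite finite_eigenvalues) blast
  moreover have "eventually (\<lambda>h. h > 0) (at_right (0::real))" by (simp add: eventually_at_filter)
  ultimately have "eventually (\<lambda>h. h > 0 \<and> (\<forall>l\<in>?E. cmod (1 + of_real h * l) < 1)) (at_right 0)"
    by eventually_elim simp
  then obtain h where h: "h > 0" "\<And>l. l \<in> ?E \<Longrightarrow> cmod (1 + of_real h * l) < 1"
    by (auto dest: eventually_happens' [rotated])
  have "cmod m < 1" if m: "m \<in> eigenvalues (complex_matrix (mat 1 + h *\<^sub>R A))" for m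
  proof -
    obtain x where x: "x \<noteq> 0" "complex_matrix (mat 1 + h *\<^sub>R A) *v x = m *s x"
      using m unfolding eigenvalues_def by blast
    have "complex_matrix (mat 1 + h *\<^sub>R A) *v x = x + complex_of_real h *s (complex_matrix A *v x)"
    proof -
      have "complex_matrix (mat 1 + h *\<^sub>R A) = mat 1 + (\<chi> i j. of_real h * of_real (A $ i $ j))"
        by (simp add: vec_eq_iff complex_matrix_def mat_def)
      moreover have "(\<chi> i j. of_real h * of_real (A $ i $ j)) *v x = complex_of_real h *s (complex_matrix A *v x)"
        by (simp add: vec_eq_iff complex_matrix_def matrix_vector_mult_def sum_distrib_left mult.assoc)
      ultimately show ?thesis by (simp add: matrix_vector_mult_add_rdistrib)
    qed
    then have "complex_of_real h *s (complex_matrix A *v x) = (m - 1) *s x"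
      using x(2) by (simp add: vec_eq_iff algebra_simps)
    then have "complex_matrix A *v x = ((m - 1) / of_real h) *s x"
      using h(1) by (simp add: vec_eq_iff field_simps)
    then have "(m - 1) / of_real h \<in> ?E" using x(1) by (auto simp: eigenvalues_def)
    from h(2)[OF this] show ?thesis using h(1) by simp
  qed
  then show ?thesis using h(1) by blast
qed

lemma sum_matrix_vector: "(\<Sum>k\<in>S. M k) *v x = (\<Sum>k\<in>S. M k *v x)" for M :: "_ \<Rightarrow> real^'n^'m"
  by (induction S rule: infinite_finite_induct) (simp_all add: matrix_vector_mult_add_rdistrib)

lemma inner_transpose_matrix_vector: "x \<bullet> (transpose P *v z) = (P *v x) \<bullet> z" for P :: "real^'n^'m"
  unfolding transpose_matrix_vector inner_commute[of x] dot_lmul_matrix by (rule inner_commute)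

text \<open>The quadratic form \<open>\<Sum>k<K. (norm (C\<^sup>k x))\<^sup>2\<close> with \<open>C = I + h A\<close> decreases along \<open>C\<close>, hence along the flow of \<open>A\<close>.\<close>

lemma discrete_lyapunov:
  fixes A :: "real^'n^'n"
  assumes eig: "\<And>l. l \<in> eigenvalues (complex_matrix A) \<Longrightarrow> Re l < 0"
  shows "\<exists>H c g. c > 0 \<and> g > 0 \<and> (\<forall>x y. x \<bullet> (H *v y) = y \<bullet> (H *v x)) \<and>
    (\<forall>x. (norm x)\<^sup>2 \<le> x \<bullet> (H *v x)) \<and> (\<forall>x. x \<bullet> (H *v x) \<le> c * (norm x)\<^sup>2) \<and>
    (\<forall>x. 2 * (x \<bullet> (H *v (A *v x))) \<le> - g * (norm x)\<^sup>2)"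
proof -
  obtain h where h: "h > 0" "\<And>l. l \<in> eigenvalues (complex_matrix (mat 1 + h *\<^sub>R A)) \<Longrightarrow> cmod l < 1"
    using exists_stable_step[of A] eig by blast
  define C where "C = mat 1 + h *\<^sub>R A"
  define \<beta> where "\<beta> k = (\<Sum>i\<in>UNIV. \<Sum>j\<in>UNIV. \<bar>mpow C k $ i $ j\<bar>)" for k
  have "\<beta> \<longlonglongrightarrow> (\<Sum>i\<in>(UNIV::'n set). \<Sum>j\<in>(UNIV::'n set). \<bar>0\<bar>)"
    unfolding \<beta>_def C_def by (intro tendsto_sum tendsto_rabs mpow_tendsto_0 h)
  then have "\<beta> \<longlonglongrightarrow> 0" by simp
  then have "eventually (\<lambda>k. \<beta> k < 1 / 2) sequentially" by (rule order_tendstoD) simp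
  then have "eventually (\<lambda>k. \<beta> k < 1 / 2 \<and> k \<ge> 1) sequentially" using eventually_ge_at_top[of 1] by eventually_elim simp
  \<comment> \<open>With \<open>\<beta> K < 1 / 2\<close> the telescoped difference
    \<open>(norm (mpow C K *v x))\<^sup>2 - (norm x)\<^sup>2\<close> is at most
    \<open>- (norm x)\<^sup>2 / 2\<close>, so a finite sum of powers already gives a decreasing
    form.\<close>
  then obtain K where K: "\<beta> K < 1 / 2" "K \<ge> 1" unfolding eventually_sequentially by blast
  have \<beta>: "norm (mpow C k *v x) \<le> \<beta> k * norm x" "\<beta> k \<ge> 0" for k x
    unfolding \<beta>_def by (auto intro: norm_matrix_vector_le sum_nonneg)
  define H where "H = (\<Sum>k<K. transpose (mpow C k) ** mpow C k)"
  have H: "x \<bullet> (H *v y) = (\<Sum>k<K. (mpow C k *v x) \<bullet> (mpow C k *v y))" for x y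
    unfolding H_def sum_matrix_vector inner_sum_right matrix_vector_mul_assoc[symmetric] inner_transpose_matrix_vector ..
  have W: "x \<bullet> (H *v x) = (\<Sum>k<K. (norm (mpow C k *v x))\<^sup>2)" for x
    unfolding H by (simp add: dot_square_norm)
  define c where "c = (\<Sum>k<K. (\<beta> k)\<^sup>2) + 1"
  define g where "g = 1 / (2 * h)"
  have c: "c > 0" unfolding c_def by (intro add_nonneg_pos sum_nonneg) auto
  have g: "g > 0" using h by (simp add: g_def)
  have sym: "x \<bullet> (H *v y) = y \<bullet> (H *v x)" for x y unfolding H by (simp add: inner_commute)
  have lower: "(norm x)\<^sup>2 \<le> x \<bullet> (H *v x)" for x
  proof -
    have "(norm (mpow C 0 *v x))\<^sup>2 \<le> (\<Sum>k<K. (norm (mpow C k *v x))\<^sup>2)"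
      using K by (intro member_le_sum) auto
    then show ?thesis by (simp add: W)
  qed
  have upper: "x \<bullet> (H *v x) \<le> c * (norm x)\<^sup>2" for x
  proof -
    have "x \<bullet> (H *v x) \<le> (\<Sum>k<K. (\<beta> k * norm x)\<^sup>2)"
      unfolding W using \<beta> by (intro sum_mono power_mono) auto
    also have "\<dots> = (\<Sum>k<K. (\<beta> k)\<^sup>2) * (norm x)\<^sup>2" by (simp add: power_mult_distrib sum_distrib_right)
    finally show ?thesis by (simp add: c_def distrib_right add_increasing2)
  qed
  have "2 * (x \<bullet> (H *v (A *v x))) \<le> - g * (norm x)\<^sup>2" for x
  proof -
    have Cx: "C *v x = x + h *\<^sub>R (A *v x)"
      by (simp add: C_def matrix_vector_mult_add_rdistrib scaleR_matrix_vector_assoc)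
    have "(C *v x) \<bullet> (H *v (C *v x)) = x \<bullet> (H *v x) + 2 * h * (x \<bullet> (H *v (A *v x))) + h\<^sup>2 * ((A *v x) \<bullet> (H *v (A *v x)))"
      unfolding Cx using sym[of "A *v x" x]
      by (simp add: matrix_vector_right_distrib matrix_vector_mult_scaleR inner_add_left inner_add_right power2_eq_square algebra_simps)
    moreover have "(C *v x) \<bullet> (H *v (C *v x)) = x \<bullet> (H *v x) + ((norm (mpow C K *v x))\<^sup>2 - (norm x)\<^sup>2)"
    proof -
      have "(\<Sum>k<K. (norm (mpow C (Suc k) *v x))\<^sup>2 - (norm (mpow C k *v x))\<^sup>2) = (norm (mpow C K *v x))\<^sup>2 - (norm (mpow C 0 *v x))\<^sup>2"
        by (rule sum_lessThan_telescope)
      moreover have "(C *v x) \<bullet> (H *v (C *v x)) = (\<Sum>k<K. (norm (mpow C (Suc k) *v x))\<^sup>2)"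
        unfolding W mpow_Suc2 by (simp add: matrix_vector_mul_assoc)
      ultimately show ?thesis by (simp add: W sum_subtractf)
    qed
    moreover have "(norm (mpow C K *v x))\<^sup>2 \<le> (norm x)\<^sup>2 / 2"
    proof -
      have "norm (mpow C K *v x) \<le> 1 / 2 * norm x"
        using \<beta>(1)[of K x] K mult_right_mono[of "\<beta> K" "1 / 2" "norm x"] by simp
      then have "(norm (mpow C K *v x))\<^sup>2 \<le> (1 / 2 * norm x)\<^sup>2" by (intro power_mono) auto
      then have "(norm (mpow C K *v x))\<^sup>2 \<le> (norm x)\<^sup>2 / 4" by (simp add: power_mult_distrib power_divide)
      then show ?thesis using zero_le_power2[of "norm x"] by linarith
    qed
    \<comment> \<open>The second-order term of the Euler step has a favourable sign, so decrease
      along \<open>C\<close> passes to the derivative along \<open>A\<close>.\<close>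
    moreover have "h\<^sup>2 * ((A *v x) \<bullet> (H *v (A *v x))) \<ge> 0" unfolding W by (intro mult_nonneg_nonneg sum_nonneg) auto
    ultimately have "2 * h * (x \<bullet> (H *v (A *v x))) \<le> - ((norm x)\<^sup>2 / 2)" by linarith
    then show ?thesis using h(1) by (simp add: g_def field_simps)
  qed
  then show ?thesis using c g sym lower upper by blast
qed

section \<open>Entrywise power series of the matrix exponential\<close>

lemma mpow_entry_bound:
  fixes A :: "real^'n^'n"
  shows "\<bar>mpow A m $ i $ j\<bar> \<le> (\<Sum>i\<in>UNIV. \<Sum>j\<in>UNIV. \<bar>A $ i $ j\<bar>) ^ m"
proof (induction m arbitrary: i)
  case (Suc m)
  let ?b = "\<Sum>i\<in>UNIV. \<Sum>j\<in>UNIV. \<bar>A $ i $ j\<bar>"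
  have "\<bar>mpow A (Suc m) $ i $ j\<bar> \<le> (\<Sum>k\<in>UNIV. \<bar>A $ i $ k\<bar> * ?b ^ m)"
    unfolding mpow_Suc matrix_matrix_mult_def
    by (auto intro!: order_trans[OF sum_abs] sum_mono mult_left_mono Suc simp: abs_mult)
  also have "\<dots> = (\<Sum>k\<in>UNIV. \<bar>A $ i $ k\<bar>) * ?b ^ m" by (simp add: sum_distrib_right)
  also have "\<dots> \<le> ?b * ?b ^ m"
    by (intro mult_right_mono member_le_sum[of i UNIV "\<lambda>i. \<Sum>k\<in>UNIV. \<bar>A $ i $ k\<bar>"] zero_le_power sum_nonneg) auto
  finally show ?case by simp
qed (simp add: mat_def)

definition exp_entry :: "real^'n^'n \<Rightarrow> 'n \<Rightarrow> 'n \<Rightarrow> nat \<Rightarrow> real" where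
  "exp_entry A i j m = mpow A m $ i $ j / fact m"

lemma summable_exp_entry: "summable (\<lambda>m. exp_entry A i j m * y ^ m)"
proof (rule summable_comparison_test')
  let ?b = "\<Sum>i\<in>UNIV. \<Sum>j\<in>UNIV. \<bar>A $ i $ j\<bar>"
  show "summable (\<lambda>m. inverse (fact m) * (?b * \<bar>y\<bar>) ^ m)" by (rule summable_exp)
  fix m :: nat
  have "\<bar>mpow A m $ i $ j\<bar> * \<bar>y\<bar> ^ m \<le> ?b ^ m * \<bar>y\<bar> ^ m"
    by (intro mult_right_mono mpow_entry_bound) simp
  then show "norm (exp_entry A i j m * y ^ m) \<le> inverse (fact m) * (?b * \<bar>y\<bar>) ^ m"
    by (simp add: exp_entry_def abs_mult power_abs power_mult_distrib field_simps)
qed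

lemma matrix_exp_entry: "matrix_exp (t *\<^sub>R A) $ i $ j = (\<Sum>m. exp_entry A i j m * t ^ m)"
proof -
  have "(\<lambda>m. (1 / fact m) *\<^sub>R mpow (t *\<^sub>R A) m) sums (\<chi> i j. \<Sum>m. exp_entry A i j m * t ^ m)"
    unfolding sums_def
  proof (intro vec_tendstoI)
    fix i j
    have "(\<lambda>m. exp_entry A i j m * t ^ m) sums (\<Sum>m. exp_entry A i j m * t ^ m)"
      by (rule summable_sums[OF summable_exp_entry])
    then show "((\<lambda>n. (\<Sum>m<n. (1 / fact m) *\<^sub>R mpow (t *\<^sub>R A) m) $ i $ j) \<longlongrightarrow> (\<chi> i j. \<Sum>m. exp_entry A i j m * t ^ m) $ i $ j) sequentially"
      unfolding sums_def by (simp add: sum_component mpow_scaleR exp_entry_def mult.commute)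
  qed
  from sums_unique[OF this, symmetric]
  have eq: "(\<Sum>m. (1 / fact m) *\<^sub>R mpow (t *\<^sub>R A) m) = (\<chi> i j. \<Sum>m. exp_entry A i j m * t ^ m)" .
  show ?thesis unfolding matrix_exp_def mpow_def[symmetric] eq by simp
qed

lemma matrix_exp_transpose: "matrix_exp (t *\<^sub>R transpose A) = transpose (matrix_exp (t *\<^sub>R A))"
  by (simp add: vec_eq_iff matrix_exp_entry transpose_def[of "matrix_exp _"] exp_entry_def mpow_transpose)
    (simp add: transpose_def)

lemma matrix_exp_0: "matrix_exp (0 *\<^sub>R A) = mat 1"
  unfolding vec_eq_iff matrix_exp_entry powser_zero by (simp add: exp_entry_def)

text \<open>The two forms come from splitting off a factor of the power on the left or on the right.
  Comparing the resulting series shows that \<open>A\<close> commutes with its exponential.\<close>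

lemma exp_entry_Suc:
  "(1 + real m) * exp_entry A i j (Suc m) = (\<Sum>k\<in>UNIV. A $ i $ k * exp_entry A k j m)"
  "(1 + real m) * exp_entry A i j (Suc m) = (\<Sum>k\<in>UNIV. exp_entry A i k m * A $ k $ j)"
proof -
  have "(1 + real m) * exp_entry A i j (Suc m) = mpow A (Suc m) $ i $ j / fact m"
  proof -
    have "1 + real m \<noteq> 0" by linarith
    then show ?thesis by (simp add: exp_entry_def)
  qed
  moreover have "mpow A (Suc m) $ i $ j / fact m = (\<Sum>k\<in>UNIV. A $ i $ k * exp_entry A k j m)"
    unfolding mpow_Suc by (simp add: matrix_matrix_mult_def exp_entry_def sum_divide_distrib)
  moreover have "mpow A (Suc m) $ i $ j / fact m = (\<Sum>k\<in>UNIV. exp_entry A i k m * A $ k $ j)"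
    unfolding mpow_Suc2 by (simp add: matrix_matrix_mult_def exp_entry_def sum_divide_distrib)
  ultimately show "(1 + real m) * exp_entry A i j (Suc m) = (\<Sum>k\<in>UNIV. A $ i $ k * exp_entry A k j m)"
    "(1 + real m) * exp_entry A i j (Suc m) = (\<Sum>k\<in>UNIV. exp_entry A i k m * A $ k $ j)" by simp_all
qed

lemma exp_entry_diffs_sums:
  "(\<lambda>m. diffs (exp_entry A i j) m * t ^ m) sums ((A ** matrix_exp (t *\<^sub>R A)) $ i $ j)"
  "(\<lambda>m. diffs (exp_entry A i j) m * t ^ m) sums ((matrix_exp (t *\<^sub>R A) ** A) $ i $ j)"
proof -
  have "(\<lambda>m. \<Sum>k\<in>UNIV. A $ i $ k * (exp_entry A k j m * t ^ m)) sums (\<Sum>k\<in>UNIV. A $ i $ k * matrix_exp (t *\<^sub>R A) $ k $ j)"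
    unfolding matrix_exp_entry by (intro sums_sum sums_mult summable_sums summable_exp_entry)
  then show "(\<lambda>m. diffs (exp_entry A i j) m * t ^ m) sums ((A ** matrix_exp (t *\<^sub>R A)) $ i $ j)"
    by (simp add: diffs_def exp_entry_Suc(1) matrix_matrix_mult_def sum_distrib_right mult.assoc)
  have "(\<lambda>m. \<Sum>k\<in>UNIV. (exp_entry A i k m * t ^ m) * A $ k $ j) sums (\<Sum>k\<in>UNIV. matrix_exp (t *\<^sub>R A) $ i $ k * A $ k $ j)"
    unfolding matrix_exp_entry by (intro sums_sum sums_mult2 summable_sums summable_exp_entry)
  then show "(\<lambda>m. diffs (exp_entry A i j) m * t ^ m) sums ((matrix_exp (t *\<^sub>R A) ** A) $ i $ j)"
    by (simp add: diffs_def exp_entry_Suc(2) matrix_matrix_mult_def sum_distrib_right mult.assoc mult.commute[of "t ^ _"])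
qed

lemma matrix_exp_commute: "A ** matrix_exp (t *\<^sub>R A) = matrix_exp (t *\<^sub>R A) ** A"
  unfolding vec_eq_iff using sums_unique2[OF exp_entry_diffs_sums] by blast

lemma DERIV_matrix_exp_entry:
  "((\<lambda>t. matrix_exp (t *\<^sub>R A) $ i $ j) has_field_derivative (A ** matrix_exp (t *\<^sub>R A)) $ i $ j) (at t)"
  using termdiffs_strong_converges_everywhere[OF summable_exp_entry[of A i j], of t]
    sums_unique[OF exp_entry_diffs_sums(1)[of A i j t]]
  by (simp add: matrix_exp_entry)

lemma DERIV_matrix_exp_vector:
  "((\<lambda>t. (matrix_exp (t *\<^sub>R A) *v x) $ i) has_field_derivative (A *v (matrix_exp (t *\<^sub>R A) *v x)) $ i) (at t)"
  unfolding matrix_vector_mul_assoc unfolding matrix_vector_mult_def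
  by (auto intro!: derivative_eq_intros DERIV_matrix_exp_entry)

lemma DERIV_inner_matrix:
  fixes u w :: "real \<Rightarrow> real^'n"
  assumes "\<And>i. ((\<lambda>t. u t $ i) has_field_derivative u' $ i) (at t)"
    and "\<And>i. ((\<lambda>t. w t $ i) has_field_derivative w' $ i) (at t)"
  shows "((\<lambda>t. u t \<bullet> (H *v w t)) has_field_derivative (u' \<bullet> (H *v w t) + u t \<bullet> (H *v w'))) (at t)"
  unfolding inner_vec_def matrix_vector_mult_def inner_real_def vec_lambda_beta
  by (rule DERIV_cong, rule DERIV_sum, rule DERIV_mult, rule assms, rule DERIV_sum, rule DERIV_cmult, rule assms)
    (simp add: sum.distrib mult.commute)

lemma DERIV_inner_vector:
  fixes u w :: "real \<Rightarrow> real^'n"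
  assumes "\<And>i. ((\<lambda>t. u t $ i) has_field_derivative u' $ i) (at t)"
    and "\<And>i. ((\<lambda>t. w t $ i) has_field_derivative w' $ i) (at t)"
  shows "((\<lambda>t. u t \<bullet> w t) has_field_derivative (u' \<bullet> w t + u t \<bullet> w')) (at t)"
  using DERIV_inner_matrix[OF assms, of "mat 1"] by simp

text \<open>A Gronwall argument: \<open>exp (a * t)\<close> times the form of
  \<open>discrete_lyapunov\<close> is nonincreasing along the flow when \<open>a = g / c\<close>.
  The decay makes the integral in \<open>limit_cov\<close> converge.\<close>

lemma matrix_exp_decay:
  fixes A :: "real^'n^'n"
  assumes eig: "\<And>l. l \<in> eigenvalues (complex_matrix A) \<Longrightarrow> Re l < 0"
  shows "\<exists>c a. c > 0 \<and> a > 0 \<and>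
    (\<forall>t\<ge>0. \<forall>x. (norm (matrix_exp (t *\<^sub>R A) *v x))\<^sup>2 \<le> c * exp (- a * t) * (norm x)\<^sup>2)"
proof -
  obtain H c g where c: "c > 0" and g: "g > 0" and sym: "\<And>x y. x \<bullet> (H *v y) = y \<bullet> (H *v x)"
    and H1: "\<And>x. (norm x)\<^sup>2 \<le> x \<bullet> (H *v x)" and H2: "\<And>x. x \<bullet> (H *v x) \<le> c * (norm x)\<^sup>2"
    and H3: "\<And>x. 2 * (x \<bullet> (H *v (A *v x))) \<le> - g * (norm x)\<^sup>2"
    using discrete_lyapunov[of A] eig by metis
  define a where "a = g / c"
  have a: "a > 0" "a * c = g" using c g by (simp_all add: a_def)
  have "(norm (matrix_exp (t *\<^sub>R A) *v x))\<^sup>2 \<le> c * exp (- a * t) * (norm x)\<^sup>2" if "t \<ge> 0" for t x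
  proof -
    define u where "u t = matrix_exp (t *\<^sub>R A) *v x" for t
    have du: "((\<lambda>t. u t $ i) has_field_derivative (A *v u t) $ i) (at t)" for i t
      unfolding u_def by (rule DERIV_matrix_exp_vector)
    have "exp (a * t) * (u t \<bullet> (H *v u t)) \<le> exp (a * 0) * (u 0 \<bullet> (H *v u 0))"
    proof (rule DERIV_nonpos_imp_nonincreasing[OF that])
      fix r
      have "((\<lambda>t. exp (a * t) * (u t \<bullet> (H *v u t))) has_field_derivative
          exp (a * r) * a * (u r \<bullet> (H *v u r)) + ((A *v u r) \<bullet> (H *v u r) + u r \<bullet> (H *v (A *v u r))) * exp (a * r)) (at r)"
        by (auto intro!: derivative_eq_intros DERIV_inner_matrix du)
      moreover have "exp (a * r) * a * (u r \<bullet> (H *v u r)) + ((A *v u r) \<bullet> (H *v u r) + u r \<bullet> (H *v (A *v u r))) * exp (a * r) \<le> 0"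
      proof -
        have "a * (u r \<bullet> (H *v u r)) \<le> a * (c * (norm (u r))\<^sup>2)" using a H2 by (intro mult_left_mono) auto
        also have "\<dots> = g * (norm (u r))\<^sup>2" using a(2) by simp
        finally have "a * (u r \<bullet> (H *v u r)) + 2 * (u r \<bullet> (H *v (A *v u r))) \<le> 0" using H3[of "u r"] by simp
        then have "exp (a * r) * (a * (u r \<bullet> (H *v u r)) + 2 * (u r \<bullet> (H *v (A *v u r)))) \<le> 0"
          by (simp add: mult_le_0_iff)
        then show ?thesis using sym[of "A *v u r" "u r"] by (simp add: algebra_simps)
      qed
      ultimately show "\<exists>y. ((\<lambda>t. exp (a * t) * (u t \<bullet> (H *v u t))) has_real_derivative y) (at r) \<and> y \<le> 0" by blast
    qed
    also have "\<dots> \<le> c * (norm x)\<^sup>2" using H2[of x] matrix_exp_0[of A] by (simp add: u_def)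
    finally have "exp (a * t) * (u t \<bullet> (H *v u t)) \<le> c * (norm x)\<^sup>2" .
    then have "u t \<bullet> (H *v u t) \<le> c * exp (- a * t) * (norm x)\<^sup>2" by (simp add: exp_minus field_simps)
    then show ?thesis using H1[of "u t"] by (simp add: u_def)
  qed
  then show ?thesis using c a(1) by blast
qed

section \<open>Improper integrals and the limit covariance\<close>

lemma improper_integral:
  fixes g :: "real \<Rightarrow> real"
  assumes cont: "continuous_on {0..} g" and bound: "\<And>t. t \<ge> 0 \<Longrightarrow> \<bar>g t\<bar> \<le> K * exp (- a * t)" and a: "a > 0"
  shows "g integrable_on {0..}" "(\<lambda>k. integral {0..real k} g) \<longlonglongrightarrow> integral {0..} g"
proof -
  define f where "f k t = (if t \<in> {0..real k} then g t else 0)" for k :: nat and t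
  have int: "g integrable_on {0..real k}" for k
    by (intro integrable_continuous_interval continuous_on_subset[OF cont]) auto
  have inter: "{0..real k} \<inter> {0..} = {0..real k}" for k by auto
  have fk: "f k = (\<lambda>t. if t \<in> {0..real k} then g t else 0)" for k
    by (simp add: f_def fun_eq_iff)
  have f: "f k integrable_on {0..}" for k
    unfolding fk integrable_restrict_Int inter by (rule int)
  have fi: "integral {0..} (f k) = integral {0..real k} g" for k
    unfolding fk integral_restrict_Int Int_commute[of "{0..}"] inter ..
  have h: "(\<lambda>t. K * exp (- a * t)) integrable_on {0..}"
    using has_integral_exp_minus_to_infinity[OF a, of 0] by (intro integrable_on_mult_right) (auto simp: integrable_on_def)
  have le: "norm (f k t) \<le> K * exp (- a * t)" if "t \<in> {0..}" for k t
    using bound[of t] that by (auto simp: f_def intro: order_trans[OF abs_ge_zero])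
  have lim: "(\<lambda>k. f k t) \<longlonglongrightarrow> g t" if "t \<in> {0..}" for t
  proof (rule tendsto_eventually)
    obtain m :: nat where "t \<le> m" using real_arch_simple by blast
    then show "eventually (\<lambda>k. f k t = g t) sequentially"
      using that unfolding eventually_sequentially f_def by (intro exI[of _ m]) auto
  qed
  show "g integrable_on {0..}" by (rule dominated_convergence(1)[OF f h le lim])
  show "(\<lambda>k. integral {0..real k} g) \<longlonglongrightarrow> integral {0..} g"
    using dominated_convergence(2)[OF f h le lim] by (simp add: fi)
qed

text \<open>Subtracting half the identity moves the spectrum into the open left half-plane, so the
  boundary term at infinity vanishes. The matrix integral is evaluated through the scalar functions
  \<open>p x y\<close>. Returning from \<open>A\<close> to \<open>B\<close> adds the term
  \<open>x \<bullet> (G *v x)\<close> to the equation.\<close>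

lemma limit_cov_lyapunov:
  fixes B :: "real^'n^'n"
  assumes "max_Re_eigenvalue B < 1 / 2"
  shows "lyapunov B (limit_cov B)"
proof -
  define A where "A = B - (1/2) *\<^sub>R mat 1"
  have eig: "Re l < 0" if l: "l \<in> eigenvalues (complex_matrix A)" for l
  proof -
    obtain x where x: "x \<noteq> 0" "complex_matrix A *v x = l *s x" using l by (auto simp: eigenvalues_def)
    have "complex_matrix B = complex_matrix A + mat (1/2)"
      by (simp add: vec_eq_iff complex_matrix_def A_def mat_def)
    moreover have "mat (1/2) *v x = (1/2) *s x"
      by (simp add: vec_eq_iff matrix_vector_mult_def mat_def if_distrib if_distribR sum.delta' cong: if_cong)
    ultimately have "complex_matrix B *v x = (l + 1/2) *s x"
      by (simp only: matrix_vector_mult_add_rdistrib x(2) vector_sadd_rdistrib)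
    then have "l + 1/2 \<in> eigenvalues (complex_matrix B)" using x(1) by (auto simp: eigenvalues_def)
    then have "Re (l + 1/2) \<le> max_Re_eigenvalue B"
      unfolding max_Re_eigenvalue_def by (intro Max_ge finite_imageI finite_eigenvalues imageI)
    then show ?thesis using assms by simp
  qed
  obtain c a where c: "c > 0" and a: "a > 0"
    and decay: "\<And>t x. t \<ge> 0 \<Longrightarrow> (norm (matrix_exp (t *\<^sub>R A) *v x))\<^sup>2 \<le> c * exp (- a * t) * (norm x)\<^sup>2"
    using matrix_exp_decay[of A] eig by metis
  define E where "E t = matrix_exp (t *\<^sub>R A)" for t
  have dE: "((\<lambda>t. (E t *v x) $ i) has_field_derivative (A *v (E t *v x)) $ i) (at t)" for x i t
    unfolding E_def by (rule DERIV_matrix_exp_vector)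
  define p where "p x y t = (E t *v x) \<bullet> (E t *v y)" for x y t
  have dp: "(p x y has_field_derivative ((A *v (E t *v x)) \<bullet> (E t *v y) + (E t *v x) \<bullet> (A *v (E t *v y)))) (at t)" for x y t
    unfolding p_def by (rule DERIV_inner_vector[OF dE dE])
  have cont: "continuous_on {0..} (p x y)" for x y
    by (intro continuous_at_imp_continuous_on ballI DERIV_isCont[OF dp])
  have pb: "\<bar>p x y t\<bar> \<le> (c * ((norm x)\<^sup>2 + (norm y)\<^sup>2)) * exp (- a * t)" if "t \<ge> 0" for x y t
  proof -
    have "\<bar>p x y t\<bar> \<le> norm (E t *v x) * norm (E t *v y)" unfolding p_def by (rule Cauchy_Schwarz_ineq2)
    also have "\<dots> \<le> (norm (E t *v x))\<^sup>2 + (norm (E t *v y))\<^sup>2"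
    proof -
      have "z * w \<le> z\<^sup>2 + w\<^sup>2" if "z \<ge> 0" "w \<ge> 0" for z w :: real
        using sum_squares_bound[of z w] mult_nonneg_nonneg[OF that] by linarith
      then show ?thesis by simp
    qed
    also have "\<dots> \<le> c * exp (- a * t) * (norm x)\<^sup>2 + c * exp (- a * t) * (norm y)\<^sup>2"
      unfolding E_def by (intro add_mono decay that)
    finally show ?thesis by (simp add: algebra_simps)
  qed
  have pint: "p x y integrable_on {0..}"
    "(\<lambda>k. integral {0..real k} (p x y)) \<longlonglongrightarrow> integral {0..} (p x y)" for x y
    by (rule improper_integral[OF cont _ a], erule pb)+
  define f where "f t = matrix_exp (t *\<^sub>R transpose A) ** matrix_exp (t *\<^sub>R A)" for t
  have f: "x \<bullet> (f t *v y) = p x y t" for x y t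
    unfolding f_def matrix_exp_transpose p_def E_def matrix_vector_mul_assoc[symmetric] inner_transpose_matrix_vector ..
  have fint: "f integrable_on {0..}"
  proof (rule integrable_componentwise)
    fix b :: "real^'n^'n" assume "b \<in> Basis"
    then obtain i j where b: "b = axis i (axis j 1)" by (auto simp: Basis_vec_def)
    have "f t \<bullet> b = p (axis i 1) (axis j 1) t" for t
      unfolding f[symmetric] b
      by (simp add: inner_axis inner_axis' matrix_vector_mult_def) (simp add: axis_def if_distrib sum.delta cong: if_cong)
    then show "(\<lambda>t. f t \<bullet> b) integrable_on {0..}" using pint(1) by simp
  qed
  let ?G = "limit_cov B"
  have G: "?G = integral {0..} f" unfolding limit_cov_def f_def A_def ..
  have Gp: "x \<bullet> (?G *v y) = integral {0..} (p x y)" for x y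
  proof -
    have "linear (\<lambda>Q::real^'n^'n. x \<bullet> (Q *v y))"
      by (intro linearI) (simp_all add: matrix_vector_mult_add_rdistrib inner_add_right scaleR_matrix_vector_assoc[symmetric])
    then have "bounded_linear (\<lambda>Q::real^'n^'n. x \<bullet> (Q *v y))" by (rule linear_conv_bounded_linear[THEN iffD1])
    from integral_linear[OF fint this] show ?thesis by (simp add: G comp_def f)
  qed
  have lyap0: "2 * (x \<bullet> (?G *v (A *v x))) = - (x \<bullet> x)" for x
  proof -
    have comm: "A *v (E t *v x) = E t *v (A *v x)" for t
      by (simp add: E_def matrix_vector_mul_assoc matrix_exp_commute)
    have "(\<lambda>k. 2 * integral {0..real k} (p x (A *v x))) \<longlonglongrightarrow> 2 * integral {0..} (p x (A *v x))"
      by (intro tendsto_intros pint(2))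
    moreover have "2 * integral {0..real k} (p x (A *v x)) = p x x k - p x x 0" for k
    proof -
      have "((\<lambda>t. 2 * p x (A *v x) t) has_integral (p x x k - p x x 0)) {0..real k}"
      proof (rule fundamental_theorem_of_calculus)
        fix t
        have "(p x x has_field_derivative 2 * p x (A *v x) t) (at t)"
          using dp[of x x t] unfolding comm by (simp add: p_def inner_commute)
        then show "(p x x has_vector_derivative 2 * p x (A *v x) t) (at t within {0..real k})"
          by (simp add: has_real_derivative_iff_has_vector_derivative has_vector_derivative_at_within)
      qed simp
      then show ?thesis by (simp add: integral_unique[symmetric] has_integral_integrable_integral)
    qed
    moreover have "(\<lambda>k. p x x (real k) - p x x 0) \<longlonglongrightarrow> 0 - p x x 0"
    proof (intro tendsto_intros)
      have "(\<lambda>k. (c * ((norm x)\<^sup>2 + (norm x)\<^sup>2)) * exp (- a * real k)) \<longlonglongrightarrow> 0"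
        using a by real_asymp
      then show "(\<lambda>k. p x x (real k)) \<longlonglongrightarrow> 0"
      proof (rule Lim_null_comparison[rotated])
        have "norm (p x x (real k)) \<le> (c * ((norm x)\<^sup>2 + (norm x)\<^sup>2)) * exp (- a * real k)" for k
          unfolding real_norm_def by (rule pb) simp
        then show "eventually (\<lambda>k. norm (p x x (real k)) \<le> (c * ((norm x)\<^sup>2 + (norm x)\<^sup>2)) * exp (- a * real k)) sequentially"
          by (rule always_eventually[OF allI])
      qed
    qed
    ultimately have "2 * integral {0..} (p x (A *v x)) = 0 - p x x 0" by (simp add: LIMSEQ_unique)
    then show ?thesis using matrix_exp_0[of A] by (simp add: Gp p_def E_def)
  qed
  have sym: "x \<bullet> (?G *v y) = y \<bullet> (?G *v x)" for x y
  proof -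
    have "p x y = p y x" by (simp add: p_def fun_eq_iff inner_commute)
    then show ?thesis by (simp only: Gp)
  qed
  have nonneg: "x \<bullet> (?G *v x) \<ge> 0" for x
    unfolding Gp by (rule integral_nonneg[OF pint(1)]) (unfold p_def, rule inner_ge_zero)
  have pos: "x \<bullet> (?G *v x) > 0" if "x \<noteq> 0" for x
  proof (rule ccontr)
    assume "\<not> x \<bullet> (?G *v x) > 0"
    then have zero: "x \<bullet> (?G *v x) = 0" using nonneg[of x] by simp
    \<comment> \<open>Nonnegativity at \<open>x + r A x\<close> for small \<open>r > 0\<close> contradicts the linear term \<open>- r (x \<bullet> x)\<close>.\<close>
    define v where "v = (A *v x) \<bullet> (?G *v (A *v x))"
    define r where "r = (x \<bullet> x) / (2 * (v + 1))"
    have v: "v \<ge> 0" unfolding v_def by (rule nonneg)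
    have r: "r > 0" using that v by (simp add: r_def)
    have "0 \<le> (x + r *\<^sub>R (A *v x)) \<bullet> (?G *v (x + r *\<^sub>R (A *v x)))" by (rule nonneg)
    also have "\<dots> = x \<bullet> (?G *v x) + r * (2 * (x \<bullet> (?G *v (A *v x)))) + r * (r * v)"
      using sym[of "A *v x" x]
      by (simp add: v_def matrix_vector_right_distrib matrix_vector_mult_scaleR inner_add_left inner_add_right algebra_simps)
    also have "\<dots> = r * (r * v - x \<bullet> x)" unfolding zero lyap0 by (simp add: algebra_simps)
    finally have "x \<bullet> x \<le> r * v" using r by (simp add: zero_le_mult_iff)
    also have "\<dots> \<le> (x \<bullet> x) / 2"
      using v by (simp add: r_def divide_simps) (simp add: algebra_simps)
    finally show False using that inner_gt_zero_iff[of x] by simp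
  qed
  show ?thesis
  proof
    show "x \<bullet> (?G *v y) = y \<bullet> (?G *v x)" for x y by (rule sym)
    show "x \<noteq> 0 \<Longrightarrow> 0 < x \<bullet> (?G *v x)" for x by (rule pos)
    show "2 * (x \<bullet> (?G *v (B *v x))) = x \<bullet> (?G *v x) - x \<bullet> x" for x
    proof -
      have "B *v x = A *v x + (1/2) *\<^sub>R x"
        by (simp add: A_def matrix_vector_mult_diff_rdistrib scaleR_matrix_vector_assoc[symmetric])
      then show ?thesis
        using lyap0[of x] by (simp add: matrix_vector_right_distrib matrix_vector_mult_scaleR inner_add_right)
    qed
  qed
qed

subsection \<open>The ERWG process as a sign-valued walk\<close>

text \<open>The injected drivers are decoded with defaults outside their ranges, so that the reconstructed
  steps are signs everywhere and depend on finitely many drivers each.\<close>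

definition sign_of :: "int + nat + 'k \<Rightarrow> int" where
  "sign_of x = (case x of Inl z \<Rightarrow> if z = - 1 then - 1 else 1 | _ \<Rightarrow> 1)"

definition time_of :: "int + nat + 'k \<Rightarrow> nat" where
  "time_of x = (case x of Inr (Inl n) \<Rightarrow> n | _ \<Rightarrow> 0)"

definition source_of :: "int + nat + 'k \<Rightarrow> 'k" where
  "source_of x = (case x of Inr (Inr w) \<Rightarrow> w | _ \<Rightarrow> undefined)"

text \<open>The cut-off \<open>min\<close> makes the recursion terminate for every driver family;
  almost surely the time driver lies in the admissible range and is unchanged by it. Time 0, reached
  by the recursion only from a time driver 0, carries the default sign 1.\<close>

function path :: "('k driver \<Rightarrow> int + nat + 'k) \<Rightarrow> nat \<Rightarrow> 'k \<Rightarrow> int" where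
  "path d 0 v = 1"
| "path d (Suc 0) v = sign_of (d (Init v))"
| "path d (Suc (Suc n)) v = sign_of (d (Flip (Suc n) v)) *
     path d (min (Suc n) (time_of (d (Time (Suc n) v)))) (source_of (d (Source (Suc n) v)))"
  by pat_completeness auto
termination
  by (relation "Wellfounded.measure (\<lambda>(d, n, v). n)") (auto simp: min_def)

lemma path_Suc: "n \<ge> 1 \<Longrightarrow> path d (Suc n) v = sign_of (d (Flip n v)) *
     path d (min n (time_of (d (Time n v)))) (source_of (d (Source n v)))"
  by (cases n) simp_all

lemma abs_sign_of: "\<bar>sign_of x\<bar> = 1"
  by (auto simp: sign_of_def split: sum.split)

lemma abs_path: "\<bar>path d n v\<bar> = 1"
  by (induction d n v rule: path.induct) (simp_all add: abs_sign_of abs_mult)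

text \<open>Step \<open>n + 1\<close> uses the flip, time and source drivers of index
  \<open>n\<close>. The strict bound \<open>m < n\<close> keeps them outside \<open>past n\<close>,
  which is what independence of the next step from the past rests on.\<close>

definition past :: "nat \<Rightarrow> 'k driver set" where
  "past n = range Init \<union> (\<Union>m\<in>{1..<n}. range (Flip m) \<union> range (Time m) \<union> range (Source m))"

lemma past_mono: "m \<le> n \<Longrightarrow> past m \<subseteq> past n"
  unfolding past_def by fastforce

lemma finite_past: "finite (past n :: 'k::finite driver set)"
  by (simp add: past_def)

lemma path_cong:
  assumes "\<And>i. i \<in> past n \<Longrightarrow> d i = d' i"
  shows "path d n v = path d' n v"
  using assms
proof (induction d n v rule: path.induct)
  case (2 d v)
  then show ?case by (simp add: past_def)
next
  case (3 d n v)
  have eq: "d (Flip (Suc n) v) = d' (Flip (Suc n) v)" "d (Time (Suc n) v) = d' (Time (Suc n) v)"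
    "d (Source (Suc n) v) = d' (Source (Suc n) v)"
    by (rule "3.prems", force simp: past_def)+
  let ?m = "min (Suc n) (time_of (d (Time (Suc n) v)))"
  have "past ?m \<subseteq> past (Suc (Suc n))" by (rule past_mono) simp
  then have "path d ?m (source_of (d (Source (Suc n) v))) = path d' ?m (source_of (d (Source (Suc n) v)))"
    using "3.prems" by (intro "3.IH") blast
  then show ?case by (simp add: eq)
qed simp

section \<open>Law of the reconstructed walk\<close>

context erwg
begin

abbreviation drv :: "'a \<Rightarrow> 'k driver \<Rightarrow> int + nat + 'k" where
  "drv \<omega> i \<equiv> driver_var \<sigma> \<xi> D u i \<omega>"

definition Y :: "nat \<Rightarrow> 'a \<Rightarrow> real^'k" where
  "Y n \<omega> = (\<chi> v. real_of_int (path (drv \<omega>) n v))"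

lemma past_drivers: "past n \<subseteq> (drivers :: 'k driver set)"
  by (auto simp: past_def drivers_def)

lemma drv_measurable: "i \<in> drivers \<Longrightarrow> (\<lambda>\<omega>. drv \<omega> i) \<in> measurable M (count_space UNIV)"
  using indep by (auto simp: indep_vars_def)

lemma PiM_count: "finite I \<Longrightarrow> PiM I (\<lambda>_. count_space (UNIV :: (int + nat + 'k) set)) = count_space (I \<rightarrow>\<^sub>E UNIV)"
  using count_space_PiM_finite[of I "\<lambda>_. UNIV :: (int + nat + 'k) set", OF _ countableI_type] by simp

lemma drv_restrict_measurable:
  "finite I \<Longrightarrow> I \<subseteq> drivers \<Longrightarrow> (\<lambda>\<omega>. restrict (drv \<omega>) I) \<in> measurable M (PiM I (\<lambda>_. count_space UNIV))"
  by (intro measurable_restrict drv_measurable) blast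

lemma \<xi>_measurable: "n \<ge> 1 \<Longrightarrow> \<xi> n v \<in> measurable M (count_space UNIV)"
proof -
  assume "n \<ge> 1"
  then have "(\<lambda>\<omega>. projl (drv \<omega> (Flip n v))) \<in> measurable M (count_space UNIV)"
    by (intro measurable_compose[OF drv_measurable]) (auto simp: drivers_def)
  then show ?thesis by simp
qed

lemma D_measurable: "n \<ge> 1 \<Longrightarrow> D n v \<in> measurable M (count_space UNIV)"
proof -
  assume "n \<ge> 1"
  then have "(\<lambda>\<omega>. projl (projr (drv \<omega> (Time n v)))) \<in> measurable M (count_space UNIV)"
    by (intro measurable_compose[OF drv_measurable]) (auto simp: drivers_def)
  then show ?thesis by simp
qed

lemma u_measurable: "n \<ge> 1 \<Longrightarrow> u n v \<in> measurable M (count_space UNIV)"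
proof -
  assume "n \<ge> 1"
  then have "(\<lambda>\<omega>. projr (projr (drv \<omega> (Source n v)))) \<in> measurable M (count_space UNIV)"
    by (intro measurable_compose[OF drv_measurable]) (auto simp: drivers_def)
  then show ?thesis by simp
qed

lemma \<sigma>_measurable: "\<sigma> v \<in> measurable M (count_space UNIV)"
proof -
  have "(\<lambda>\<omega>. projl (drv \<omega> (Init v))) \<in> measurable M (count_space UNIV)"
    by (intro measurable_compose[OF drv_measurable]) (auto simp: drivers_def)
  then show ?thesis by simp
qed

lemma AE_of_distr:
  assumes "f \<in> measurable M (count_space UNIV)" "distr M (count_space UNIV) f = measure_pmf m" "set_pmf m \<subseteq> A"
  shows "AE \<omega> in M. f \<omega> \<in> A"
proof -
  have "AE y in distr M (count_space UNIV) f. y \<in> A"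
    unfolding assms(2) AE_measure_pmf_iff using assms(3) by blast
  then show ?thesis using assms(1) by (subst (asm) AE_distr_iff) auto
qed

lemma set_rad_pmf: "set_pmf (rad_pmf r) \<subseteq> {- 1, 1}"
  by (auto simp: rad_pmf_def)

lemma AE_\<sigma>: "AE \<omega> in M. \<sigma> v \<omega> \<in> {- 1, 1}"
  by (rule AE_of_distr[OF \<sigma>_measurable distr_\<sigma> set_rad_pmf])

lemma AE_\<xi>: "n \<ge> 1 \<Longrightarrow> AE \<omega> in M. \<xi> n v \<omega> \<in> {- 1, 1}"
  by (rule AE_of_distr[OF \<xi>_measurable distr_\<xi> set_rad_pmf])

lemma AE_D: "n \<ge> 1 \<Longrightarrow> AE \<omega> in M. D n v \<omega> \<in> {1..n}"
  by (rule AE_of_distr[OF D_measurable distr_D]) auto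

text \<open>\<open>X\<close> is given only by its recursion, so measurability and the sign property
  are established for the reconstruction, which agrees with \<open>X\<close> unless some driver
  leaves its range. The induction is strong because the remembered time can be any earlier
  one.\<close>

lemma AE_X_eq_path: "AE \<omega> in M. \<forall>n\<ge>1. \<forall>v. X n v \<omega> = path (drv \<omega>) n v"
proof -
  have "AE \<omega> in M. \<forall>v. \<sigma> v \<omega> \<in> {- 1, 1}"
    unfolding AE_all_countable using AE_\<sigma> by blast
  moreover have "AE \<omega> in M. \<forall>n v. n \<ge> 1 \<longrightarrow> \<xi> n v \<omega> \<in> {- 1, 1} \<and> D n v \<omega> \<in> {1..n}"
    unfolding AE_all_countable using AE_\<xi> AE_D by (auto intro: AE_impI AE_conjI)
  ultimately show ?thesis using AE_space
  proof eventually_elim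
    case (elim \<omega>)
    have "X n v \<omega> = path (drv \<omega>) n v" if "n \<ge> 1" for n v
      using that
    proof (induction n arbitrary: v rule: less_induct)
      case (less n)
      show ?case
      proof (cases "n = 1")
        case True
        then show ?thesis using X_1[of \<omega> v] elim(1,3) by (auto simp: sign_of_def)
      next
        case False
        then obtain m where m: "n = Suc m" "m \<ge> 1" using less.prems by (cases n) auto
        have D: "D m v \<omega> \<ge> 1" "D m v \<omega> \<le> m" and x: "\<xi> m v \<omega> \<in> {- 1, 1}" using elim(2) m by auto
        have "X n v \<omega> = \<xi> m v \<omega> * X (D m v \<omega>) (u m v \<omega>) \<omega>" unfolding m(1) by (rule X_Suc[OF m(2) elim(3)])
        also have "X (D m v \<omega>) (u m v \<omega>) \<omega> = path (drv \<omega>) (D m v \<omega>) (u m v \<omega>)"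
          using D m by (intro less.IH) auto
        also have "\<xi> m v \<omega> = sign_of (drv \<omega> (Flip m v))" using x by (auto simp: sign_of_def)
        also have "D m v \<omega> = min m (time_of (drv \<omega> (Time m v)))" using D by (simp add: time_of_def)
        finally show ?thesis unfolding m(1) path_Suc[OF m(2)] by (simp add: source_of_def)
      qed
    qed
    then show ?case by blast
  qed
qed

lemma Y_restrict: "j \<le> n \<Longrightarrow> Y j \<omega> = (\<chi> v. real_of_int (path (restrict (drv \<omega>) (past n)) j v))"
  unfolding Y_def using past_mono[of j n]
  by (intro arg_cong[where f=vec_lambda] ext arg_cong[where f=real_of_int] path_cong) auto

lemma Y_measurable: "Y n \<in> borel_measurable M"
proof -
  have "(\<lambda>r. (\<chi> v. real_of_int (path r n v)) :: real^'k) \<in> measurable (PiM (past n) (\<lambda>_. count_space UNIV)) borel"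
    unfolding PiM_count[OF finite_past] by simp
  from measurable_compose[OF drv_restrict_measurable[OF finite_past past_drivers] this]
  show ?thesis by (simp add: Y_restrict[of n n, symmetric])
qed

lemma expectation_distr:
  fixes g :: "'b \<Rightarrow> real"
  assumes "f \<in> measurable M (count_space UNIV)" "distr M (count_space UNIV) f = measure_pmf m"
  shows "expectation (\<lambda>\<omega>. g (f \<omega>)) = measure_pmf.expectation m g"
  unfolding assms(2)[symmetric] using assms(1) by (subst integral_distr) auto

lemma expectation_sign: "n \<ge> 1 \<Longrightarrow> expectation (\<lambda>\<omega>. real_of_int (sign_of (drv \<omega> (Flip n v)))) = 2 * p v - 1"
proof -
  assume n: "n \<ge> 1"
  have "expectation (\<lambda>\<omega>. real_of_int (sign_of (Inl (\<xi> n v \<omega>) :: int + nat + 'k))) =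
      measure_pmf.expectation (rad_pmf (p v)) (\<lambda>z. real_of_int (sign_of (Inl z :: int + nat + 'k)))"
    by (rule expectation_distr[OF \<xi>_measurable[OF n] distr_\<xi>[OF n]])
  also have "\<dots> = 2 * p v - 1"
    using p_range[of v] by (simp add: rad_pmf_def sign_of_def)
  finally show ?thesis by simp
qed

lemma expectation_time: "n \<ge> 1 \<Longrightarrow> j \<in> {1..n} \<Longrightarrow> expectation (\<lambda>\<omega>. of_bool (time_of (drv \<omega> (Time n v)) = j)) = 1 / n"
proof -
  assume n: "n \<ge> 1" "j \<in> {1..n}"
  have "expectation (\<lambda>\<omega>. of_bool (D n v \<omega> = j) :: real) = measure_pmf.expectation (pmf_of_set {1..n}) (\<lambda>z. of_bool (z = j))"
    by (rule expectation_distr[OF D_measurable[OF n(1)] distr_D[OF n(1)]])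
  also have "\<dots> = measure_pmf.expectation (pmf_of_set {1..n}) (indicator {j})"
    by (intro Bochner_Integration.integral_cong refl) (simp add: indicator_def)
  also have "measure_pmf.expectation (pmf_of_set {1..n}) (indicator {j}) = 1 / n"
    using n by (simp add: measure_pmf_single)
  finally show ?thesis by (simp add: time_of_def)
qed

lemma expectation_source:
  "n \<ge> 1 \<Longrightarrow> expectation (\<lambda>\<omega>. of_bool (source_of (drv \<omega> (Source n v)) = w)) = of_bool ((w, v) \<in> E) / in_degree E v"
proof -
  assume n: "n \<ge> 1"
  have ne: "in_neighbours E v \<noteq> {}" using in_degree_pos[of v] by (auto simp: in_degree_def)
  have "expectation (\<lambda>\<omega>. of_bool (u n v \<omega> = w) :: real) = measure_pmf.expectation (pmf_of_set (in_neighbours E v)) (\<lambda>z. of_bool (z = w))"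
    by (rule expectation_distr[OF u_measurable[OF n] distr_u[OF n]])
  also have "\<dots> = measure_pmf.expectation (pmf_of_set (in_neighbours E v)) (indicator {w})"
    by (intro Bochner_Integration.integral_cong refl) (simp add: indicator_def)
  also have "measure_pmf.expectation (pmf_of_set (in_neighbours E v)) (indicator {w}) = of_bool ((w, v) \<in> E) / in_degree E v"
    using ne by (simp add: measure_pmf_single in_degree_def in_neighbours_def indicator_def)
  finally show ?thesis by (simp add: source_of_def)
qed

lemma expectation_driver_product:
  assumes n: "n \<ge> 1" and j: "j \<in> {1..n}"
  shows "expectation (\<lambda>\<omega>. real_of_int (sign_of (drv \<omega> (Flip n v))) * (of_bool (time_of (drv \<omega> (Time n v)) = j) *
      of_bool (source_of (drv \<omega> (Source n v)) = w))) = (2 * p v - 1) * (1 / n * (of_bool ((w, v) \<in> E) / in_degree E v))"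
proof -
  \<comment> \<open>One family of test functions on all drivers, as joint independence requires; the
    value at \<open>Init\<close> is a filler outside \<open>?J\<close>.\<close>
  define \<phi> :: "'k driver \<Rightarrow> int + nat + 'k \<Rightarrow> real" where
    "\<phi> i x = (case i of Init _ \<Rightarrow> 0 | Flip _ _ \<Rightarrow> real_of_int (sign_of x)
      | Time _ _ \<Rightarrow> of_bool (time_of x = j) | Source _ _ \<Rightarrow> of_bool (source_of x = w))" for i x
  let ?J = "{Flip n v, Time n v, Source n v}"
  have J: "?J \<subseteq> drivers" using n by (auto simp: drivers_def)
  have ind: "indep_vars (\<lambda>_. borel) (\<lambda>i \<omega>. \<phi> i (drv \<omega> i)) ?J"
    by (rule indep_vars_compose2[OF indep_vars_subset[OF indep J]]) simp
  have "\<bar>\<phi> i x\<bar> \<le> 1" for i x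
    using abs_sign_of[of x] by (auto simp: \<phi>_def split: driver.split)
  then have int: "integrable M (\<lambda>\<omega>. \<phi> i (drv \<omega> i))" if "i \<in> ?J" for i
    using ind that by (intro integrable_const_bound[where B=1]) (auto simp: indep_vars_def)
  have "expectation (\<lambda>\<omega>. \<Prod>i\<in>?J. \<phi> i (drv \<omega> i)) = (\<Prod>i\<in>?J. expectation (\<lambda>\<omega>. \<phi> i (drv \<omega> i)))"
    by (rule indep_vars_lebesgue_integral[OF _ ind int]) simp
  then show ?thesis
    using expectation_sign[OF n, of v] expectation_time[OF n j, of v] expectation_source[OF n, of v w]
    by (simp add: \<phi>_def del: driver_var.simps)
qed

definition B where "B = memory_matrix E p"

text \<open>For a sign \<open>y\<close>, \<open>exp (x * y) = cosh x + y * sinh x\<close>, so only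
  the mean of the step matters. Writing the step as a sum over pairs of a past time and a source
  gives products of independent factors, and their means assemble to a coordinate of the
  drift.\<close>

lemma expectation_step:
  assumes n: "n \<ge> 1" and hh: "\<And>j w. j \<in> {1..n} \<Longrightarrow> hh j w = h j $ w" and bound: "\<And>j w. \<bar>hh j w\<bar> = (1::real)"
  shows "expectation (\<lambda>\<omega>. exp (x * (real_of_int (sign_of (drv \<omega> (Flip n v))) *
      hh (min n (time_of (drv \<omega> (Time n v)))) (source_of (drv \<omega> (Source n v)))))) =
    cosh x + ((\<Sum>j=1..n. h j) v* B) $ v / n * sinh x"
proof -
  let ?s = "\<lambda>\<omega>. real_of_int (sign_of (drv \<omega> (Flip n v)))"
  let ?t = "\<lambda>\<omega>. time_of (drv \<omega> (Time n v))" and ?w = "\<lambda>\<omega>. source_of (drv \<omega> (Source n v))"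
  have drvm: "(\<lambda>\<omega>. drv \<omega> i) \<in> measurable M (count_space UNIV)" if "i \<in> {Flip n v, Time n v, Source n v}" for i
    using that n by (intro drv_measurable) (auto simp: drivers_def)
  have "(\<lambda>\<omega>. ?s \<omega>) \<in> borel_measurable M"
    by (rule measurable_compose[OF drvm, where g="\<lambda>x. real_of_int (sign_of x)"]) simp_all
  moreover have "(\<lambda>\<omega>. of_bool (?t \<omega> = j) :: real) \<in> borel_measurable M" for j
    by (rule measurable_compose[OF drvm, where g="\<lambda>x. of_bool (time_of x = j)"]) simp_all
  moreover have "(\<lambda>\<omega>. of_bool (?w \<omega> = w) :: real) \<in> borel_measurable M" for w
    by (rule measurable_compose[OF drvm, where g="\<lambda>x. of_bool (source_of x = w)"]) simp_all
  ultimately have term_meas: "(\<lambda>\<omega>. ?s \<omega> * (of_bool (?t \<omega> = j) * of_bool (?w \<omega> = w))) \<in> borel_measurable M" for j w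
    by (intro borel_measurable_times)
  have term_int: "integrable M (\<lambda>\<omega>. ?s \<omega> * (of_bool (?t \<omega> = j) * of_bool (?w \<omega> = w)))" for j w
    using term_meas
    by (intro integrable_const_bound[where B=1])
      (auto simp: abs_mult abs_sign_of simp flip: of_int_abs simp del: driver_var.simps)
  have split: "exp (x * y) = cosh x + y * sinh x" if "\<bar>y\<bar> = 1" for y :: real
    using that cosh_plus_sinh[of x] cosh_minus_sinh[of x] by (auto simp: abs_if split: if_splits)
  have select: "(\<Sum>j=1..n. \<Sum>w\<in>UNIV. h j $ w * (y * (of_bool (t = j) * of_bool (z = w)))) = h t $ z * y"
    if "t \<in> {1..n}" for t :: nat and z :: 'k and y :: real
  proof -
    have "(\<Sum>w\<in>UNIV. h j $ w * (y * (of_bool (t = j) * of_bool (z = w)))) = (if t = j then h j $ z * y else 0)" for j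
    proof -
      have "(\<Sum>w\<in>UNIV. h j $ w * (y * (of_bool (t = j) * of_bool (z = w)))) =
          (\<Sum>w\<in>UNIV. if z = w then h j $ w * y * of_bool (t = j) else 0)"
        by (intro sum.cong) auto
      then show ?thesis by simp
    qed
    then show ?thesis using that by (simp only:) simp
  qed
  let ?Z = "\<lambda>\<omega>. \<Sum>j=1..n. \<Sum>w\<in>UNIV. h j $ w * (?s \<omega> * (of_bool (?t \<omega> = j) * of_bool (?w \<omega> = w)))"
  have "AE \<omega> in M. exp (x * (?s \<omega> * hh (min n (?t \<omega>)) (?w \<omega>))) = cosh x + ?Z \<omega> * sinh x"
    using AE_D[OF n, of v]
  proof eventually_elim
    case (elim \<omega>)
    then have t: "?t \<omega> \<in> {1..n}" by (simp add: time_of_def)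
    have "?Z \<omega> = h (?t \<omega>) $ ?w \<omega> * ?s \<omega>" by (rule select[OF t])
    also have "\<dots> = ?s \<omega> * hh (min n (?t \<omega>)) (?w \<omega>)" using t by (simp add: hh min_absorb2 del: driver_var.simps)
    finally have Z: "?Z \<omega> = \<dots>" .
    show ?case unfolding Z by (rule split) (simp add: abs_mult bound abs_sign_of flip: of_int_abs del: driver_var.simps)
  qed
  then have "expectation (\<lambda>\<omega>. exp (x * (?s \<omega> * hh (min n (?t \<omega>)) (?w \<omega>)))) = expectation (\<lambda>\<omega>. cosh x + ?Z \<omega> * sinh x)"
  proof (rule integral_cong_AE[rotated 2])
    show "(\<lambda>\<omega>. cosh x + ?Z \<omega> * sinh x) \<in> borel_measurable M"
      by (intro borel_measurable_add borel_measurable_times borel_measurable_sum borel_measurable_const term_meas)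
    have "(\<lambda>r. exp (x * (real_of_int (sign_of (r (Flip n v))) * hh (min n (time_of (r (Time n v)))) (source_of (r (Source n v))))))
        \<in> borel_measurable (PiM {Flip n v, Time n v, Source n v} (\<lambda>_. count_space (UNIV :: (int + nat + 'k) set)))"
      by (subst PiM_count) auto
    from measurable_compose[OF drv_restrict_measurable this]
    show "(\<lambda>\<omega>. exp (x * (?s \<omega> * hh (min n (?t \<omega>)) (?w \<omega>)))) \<in> borel_measurable M"
      using n by (simp add: drivers_def del: driver_var.simps)
  qed
  also have "\<dots> = cosh x + expectation ?Z * sinh x"
    by (subst Bochner_Integration.integral_add) (auto intro!: Bochner_Integration.integrable_sum integrable_mult_right integrable_mult_left term_int simp: prob_space simp del: driver_var.simps)
  also have "expectation ?Z = (\<Sum>j=1..n. \<Sum>w\<in>UNIV. h j $ w * ((2 * p v - 1) * (1 / n * (of_bool ((w, v) \<in> E) / in_degree E v))))"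
  proof -
    have "expectation ?Z = (\<Sum>j=1..n. \<Sum>w\<in>UNIV. h j $ w * expectation (\<lambda>\<omega>. ?s \<omega> * (of_bool (?t \<omega> = j) * of_bool (?w \<omega> = w))))"
      by (simp add: Bochner_Integration.integral_sum Bochner_Integration.integrable_sum integrable_mult_right term_int del: driver_var.simps)
    also have "\<dots> = (\<Sum>j=1..n. \<Sum>w\<in>UNIV. h j $ w * ((2 * p v - 1) * (1 / n * (of_bool ((w, v) \<in> E) / in_degree E v))))"
      by (intro sum.cong refl arg_cong2[where f="(*)"] expectation_driver_product n)
    finally show ?thesis .
  qed
  also have "\<dots> = ((\<Sum>j=1..n. h j) v* B) $ v / n"
  proof -
    have "((\<Sum>j=1..n. h j) v* B) $ v / n = (\<Sum>w\<in>UNIV. \<Sum>j=1..n. B $ w $ v * h j $ w / n)"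
      by (simp add: vector_matrix_mult_def sum_component sum_distrib_left sum_distrib_right sum_divide_distrib mult.commute)
    also have "\<dots> = (\<Sum>j=1..n. \<Sum>w\<in>UNIV. B $ w $ v * h j $ w / n)" by (rule sum.swap)
    also have "\<dots> = (\<Sum>j=1..n. \<Sum>w\<in>UNIV. h j $ w * ((2 * p v - 1) * (1 / n * (of_bool ((w, v) \<in> E) / in_degree E v))))"
      by (intro sum.cong refl) (simp add: B_def memory_matrix_def mult.commute)
    finally show ?thesis by simp
  qed
  finally show ?thesis .
qed

text \<open>The past and, for every walker, its three new drivers are disjoint blocks and hence
  independent; the index type \<open>'k option\<close> puts them into one product. Once the past is
  fixed, each coordinate of the next step depends on its own block only.\<close>

lemma Y_step:
  fixes h :: "nat \<Rightarrow> real^'k" and x :: "real^'k"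
  assumes n: "n \<ge> 1"
  shows "expectation (\<lambda>\<omega>. indicator {\<omega> \<in> space M. \<forall>j\<in>{1..n}. Y j \<omega> = h j} \<omega> * exp (x \<bullet> Y (Suc n) \<omega>)) =
      prob {\<omega> \<in> space M. \<forall>j\<in>{1..n}. Y j \<omega> = h j} *
      (\<Prod>v\<in>UNIV. cosh (x $ v) + ((\<Sum>j=1..n. h j) v* B) $ v / n * sinh (x $ v))"
proof (cases "{\<omega> \<in> space M. \<forall>j\<in>{1..n}. Y j \<omega> = h j} = {}")
  case True
  then show ?thesis by (simp only: True) simp
next
  case False
  then obtain \<omega>0 where \<omega>0: "\<And>j. j \<in> {1..n} \<Longrightarrow> Y j \<omega>0 = h j" by blast
  \<comment> \<open>The default 1 agrees with \<open>path\<close> at time 0, so the factorisation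
    holds for every \<omega>, even where a time driver is 0.\<close>
  define hh where "hh j w = (if j \<in> {1..n} then h j $ w else 1)" for j w
  have hh1: "\<bar>hh j w\<bar> = 1" for j w
  proof -
    have "\<bar>Y j \<omega>0 $ w\<bar> = 1" using abs_path[of "drv \<omega>0" j w] by (simp add: Y_def flip: of_int_abs)
    then show ?thesis using \<omega>0[of j] by (cases "j \<in> {1..n}") (auto simp: hh_def)
  qed
  define Kb where "Kb i = (case i of None \<Rightarrow> past n | Some v \<Rightarrow> {Flip n v, Time n v, Source n v})" for i :: "'k option"
  have Kb: "Kb i \<subseteq> drivers" "finite (Kb i)" for i
    using past_drivers[of n] n finite_past[of n] by (auto simp: Kb_def drivers_def split: option.split)
  have disj: "disjoint_family_on Kb UNIV"
    unfolding disjoint_family_on_def by (auto simp: Kb_def past_def split: option.splits)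
  define g :: "'k option \<Rightarrow> ('k driver \<Rightarrow> int + nat + 'k) \<Rightarrow> real" where
    "g i r = (case i of None \<Rightarrow> of_bool (\<forall>j\<in>{1..n}. (\<chi> v. real_of_int (path r j v)) = h j)
      | Some v \<Rightarrow> exp (x $ v * (real_of_int (sign_of (r (Flip n v))) *
          hh (min n (time_of (r (Time n v)))) (source_of (r (Source n v))))))" for i r
  let ?r = "\<lambda>i \<omega>. restrict (drv \<omega>) (Kb i)"
  have ind0: "indep_vars (\<lambda>i. PiM (Kb i) (\<lambda>_. count_space UNIV)) ?r UNIV"
    by (rule indep_vars_restrict[OF indep Kb(1) disj])
  have ind: "indep_vars (\<lambda>_. borel) (\<lambda>i \<omega>. g i (?r i \<omega>)) UNIV"
    by (rule indep_vars_compose2[OF ind0]) (simp add: PiM_count[OF Kb(2)])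
  have gNone: "g None (?r None \<omega>) = of_bool (\<forall>j\<in>{1..n}. Y j \<omega> = h j)" for \<omega>
    by (simp add: g_def Kb_def Y_restrict[of _ n])
  have gSome: "g (Some v) (?r (Some v) \<omega>) = exp (x $ v * (real_of_int (sign_of (drv \<omega> (Flip n v))) *
          hh (min n (time_of (drv \<omega> (Time n v)))) (source_of (drv \<omega> (Source n v)))))" for v \<omega>
    by (simp add: g_def Kb_def del: driver_var.simps)
  have bnd: "\<bar>g i r\<bar> \<le> (\<Sum>v\<in>UNIV. exp \<bar>x $ v\<bar>) + 1" for i r
  proof (cases i)
    case None
    then show ?thesis by (simp add: g_def sum_nonneg)
  next
    case (Some v)
    have "\<bar>x $ v * (real_of_int (sign_of (r (Flip n v))) * hh (min n (time_of (r (Time n v)))) (source_of (r (Source n v))))\<bar> = \<bar>x $ v\<bar>"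
      by (simp add: abs_mult hh1 abs_sign_of flip: of_int_abs)
    then have "g i r \<le> exp \<bar>x $ v\<bar>" unfolding Some g_def by (simp add: abs_le_iff)
    also have "\<dots> \<le> (\<Sum>v\<in>UNIV. exp \<bar>x $ v\<bar>)" by (rule member_le_sum) auto
    finally show ?thesis by (simp add: g_def Some)
  qed
  have int: "integrable M (\<lambda>\<omega>. g i (?r i \<omega>))" for i
    using ind bnd by (intro integrable_const_bound[where B="(\<Sum>v\<in>UNIV. exp \<bar>x $ v\<bar>) + 1"]) (auto simp: indep_vars_def)
  have "expectation (\<lambda>\<omega>. indicator {\<omega> \<in> space M. \<forall>j\<in>{1..n}. Y j \<omega> = h j} \<omega> * exp (x \<bullet> Y (Suc n) \<omega>)) =
      expectation (\<lambda>\<omega>. \<Prod>i\<in>UNIV. g i (?r i \<omega>))"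
  proof (rule Bochner_Integration.integral_cong[OF refl])
    fix \<omega> assume \<omega>: "\<omega> \<in> space M"
    have prod: "(\<Prod>i\<in>UNIV. g i (?r i \<omega>)) = g None (?r None \<omega>) * (\<Prod>v\<in>UNIV. g (Some v) (?r (Some v) \<omega>))"
      by (simp add: UNIV_option_conv prod.reindex)
    show "indicator {\<omega> \<in> space M. \<forall>j\<in>{1..n}. Y j \<omega> = h j} \<omega> * exp (x \<bullet> Y (Suc n) \<omega>) = (\<Prod>i\<in>UNIV. g i (?r i \<omega>))"
    proof (cases "\<forall>j\<in>{1..n}. Y j \<omega> = h j")
      case True
      have "g (Some v) (?r (Some v) \<omega>) = exp (x $ v * Y (Suc n) \<omega> $ v)" for v
      proof -
        have "hh j w = real_of_int (path (drv \<omega>) j w)" if "j \<le> n" for j w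
        proof (cases "j = 0")
          case False
          then have "h j = Y j \<omega>" using True that by simp
          then show ?thesis using False that by (simp add: hh_def Y_def)
        qed (simp add: hh_def)
        then show ?thesis unfolding gSome Y_def by (simp add: path_Suc[OF n] del: driver_var.simps)
      qed
      then show ?thesis using True \<omega> unfolding prod gNone by (simp add: inner_vec_def exp_sum)
    next
      case False
      then show ?thesis unfolding prod gNone by (auto simp: indicator_def)
    qed
  qed
  also have "\<dots> = (\<Prod>i\<in>UNIV. expectation (\<lambda>\<omega>. g i (?r i \<omega>)))"
    by (rule indep_vars_lebesgue_integral[OF _ ind int]) simp
  also have "\<dots> = expectation (\<lambda>\<omega>. g None (?r None \<omega>)) * (\<Prod>v\<in>UNIV. expectation (\<lambda>\<omega>. g (Some v) (?r (Some v) \<omega>)))"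
    by (simp add: UNIV_option_conv prod.reindex)
  also have "expectation (\<lambda>\<omega>. g None (?r None \<omega>)) = prob {\<omega> \<in> space M. \<forall>j\<in>{1..n}. Y j \<omega> = h j}"
  proof -
    have "{\<omega> \<in> space M. \<forall>j\<in>{1..n}. Y j \<omega> = h j} \<in> events"
      using Y_measurable by measurable
    moreover have "expectation (\<lambda>\<omega>. g None (?r None \<omega>)) = expectation (indicator {\<omega> \<in> space M. \<forall>j\<in>{1..n}. Y j \<omega> = h j})"
      unfolding gNone by (intro Bochner_Integration.integral_cong refl) (simp add: indicator_def)
    ultimately show ?thesis by simp
  qed
  also have "(\<Prod>v\<in>UNIV. expectation (\<lambda>\<omega>. g (Some v) (?r (Some v) \<omega>))) =
      (\<Prod>v\<in>UNIV. cosh (x $ v) + ((\<Sum>j=1..n. h j) v* B) $ v / n * sinh (x $ v))"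
    unfolding gSome by (intro prod.cong refl expectation_step n hh1) (simp add: hh_def)
  finally show ?thesis .
qed

lemma B_column: "(\<Sum>i\<in>UNIV. \<bar>B $ i $ j\<bar>) \<le> 1"
proof -
  have "(\<Sum>i\<in>UNIV. \<bar>B $ i $ j\<bar>) = (\<Sum>i\<in>in_neighbours E j. \<bar>2 * p j - 1\<bar> / in_degree E j)"
    by (intro sum.mono_neutral_cong_right) (auto simp: B_def memory_matrix_def in_neighbours_def)
  also have "\<dots> = \<bar>2 * p j - 1\<bar>"
    using in_degree_pos[of j] by (auto simp: in_degree_def card_gt_0_iff Suc_le_eq)
  also have "\<dots> \<le> 1" using p_range[of j] by (simp add: abs_le_iff)
  finally show ?thesis .
qed


lemma pm_walk: "max_Re_eigenvalue B < 1 / 2 \<Longrightarrow> pm_walk M B (limit_cov B) Y"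
proof (intro pm_walk.intro pm_walk_axioms.intro prob_space_axioms limit_cov_lyapunov)
  show "\<And>n. Y n \<in> borel_measurable M" by (rule Y_measurable)
  show "\<bar>Y n \<omega> $ v\<bar> = 1" for n \<omega> v
    by (simp add: Y_def abs_path flip: of_int_abs)
qed (use B_column Y_step in auto)

lemma erwg_lil:
  assumes "max_Re_eigenvalue B < 1 / 2"
  shows "AE \<omega> in M. compact (closure (lil_seq X \<omega> ` {3..})) \<and>
    seq_limit_points (lil_seq X \<omega>) = cov_ellipsoid (limit_cov B)"
proof -
  interpret walk: pm_walk M B "limit_cov B" Y by (rule pm_walk[OF assms])
  from walk.lil AE_X_eq_path show ?thesis
  proof eventually_elim
    case (elim \<omega>)
    have "walk.S n \<omega> = erwg_sum X n \<omega>" for n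
      unfolding walk.S_def erwg_sum_def Y_def using elim(2)
      by (intro sum.cong refl) simp
    then have "(\<lambda>n. (1 / lil_scale n) *\<^sub>R walk.S n \<omega>) = lil_seq X \<omega>"
      by (simp add: fun_eq_iff lil_seq_def lil_scale_def)
    then show ?case using elim(1) by (simp only:)
  qed
qed

end

theorem theorem11:
  fixes M :: "'a measure"
    and E :: "('k::finite \<times> 'k) set"
    and p q :: "'k \<Rightarrow> real"
    and \<sigma> :: "'k \<Rightarrow> 'a \<Rightarrow> int"
    and \<xi> :: "nat \<Rightarrow> 'k \<Rightarrow> 'a \<Rightarrow> int"
    and D :: "nat \<Rightarrow> 'k \<Rightarrow> 'a \<Rightarrow> nat"
    and u :: "nat \<Rightarrow> 'k \<Rightarrow> 'a \<Rightarrow> 'k"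
    and X :: "nat \<Rightarrow> 'k \<Rightarrow> 'a \<Rightarrow> int"
    and B :: "real^'k^'k"
  assumes "erwg M E p q \<sigma> \<xi> D u X"
    and "B = memory_matrix E p"
    and "max_Re_eigenvalue B < 1/2"
  shows "AE \<omega> in M.
           compact (closure (lil_seq X \<omega> ` {3..})) \<and>
           seq_limit_points (lil_seq X \<omega>) = cov_ellipsoid (limit_cov B)"
proof -
  interpret erwg M E p q \<sigma> \<xi> D u X by fact
  show ?thesis using erwg_lil assms(3) unfolding B_def assms(2) by blast
qed

end
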